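(* Let $B$ be an infinite punctual Boolean algebra which is relatively computably categorical. Then $\mathrm{PrCat}(B)=\mathrm{Cone}(\Delta^0_1)$.
   Context: Boolean algebras are considered as structures in the language of join, meet, complement, top and bottom. A structure is punctual if its domain is $\omega$ and its functions and relations are uniformly primitive recursive. A computable structure $A$ is relatively computably categorical if for every copy $C\cong A$ with domain $\omega$ there is an isomorphism $f:C\to A$ computable relative to the atomic diagram of $C$. For total $f,g:\omega\to\omega$, write $f\le_{PR}g$ if $f$ is primitive recursive relative to $g$; the induced equivalence classes are PR-degrees, and $f\le_{PR}\mathbf d$ means $f\le_{PR}$ a member of $\mathbf d$. For a punctual structure $A$, $\mathrm{PrCat}(A)$ is the set of PR-degrees $\mathbf d$ such that for every punctual $C\cong A$ there is an isomorphism $f:A\to C$ with $f\le_{PR}\mathbf d$ and $f^{-1}\le_{PR}\mathbf d$. $\mathrm{Cone}(\Delta^0_1)$ is the set of PR-degrees $\mathbf d$ such that $f\le_{PR}\mathbf d$ for every total computable function $f:\omega\to\omega$. *)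

theory Defs
  imports Main "HOL-Library.Nat_Bijection"
begin

text \<open>
  A function of \<open>n\<close> arguments is evaluated on argument lists of length \<open>n\<close>.  For a code of
  arity \<open>n\<close>, the value of \<open>rf_eval\<close> on lists of any other length is irrelevant.
\<close>

datatype rf =
    Zero
  | Succ
  | Proj nat
  | Oracle
  | Comp rf "rf list"
  | PrimRec rf rf
  | Mu rf

fun has_arity :: "rf \<Rightarrow> nat \<Rightarrow> bool" where
  "has_arity Zero n \<longleftrightarrow> True"
| "has_arity Succ n \<longleftrightarrow> n = 1"
| "has_arity (Proj i) n \<longleftrightarrow> i < n"
| "has_arity Oracle n \<longleftrightarrow> n = 1"
| "has_arity (Comp f hs) n \<longleftrightarrow> has_arity f (length hs) \<and> (\<forall>h\<in>set hs. has_arity h n)"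
| "has_arity (PrimRec f h) n \<longleftrightarrow>
     0 < n \<and> has_arity f (n - 1) \<and> has_arity h (Suc n)"
| "has_arity (Mu h) n \<longleftrightarrow> has_arity h (Suc n)"

fun mu_free :: "rf \<Rightarrow> bool" where
  "mu_free (Comp f hs) \<longleftrightarrow> mu_free f \<and> (\<forall>h\<in>set hs. mu_free h)"
| "mu_free (PrimRec f h) \<longleftrightarrow> mu_free f \<and> mu_free h"
| "mu_free (Mu h) \<longleftrightarrow> False"
| "mu_free _ \<longleftrightarrow> True"

fun oracle_free :: "rf \<Rightarrow> bool" where
  "oracle_free Oracle \<longleftrightarrow> False"
| "oracle_free (Comp f hs) \<longleftrightarrow> oracle_free f \<and> (\<forall>h\<in>set hs. oracle_free h)"
| "oracle_free (PrimRec f h) \<longleftrightarrow> oracle_free f \<and> oracle_free h"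
| "oracle_free (Mu h) \<longleftrightarrow> oracle_free h"
| "oracle_free _ \<longleftrightarrow> True"

text \<open>
  \<open>None\<close> means divergence.  The recursion variable of \<open>PrimRec\<close> and the search variable of \<open>Mu\<close>
  are the first argument; the step function of \<open>PrimRec\<close> receives the recursion index, the
  previous value and the parameters.  \<open>Mu\<close> diverges if the function searched diverges before
  its first zero.
\<close>

fun rf_eval :: "(nat \<Rightarrow> nat) \<Rightarrow> rf \<Rightarrow> nat list \<Rightarrow> nat option" where
  "rf_eval g Zero xs = Some 0"
| "rf_eval g Succ xs = Some (Suc (xs ! 0))"
| "rf_eval g (Proj i) xs = Some (xs ! i)"
| "rf_eval g Oracle xs = Some (g (xs ! 0))"
| "rf_eval g (Comp f hs) xs =
     (if \<exists>h\<in>set hs. rf_eval g h xs = None then None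
      else rf_eval g f (map (\<lambda>h. the (rf_eval g h xs)) hs))"
| "rf_eval g (PrimRec f h) xs =
     rec_nat (rf_eval g f (tl xs))
       (\<lambda>k r. Option.bind r (\<lambda>v. rf_eval g h (k # v # tl xs))) (hd xs)"
| "rf_eval g (Mu h) xs =
     (if \<exists>y. rf_eval g h (y # xs) = Some 0 \<and>
             (\<forall>z<y. \<exists>v. rf_eval g h (z # xs) = Some (Suc v))
      then Some (LEAST y. rf_eval g h (y # xs) = Some 0)
      else None)"

definition computes :: "(nat \<Rightarrow> nat) \<Rightarrow> rf \<Rightarrow> nat \<Rightarrow> (nat list \<Rightarrow> nat) \<Rightarrow> bool" where
  "computes g r n F \<longleftrightarrow>
     has_arity r n \<and> (\<forall>xs. length xs = n \<longrightarrow> rf_eval g r xs = Some (F xs))"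

text \<open>For oracle-free codes the oracle supplied to \<open>computes\<close> plays no role.\<close>

definition primitive_recursive :: "nat \<Rightarrow> (nat list \<Rightarrow> nat) \<Rightarrow> bool" where
  "primitive_recursive n F \<longleftrightarrow>
     (\<exists>r. mu_free r \<and> oracle_free r \<and> computes (\<lambda>_. 0) r n F)"

definition computable :: "nat \<Rightarrow> (nat list \<Rightarrow> nat) \<Rightarrow> bool" where
  "computable n F \<longleftrightarrow> (\<exists>r. oracle_free r \<and> computes (\<lambda>_. 0) r n F)"

abbreviation unary :: "(nat \<Rightarrow> nat) \<Rightarrow> nat list \<Rightarrow> nat" where
  "unary f \<equiv> \<lambda>xs. f (xs ! 0)"

abbreviation binary :: "(nat \<Rightarrow> nat \<Rightarrow> nat) \<Rightarrow> nat list \<Rightarrow> nat" where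
  "binary f \<equiv> \<lambda>xs. f (xs ! 0) (xs ! 1)"

definition le_PR :: "(nat \<Rightarrow> nat) \<Rightarrow> (nat \<Rightarrow> nat) \<Rightarrow> bool" (infix "\<le>\<^sub>P\<^sub>R" 50) where
  "f \<le>\<^sub>P\<^sub>R g \<longleftrightarrow> (\<exists>r. mu_free r \<and> computes g r 1 (unary f))"

definition computable_relative_to :: "nat set \<Rightarrow> (nat \<Rightarrow> nat) \<Rightarrow> bool" where
  "computable_relative_to X f \<longleftrightarrow> (\<exists>r. computes (\<lambda>n. of_bool (n \<in> X)) r 1 (unary f))"

definition PR_equivalence :: "((nat \<Rightarrow> nat) \<times> (nat \<Rightarrow> nat)) set" where
  "PR_equivalence = {(f, g). f \<le>\<^sub>P\<^sub>R g \<and> g \<le>\<^sub>P\<^sub>R f}"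

definition PR_degrees :: "(nat \<Rightarrow> nat) set set" where
  "PR_degrees = UNIV // PR_equivalence"

definition le_PR_degree :: "(nat \<Rightarrow> nat) \<Rightarrow> (nat \<Rightarrow> nat) set \<Rightarrow> bool" where
  "le_PR_degree f d \<longleftrightarrow> (\<exists>g\<in>d. f \<le>\<^sub>P\<^sub>R g)"

definition Cone_Delta01 :: "(nat \<Rightarrow> nat) set set" where
  "Cone_Delta01 = {d \<in> PR_degrees. \<forall>f. computable 1 (unary f) \<longrightarrow> le_PR_degree f d}"

text \<open>
  The domain is always the whole type of natural numbers, so every such structure is infinite.
\<close>

record ba_structure =
  ba_join :: "nat \<Rightarrow> nat \<Rightarrow> nat"
  ba_meet :: "nat \<Rightarrow> nat \<Rightarrow> nat"
  ba_compl :: "nat \<Rightarrow> nat"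
  ba_top :: nat
  ba_bot :: nat

definition is_boolean_algebra :: "ba_structure \<Rightarrow> bool" where
  "is_boolean_algebra A \<longleftrightarrow>
     abstract_boolean_algebra (ba_meet A) (ba_join A) (ba_compl A) (ba_bot A) (ba_top A)"

text \<open>
  The language is finite, so uniformity over the symbols is automatic; constants and equality on
  the natural numbers impose no condition.
\<close>

definition punctual :: "ba_structure \<Rightarrow> bool" where
  "punctual A \<longleftrightarrow>
     primitive_recursive 2 (binary (ba_join A)) \<and>
     primitive_recursive 2 (binary (ba_meet A)) \<and>
     primitive_recursive 1 (unary (ba_compl A))"

definition computable_structure :: "ba_structure \<Rightarrow> bool" where
  "computable_structure A \<longleftrightarrow>
     computable 2 (binary (ba_join A)) \<and>
     computable 2 (binary (ba_meet A)) \<and>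
     computable 1 (unary (ba_compl A))"

definition is_iso :: "ba_structure \<Rightarrow> ba_structure \<Rightarrow> (nat \<Rightarrow> nat) \<Rightarrow> bool" where
  "is_iso A C f \<longleftrightarrow>
     bij f \<and>
     (\<forall>x y. f (ba_join A x y) = ba_join C (f x) (f y)) \<and>
     (\<forall>x y. f (ba_meet A x y) = ba_meet C (f x) (f y)) \<and>
     (\<forall>x. f (ba_compl A x) = ba_compl C (f x)) \<and>
     f (ba_top A) = ba_top C \<and>
     f (ba_bot A) = ba_bot C"

definition isomorphic :: "ba_structure \<Rightarrow> ba_structure \<Rightarrow> bool" where
  "isomorphic A C \<longleftrightarrow> (\<exists>f. is_iso A C f)"

text \<open>Closed terms of the language expanded by a constant \<open>Elem n\<close> for each element \<open>n\<close>.\<close>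

datatype ba_term =
    Elem nat
  | Top
  | Bot
  | Compl ba_term
  | Join ba_term ba_term
  | Meet ba_term ba_term

primrec term_val :: "ba_structure \<Rightarrow> ba_term \<Rightarrow> nat" where
  "term_val A (Elem n) = n"
| "term_val A Top = ba_top A"
| "term_val A Bot = ba_bot A"
| "term_val A (Compl t) = ba_compl A (term_val A t)"
| "term_val A (Join s t) = ba_join A (term_val A s) (term_val A t)"
| "term_val A (Meet s t) = ba_meet A (term_val A s) (term_val A t)"

primrec term_code :: "ba_term \<Rightarrow> nat" where
  "term_code (Elem n) = prod_encode (0, n)"
| "term_code Top = prod_encode (1, 0)"
| "term_code Bot = prod_encode (2, 0)"
| "term_code (Compl t) = prod_encode (3, term_code t)"
| "term_code (Join s t) = prod_encode (4, prod_encode (term_code s, term_code t))"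
| "term_code (Meet s t) = prod_encode (5, prod_encode (term_code s, term_code t))"

text \<open>Goedel numbers of the equations \<open>s = t\<close> (tag 0) and negated equations (tag 1).\<close>

definition eq_code :: "ba_term \<Rightarrow> ba_term \<Rightarrow> nat" where
  "eq_code s t = prod_encode (0, prod_encode (term_code s, term_code t))"

definition neq_code :: "ba_term \<Rightarrow> ba_term \<Rightarrow> nat" where
  "neq_code s t = prod_encode (1, prod_encode (term_code s, term_code t))"

definition atomic_diagram :: "ba_structure \<Rightarrow> nat set" where
  "atomic_diagram A =
     {eq_code s t | s t. term_val A s = term_val A t} \<union>
     {neq_code s t | s t. term_val A s \<noteq> term_val A t}"

definition relatively_computably_categorical :: "ba_structure \<Rightarrow> bool" where
  "relatively_computably_categorical A \<longleftrightarrow>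
     computable_structure A \<and>
     (\<forall>C. isomorphic C A \<longrightarrow>
        (\<exists>f. is_iso C A f \<and> computable_relative_to (atomic_diagram C) f))"

definition PrCat :: "ba_structure \<Rightarrow> (nat \<Rightarrow> nat) set set" where
  "PrCat A =
     {d \<in> PR_degrees. \<forall>C. punctual C \<and> isomorphic C A \<longrightarrow>
        (\<exists>f. is_iso A C f \<and> le_PR_degree f d \<and> le_PR_degree (inv f) d)}"

end

theory Submission
  imports Defs Complex_Main "HOL-Library.Countable" "HOL-Library.Infinite_Set"
begin

text \<open>
  A computation of an isomorphism from the atomic diagram uses only finitely many facts about
  finitely many elements.  If \<open>B\<close> had infinitely many atoms, one could therefore build a copy
  of \<open>B\<close> by finite extensions, defeating one algorithm after the other: whenever it commits itself
  to the image of an element that looks like an atom, that element is turned into a join of two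
  atoms, which is invisible to the finitely many facts used so far.  So \<open>B\<close> has finitely many
  atoms, say \<open>n\<close>, and as it is infinite, its isomorphism type is determined by \<open>n\<close>.

  One punctual copy is the interval algebra of a linear order consisting of \<open>n\<close> points followed by
  the dyadic rationals of \<open>[0, 1)\<close>.  Given a total computable function \<open>f\<close>, a second one is
  obtained by relabelling the points such that those of the interval \<open>[1/2, 1)\<close> receive their
  numbers only as the computations of \<open>f 0\<close>, \<open>f 1\<close>, \<open>\<dots>\<close> converge.  The preimage of this interval
  under an isomorphism can be split up by a primitive recursive sequence, so the images of the parts
  bound the convergence times of \<open>f\<close>, and \<open>f\<close> is primitive recursive in the isomorphism.

  Conversely, the atomic diagram of a punctual copy is computable, so relative computable
  categoricity provides computable isomorphisms.
\<close>

section \<open>Closure properties of recursive functions\<close>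

text \<open>Relative categoricity speaks of all copies, so the diagonal copy may be as ineffective
  as needed and plain finite extensions suffice. The obstacle in defeating a code is that no
  equation or inequation already used may change. The change is therefore an endomorphism of the
  algebra, which preserves equations; it forgets the truth value at one atom \<open>a\<close>, and
  inequations survive when another atom \<open>a'\<close> looks like \<open>a\<close> to all
  elements involved. Infinitely many atoms supply such pairs by the pigeonhole principle.

  In the slow copy the isomorphism is arbitrary, so the place of a single image cannot be predicted;
  only counting helps. A code below \<open>N\<close> has end points below \<open>N\<close>, so if
  \<open>c\<close> events occur below \<open>N\<close>, at most \<open>2 ^ c\<close> codes below
  \<open>N\<close> denote elements inside \<open>[1/2, 1)\<close>. Hence \<open>2 ^ Suc m\<close>
  distinct images there force more than \<open>m\<close> events, and with them the convergence on
  \<open>m\<close>. The interval starts at 1/2 because only odd numbers have van der Corput value at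
  least 1/2, so events receive the odd numbers and idle stages the even ones.\<close>

definition recursive_in :: "bool \<Rightarrow> bool \<Rightarrow> (nat \<Rightarrow> nat) \<Rightarrow> nat \<Rightarrow> (nat list \<Rightarrow> nat) \<Rightarrow> bool" where
  "recursive_in mu orc g n F \<longleftrightarrow>
     (\<exists>r. (mu_free r \<or> mu) \<and> (oracle_free r \<or> orc) \<and> computes g r n F)"

named_theorems rec_intros

context
  fixes mu orc :: bool and g :: "nat \<Rightarrow> nat"
begin

private abbreviation R :: "nat \<Rightarrow> (nat list \<Rightarrow> nat) \<Rightarrow> bool" where
  "R \<equiv> recursive_in mu orc g"

lemma rec_cong:
  assumes "R n F" "\<And>xs. length xs = n \<Longrightarrow> F xs = G xs"
  shows "R n G"
  using assms unfolding recursive_in_def computes_def by auto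

lemma rec_eqI: "F = G \<Longrightarrow> R n G \<Longrightarrow> R n F"
  by simp

lemma rec_Comp:
  assumes "R (length Hs) F" "\<And>H. H \<in> set Hs \<Longrightarrow> R n H"
  shows "R n (\<lambda>xs. F (map (\<lambda>H. H xs) Hs))"
proof -
  obtain f where f: "mu_free f \<or> mu" "oracle_free f \<or> orc" "computes g f (length Hs) F"
    using assms(1) unfolding recursive_in_def by blast
  have "\<forall>H\<in>set Hs. \<exists>r. (mu_free r \<or> mu) \<and> (oracle_free r \<or> orc) \<and> computes g r n H"
    using assms(2) unfolding recursive_in_def by blast
  then obtain c where c: "\<And>H. H \<in> set Hs \<Longrightarrow>
      (mu_free (c H) \<or> mu) \<and> (oracle_free (c H) \<or> orc) \<and> computes g (c H) n H"
    by metis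
  have "computes g (Comp f (map c Hs)) n (\<lambda>xs. F (map (\<lambda>H. H xs) Hs))"
    using c f(3) unfolding computes_def by (auto simp: comp_def cong: map_cong)
  moreover have "mu_free (Comp f (map c Hs)) \<or> mu" "oracle_free (Comp f (map c Hs)) \<or> orc"
    using c f by auto
  ultimately show ?thesis unfolding recursive_in_def by blast
qed

lemma rec_unary:
  assumes "R 1 (unary f)" "R n a"
  shows "R n (\<lambda>xs. f (a xs))"
  using rec_Comp[of "[a]" "unary f" n] assms by simp

lemma rec_binary:
  assumes "R 2 (binary f)" "R n a" "R n b"
  shows "R n (\<lambda>xs. f (a xs) (b xs))"
proof -
  have "R n H" if "H \<in> set [a, b]" for H using that assms by auto
  from rec_Comp[of "[a, b]" "binary f", OF _ this] show ?thesis using assms(1) by (simp add: numeral_2_eq_2)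
qed

lemma rec_nth [rec_intros]: "i < n \<Longrightarrow> R n (\<lambda>xs. xs ! i)"
  unfolding recursive_in_def computes_def by (rule exI[of _ "Proj i"]) auto

lemma rec_0: "R n (\<lambda>_. 0)"
  unfolding recursive_in_def computes_def by (rule exI[of _ "Zero"]) auto

lemma rec_Suc [rec_intros]: "R n a \<Longrightarrow> R n (\<lambda>xs. Suc (a xs))"
proof (rule rec_unary[of Suc])
  show "R 1 (unary Suc)"
    unfolding recursive_in_def computes_def by (rule exI[of _ "Succ"]) auto
qed

lemma rec_const [rec_intros]: "R n (\<lambda>_. c)"
  by (induction c) (auto intro: rec_0 rec_Suc)

text \<open>The rules for recursion, sums and bounded quantifiers put their bound variables in front
  of the argument list, so under nested binders a parameter appears as an entry of an iterated
  tail.\<close>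

lemma rec_tl_nth [rec_intros]:
  "Suc i < n \<Longrightarrow> R n (\<lambda>xs. tl xs ! i)"
  "Suc (Suc i) < n \<Longrightarrow> R n (\<lambda>xs. tl (tl xs) ! i)"
  "Suc (Suc (Suc i)) < n \<Longrightarrow> R n (\<lambda>xs. tl (tl (tl xs)) ! i)"
  "Suc (Suc (Suc (Suc i))) < n \<Longrightarrow> R n (\<lambda>xs. tl (tl (tl (tl xs))) ! i)"
  "Suc (Suc (Suc (Suc (Suc i)))) < n \<Longrightarrow> R n (\<lambda>xs. tl (tl (tl (tl (tl xs)))) ! i)"
  by (rule rec_cong[OF rec_nth], assumption, simp add: nth_tl)+

lemma rec_rec_nat [rec_intros]:
  assumes "R n b" "R n a" "R (Suc (Suc n)) (\<lambda>ys. h (ys ! 0) (ys ! 1) (tl (tl ys)))"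
  shows "R n (\<lambda>xs. rec_nat (a xs) (\<lambda>k v. h k v xs) (b xs))"
proof -
  obtain ra where ra: "mu_free ra \<or> mu" "oracle_free ra \<or> orc" "computes g ra n a"
    using assms(2) unfolding recursive_in_def by blast
  obtain rh where rh: "mu_free rh \<or> mu" "oracle_free rh \<or> orc"
      "computes g rh (Suc (Suc n)) (\<lambda>ys. h (ys ! 0) (ys ! 1) (tl (tl ys)))"
    using assms(3) unfolding recursive_in_def by blast
  have eval: "rf_eval g (PrimRec ra rh) (k # xs) = Some (rec_nat (a xs) (\<lambda>k v. h k v xs) k)"
    if "length xs = n" for k xs
    using ra(3) rh(3) that by (induction k) (auto simp: computes_def)
  define F where "F = (\<lambda>ys. rec_nat (a (tl ys)) (\<lambda>k v. h k v (tl ys)) (hd ys))"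
  have "rf_eval g (PrimRec ra rh) ys = Some (F ys)" if "length ys = Suc n" for ys
    using eval[of "tl ys" "hd ys"] that by (cases ys) (auto simp: F_def)
  then have "computes g (PrimRec ra rh) (Suc n) F"
    using ra(3) rh(3) by (auto simp: computes_def)
  then have F: "R (Suc n) F"
    unfolding recursive_in_def using ra rh by (intro exI[of _ "PrimRec ra rh"]) auto
  show ?thesis
  proof (rule rec_cong)
    show "R n (\<lambda>xs. F (map (\<lambda>H. H xs) (b # map (\<lambda>i xs. xs ! i) [0..<n])))"
      by (rule rec_Comp) (auto simp: assms F intro: rec_nth)
    show "F (map (\<lambda>H. H xs) (b # map (\<lambda>i xs. xs ! i) [0..<n])) =
        rec_nat (a xs) (\<lambda>k v. h k v xs) (b xs)" if "length xs = n" for xs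
    proof -
      have "map (\<lambda>H. H xs) (map (\<lambda>i xs. xs ! i) [0..<n]) = xs"
        by (auto intro!: nth_equalityI simp: that)
      then show ?thesis by (simp add: F_def)
    qed
  qed
qed

lemma rec_add [rec_intros]:
  assumes "R n a" "R n b" shows "R n (\<lambda>xs. a xs + b xs)"
proof -
  have "rec_nat x (\<lambda>k v. Suc v) y = x + y" for x y :: nat by (induction y) auto
  then have "(\<lambda>xs. a xs + b xs) = (\<lambda>xs. rec_nat (a xs) (\<lambda>k v. Suc v) (b xs))" by auto
  moreover have "R n (\<lambda>xs. rec_nat (a xs) (\<lambda>k v. Suc v) (b xs))" by (intro rec_intros assms) auto
  ultimately show ?thesis by (rule rec_eqI)
qed

lemma rec_mult [rec_intros]:
  assumes "R n a" "R n b" shows "R n (\<lambda>xs. a xs * b xs)"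
proof (rule rec_binary[of "(*)", OF _ assms])
  have "rec_nat 0 (\<lambda>k v. v + x) y = x * y" for x y :: nat by (induction y) auto
  then have "binary (*) = (\<lambda>xs. rec_nat 0 (\<lambda>k v. v + xs ! 0) (xs ! 1))" by auto
  moreover have "R 2 (\<lambda>xs. rec_nat 0 (\<lambda>k v. v + xs ! 0) (xs ! 1))" by (intro rec_intros) auto
  ultimately show "R 2 (binary (*))" by (rule rec_eqI)
qed

lemma rec_power [rec_intros]:
  assumes "R n a" "R n b" shows "R n (\<lambda>xs. a xs ^ b xs)"
proof (rule rec_binary[of "(^)", OF _ assms])
  have "rec_nat 1 (\<lambda>k v. v * x) y = x ^ y" for x y :: nat by (induction y) auto
  then have "binary (^) = (\<lambda>xs. rec_nat 1 (\<lambda>k v. v * xs ! 0) (xs ! 1))" by auto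
  moreover have "R 2 (\<lambda>xs. rec_nat 1 (\<lambda>k v. v * xs ! 0) (xs ! 1))" by (intro rec_intros) auto
  ultimately show "R 2 (binary (^))" by (rule rec_eqI)
qed

lemma rec_pred:
  assumes "R n a" shows "R n (\<lambda>xs. a xs - 1)"
proof -
  have "rec_nat 0 (\<lambda>k v. k) y = y - 1" for y :: nat by (induction y) auto
  then have "(\<lambda>xs. a xs - 1) = (\<lambda>xs. rec_nat 0 (\<lambda>k v. k) (a xs))" by auto
  moreover have "R n (\<lambda>xs. rec_nat 0 (\<lambda>k v. k) (a xs))" by (intro rec_intros assms) auto
  ultimately show ?thesis by (rule rec_eqI)
qed

lemma rec_diff [rec_intros]:
  assumes "R n a" "R n b" shows "R n (\<lambda>xs. a xs - b xs)"
proof -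
  have "rec_nat x (\<lambda>k v. v - 1) y = x - y" for x y :: nat by (induction y) auto
  then have "(\<lambda>xs. a xs - b xs) = (\<lambda>xs. rec_nat (a xs) (\<lambda>k v. v - 1) (b xs))" by auto
  moreover have "R n (\<lambda>xs. rec_nat (a xs) (\<lambda>k v. v - 1) (b xs))" by (intro rec_intros rec_pred assms) auto
  ultimately show ?thesis by (rule rec_eqI)
qed

lemma rec_sum [rec_intros]:
  assumes "R n b" "R (Suc n) (\<lambda>ys. h (ys ! 0) (tl ys))"
  shows "R n (\<lambda>xs. \<Sum>i<b xs. h i xs)"
proof -
  have "rec_nat 0 (\<lambda>k v. v + h k xs) y = (\<Sum>i<y. h i xs)" for xs y by (induction y) auto
  then have "(\<lambda>xs. \<Sum>i<b xs. h i xs) = (\<lambda>xs. rec_nat 0 (\<lambda>k v. v + h k xs) (b xs))" by auto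
  moreover have "R n (\<lambda>xs. rec_nat 0 (\<lambda>k v. v + h k xs) (b xs))"
  proof (intro rec_intros assms)
    have "R (Suc (Suc n)) (\<lambda>xs. (\<lambda>ys. h (ys ! 0) (tl ys)) (map (\<lambda>H. H xs)
        ((\<lambda>xs. xs ! 0) # map (\<lambda>i xs. xs ! (Suc (Suc i))) [0..<n])))"
      by (rule rec_Comp) (auto simp: assms intro: rec_nth)
    then show "R (Suc (Suc n)) (\<lambda>ys. h (ys ! 0) (tl (tl ys)))"
    proof (rule rec_cong)
      fix xs :: "nat list" assume "length xs = Suc (Suc n)"
      then have "map (\<lambda>H. H xs) (map (\<lambda>i xs. xs ! (Suc (Suc i))) [0..<n]) = tl (tl xs)"
        by (auto intro!: nth_equalityI simp: nth_tl)
      then show "(\<lambda>ys. h (ys ! 0) (tl ys)) (map (\<lambda>H. H xs)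
        ((\<lambda>xs. xs ! 0) # map (\<lambda>i xs. xs ! (Suc (Suc i))) [0..<n])) = h (xs ! 0) (tl (tl xs))"
        by simp
    qed
  qed auto
  ultimately show ?thesis by (rule rec_eqI)
qed

lemma rec_not [rec_intros]:
  assumes "R n (\<lambda>xs. of_bool (P xs))" shows "R n (\<lambda>xs. of_bool (\<not> P xs))"
proof -
  have "(\<lambda>xs. of_bool (\<not> P xs) :: nat) = (\<lambda>xs. 1 - of_bool (P xs))" by auto
  moreover have "R n (\<lambda>xs. 1 - of_bool (P xs))" by (intro rec_intros assms)
  ultimately show ?thesis by (rule rec_eqI)
qed

lemma rec_conj [rec_intros]:
  assumes "R n (\<lambda>xs. of_bool (P xs))" "R n (\<lambda>xs. of_bool (Q xs))"
  shows "R n (\<lambda>xs. of_bool (P xs \<and> Q xs))"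
proof -
  have "(\<lambda>xs. of_bool (P xs \<and> Q xs) :: nat) = (\<lambda>xs. of_bool (P xs) * of_bool (Q xs))" by auto
  moreover have "R n (\<lambda>xs. of_bool (P xs) * of_bool (Q xs))" by (intro rec_intros assms)
  ultimately show ?thesis by (rule rec_eqI)
qed

lemma rec_disj [rec_intros]:
  assumes "R n (\<lambda>xs. of_bool (P xs))" "R n (\<lambda>xs. of_bool (Q xs))"
  shows "R n (\<lambda>xs. of_bool (P xs \<or> Q xs))"
proof -
  have "(\<lambda>xs. of_bool (P xs \<or> Q xs) :: nat) = (\<lambda>xs. of_bool (\<not> (\<not> P xs \<and> \<not> Q xs)))" by auto
  moreover have "R n (\<lambda>xs. of_bool (\<not> (\<not> P xs \<and> \<not> Q xs)))" by (intro rec_intros assms)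
  ultimately show ?thesis by (rule rec_eqI)
qed

lemma rec_le [rec_intros]:
  assumes "R n a" "R n b" shows "R n (\<lambda>xs. of_bool (a xs \<le> b xs))"
proof -
  have "(\<lambda>xs. of_bool (a xs \<le> b xs) :: nat) = (\<lambda>xs. 1 - (a xs - b xs))" by auto
  moreover have "R n (\<lambda>xs. 1 - (a xs - b xs))" by (intro rec_intros assms)
  ultimately show ?thesis by (rule rec_eqI)
qed

lemma rec_less [rec_intros]:
  assumes "R n a" "R n b" shows "R n (\<lambda>xs. of_bool (a xs < b xs))"
  using rec_le[of n "\<lambda>xs. Suc (a xs)" b] assms by (simp add: rec_intros Suc_le_eq)

lemma rec_eq [rec_intros]:
  assumes "R n a" "R n b" shows "R n (\<lambda>xs. of_bool (a xs = b xs))"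
  using rec_conj[OF rec_le[of n a b] rec_le[of n b a]] assms by (simp add: order_eq_iff)

lemma rec_if [rec_intros]:
  assumes "R n (\<lambda>xs. of_bool (P xs))" "R n a" "R n b"
  shows "R n (\<lambda>xs. if P xs then a xs else b xs)"
proof -
  have "(\<lambda>xs. if P xs then a xs else b xs) =
      (\<lambda>xs. of_bool (P xs) * a xs + of_bool (\<not> P xs) * b xs)" by auto
  moreover have "R n (\<lambda>xs. of_bool (P xs) * a xs + of_bool (\<not> P xs) * b xs)" by (intro rec_intros assms)
  ultimately show ?thesis by (rule rec_eqI)
qed

lemma rec_all_less [rec_intros]:
  assumes "R n b" "R (Suc n) (\<lambda>ys. of_bool (P (ys ! 0) (tl ys)))"
  shows "R n (\<lambda>xs. of_bool (\<forall>i<b xs. P i xs))"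
proof -
  have "(\<lambda>xs. of_bool (\<forall>i<b xs. P i xs) :: nat) =
      (\<lambda>xs. of_bool ((\<Sum>i<b xs. of_bool (\<not> P i xs)) = (0 :: nat)))"
    by (intro ext arg_cong[of _ _ of_bool]) (auto simp del: sum_of_bool_eq)
  moreover have "R n (\<lambda>xs. of_bool ((\<Sum>i<b xs. of_bool (\<not> P i xs)) = (0 :: nat)))" by (intro rec_intros assms)
  ultimately show ?thesis by (rule rec_eqI)
qed

lemma rec_div [rec_intros]:
  assumes "R n a" "R n b" shows "R n (\<lambda>xs. a xs div b xs)"
proof -
  \<comment> \<open>The quotient counts the positive multiples of \<open>y\<close> up to
    \<open>x\<close>; the guard keeps the count at 0 when \<open>y = 0\<close>, the value of
    division by zero.\<close>
  have *: "x div y = (\<Sum>k<x. of_bool (0 < y \<and> Suc k * y \<le> x))" for x y :: nat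
  proof (cases "y = 0")
    case False
    have iff: "Suc k * y \<le> x \<longleftrightarrow> k < x div y" for k
      using False less_eq_div_iff_mult_less_eq[of y "Suc k" x] by (simp only: Suc_le_eq)
    have "(\<Sum>k<x. of_bool (0 < y \<and> Suc k * y \<le> x)) = card ({..<x} \<inter> {..<x div y})"
      using False by (simp only: iff) (simp add: lessThan_def)
    also have "{..<x} \<inter> {..<x div y} = {..<x div y}"
      by (metis Int_absorb1 div_le_dividend lessThan_subset_iff)
    finally show ?thesis by simp
  qed simp
  have "R n (\<lambda>xs. \<Sum>k<a xs. of_bool (0 < b xs \<and> Suc k * b xs \<le> a xs))"
    if "R n a" "R n b" for a b n
  proof (rule rec_binary[of "\<lambda>x y. \<Sum>k<x. of_bool (0 < y \<and> Suc k * y \<le> x)", OF _ that])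
    show "R 2 (binary (\<lambda>x y. \<Sum>k<x. of_bool (0 < y \<and> Suc k * y \<le> x)))"
      by (intro rec_intros) auto
  qed
  then show ?thesis using assms unfolding * .
qed

lemma rec_odd [rec_intros]:
  assumes "R n a" shows "R n (\<lambda>xs. of_bool (odd (a xs)))"
proof -
  have "of_bool (odd x) = x - 2 * (x div 2)" for x :: nat
    using minus_mult_div_eq_mod[of x 2] mod_2_eq_odd[of x] by simp
  then show ?thesis using assms by (simp add: rec_intros)
qed

lemma rec_even [rec_intros]:
  assumes "R n a" shows "R n (\<lambda>xs. of_bool (even (a xs)))"
  using rec_not[OF rec_odd[OF assms]] by simp

lemma rec_Mu:
  assumes "R (Suc n) F" "mu" "\<And>xs. length xs = n \<Longrightarrow> \<exists>y. F (y # xs) = 0"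
  shows "R n (\<lambda>xs. LEAST y. F (y # xs) = 0)"
proof -
  obtain r where r: "oracle_free r \<or> orc" "computes g r (Suc n) F"
    using assms(1) unfolding recursive_in_def by blast
  have "computes g (Mu r) n (\<lambda>xs. LEAST y. F (y # xs) = 0)"
    unfolding computes_def
  proof (intro conjI allI impI)
    show "has_arity (Mu r) n" using r(2) by (simp add: computes_def)
    fix xs :: "nat list" assume len: "length xs = n"
    then have eval: "rf_eval g r (y # xs) = Some (F (y # xs))" for y
      using r(2) by (simp add: computes_def)
    obtain y where "F (y # xs) = 0" using assms(3) len by blast
    then have "F ((LEAST y. F (y # xs) = 0) # xs) = 0" by (rule LeastI)
    moreover have "\<forall>z<LEAST y. F (y # xs) = 0. \<exists>v. F (z # xs) = Suc v"
      using not_less_Least not0_implies_Suc by blast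
    ultimately have "\<exists>y. F (y # xs) = 0 \<and> (\<forall>z<y. \<exists>v. F (z # xs) = Suc v)" by blast
    then show "rf_eval g (Mu r) xs = Some (LEAST y. F (y # xs) = 0)"
      unfolding rf_eval.simps eval option.inject by (rule if_P)
  qed
  then show ?thesis using r(1) assms(2) unfolding recursive_in_def
    by (intro exI[of _ "Mu r"]) auto
qed

lemma rec_oracle: "orc \<Longrightarrow> R 1 (unary g)"
  unfolding recursive_in_def computes_def by (rule exI[of _ "Oracle"]) auto

text \<open>Serves compositions in which the number of parameters passed on is a variable, so that
  the projections cannot be listed one by one.\<close>

lemma rec_append_drop:
  assumes "R (length Hs + (n - k)) F" "\<And>H. H \<in> set Hs \<Longrightarrow> R n H" "k \<le> n"
  shows "R n (\<lambda>xs. F (map (\<lambda>H. H xs) Hs @ drop k xs))"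
proof (rule rec_cong)
  let ?Hs = "Hs @ map (\<lambda>i xs. xs ! i) [k..<n]"
  show "R n (\<lambda>xs. F (map (\<lambda>H. H xs) ?Hs))"
    by (rule rec_Comp) (use assms in \<open>auto intro: rec_nth\<close>)
  show "F (map (\<lambda>H. H xs) ?Hs) = F (map (\<lambda>H. H xs) Hs @ drop k xs)" if "length xs = n" for xs
  proof -
    have "map (\<lambda>H. H xs) (map (\<lambda>i xs. xs ! i) [k..<n]) = drop k xs"
      using assms(3) that by (auto intro!: nth_equalityI)
    then show ?thesis by simp
  qed
qed

lemma rec_ball_list:
  assumes "\<And>H. H \<in> set Hs \<Longrightarrow> R n (\<lambda>xs. of_bool (P H xs))"
  shows "R n (\<lambda>xs. of_bool (\<forall>H\<in>set Hs. P H xs))"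
  using assms by (induction Hs) (auto intro: rec_const rec_conj simp del: of_bool_conj)

lemma rec_prod_encode [rec_intros]:
  assumes "R n a" "R n b" shows "R n (\<lambda>xs. prod_encode (a xs, b xs))"
  unfolding prod_encode_def triangle_def by (simp, intro rec_intros assms)

text \<open>Decoding is a bounded search: both components are at most the code and exactly one pair
  has this code, so a single summand survives.\<close>

lemma sum_prod_decode:
  fixes h :: "nat \<Rightarrow> nat \<Rightarrow> nat"
  shows "(\<Sum>i<Suc x. \<Sum>j<Suc x. h i j * of_bool (prod_encode (i, j) = x)) =
    h (fst (prod_decode x)) (snd (prod_decode x))"
proof -
  obtain i0 j0 where x: "x = prod_encode (i0, j0)" by (metis prod_decode_inverse surj_pair)
  have le: "i0 < Suc x" "j0 < Suc x" using x le_prod_encode_1 le_prod_encode_2 by (auto simp: less_Suc_eq_le)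
  have "h i j * of_bool (prod_encode (i, j) = x) = (if j = j0 then if i = i0 then h i0 j0 else 0 else 0)" for i j
    by (auto simp: x)
  then have "(\<Sum>i<Suc x. \<Sum>j<Suc x. h i j * of_bool (prod_encode (i, j) = x)) =
      (\<Sum>i<Suc x. \<Sum>j<Suc x. if j = j0 then if i = i0 then h i0 j0 else 0 else 0)"
    by (simp only:)
  also have "\<dots> = h i0 j0" using le by (simp only: sum.delta finite_lessThan lessThan_iff if_True)
  finally show ?thesis by (simp add: x)
qed

lemma rec_fst_prod_decode [rec_intros]:
  assumes "R n a" shows "R n (\<lambda>xs. fst (prod_decode (a xs)))"
  unfolding sum_prod_decode[where h = "\<lambda>i j. i", symmetric]
proof (rule rec_unary[of "\<lambda>x. \<Sum>i<Suc x. \<Sum>j<Suc x. i * of_bool (prod_encode (i, j) = x)", OF _ assms])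
  show "R 1 (\<lambda>xs. \<Sum>i<Suc (xs ! 0). \<Sum>j<Suc (xs ! 0). i * of_bool (prod_encode (i, j) = xs ! 0))"
    by (intro rec_intros) auto
qed

lemma rec_snd_prod_decode [rec_intros]:
  assumes "R n a" shows "R n (\<lambda>xs. snd (prod_decode (a xs)))"
  unfolding sum_prod_decode[where h = "\<lambda>i j. j", symmetric]
proof (rule rec_unary[of "\<lambda>x. \<Sum>i<Suc x. \<Sum>j<Suc x. j * of_bool (prod_encode (i, j) = x)", OF _ assms])
  show "R 1 (\<lambda>xs. \<Sum>i<Suc (xs ! 0). \<Sum>j<Suc (xs ! 0). j * of_bool (prod_encode (i, j) = xs ! 0))"
    by (intro rec_intros) auto
qed

end


section \<open>Independence of the oracle and substitution for it\<close>

lemma rf_eval_oracle_free: "oracle_free r \<Longrightarrow> rf_eval g r xs = rf_eval g' r xs"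
proof (induction r arbitrary: xs)
  case (Comp f hs)
  then have "\<And>h. h \<in> set hs \<Longrightarrow> rf_eval g h xs = rf_eval g' h xs" by auto
  with Comp show ?case by (auto cong: map_cong)
next
  case (PrimRec f h)
  then show ?case by simp
next
  case (Mu h)
  then have "rf_eval g h ys = rf_eval g' h ys" for ys by simp
  then show ?case by (simp only: rf_eval.simps)
qed auto

lemma computes_oracle_free:
  "oracle_free r \<Longrightarrow> computes (\<lambda>_. 0) r n F \<longleftrightarrow> computes g r n F"
  unfolding computes_def by (simp only: rf_eval_oracle_free[of r "\<lambda>_. 0" _ g])

text \<open>All notions of the statement become instances of one predicate and share its closure
  rules. The oracle \<open>g\<close> is arbitrary, as oracle-free codes never consult it.\<close>

lemma primitive_recursive_iff: "primitive_recursive n F \<longleftrightarrow> recursive_in False False g n F"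
  unfolding primitive_recursive_def recursive_in_def
  using computes_oracle_free[of _ n F g] by blast

lemma computable_iff: "computable n F \<longleftrightarrow> recursive_in True False g n F"
  unfolding computable_def recursive_in_def
  using computes_oracle_free[of _ n F g] by blast

lemma le_PR_iff: "f \<le>\<^sub>P\<^sub>R g \<longleftrightarrow> recursive_in False True g 1 (unary f)"
  unfolding le_PR_def recursive_in_def by simp

lemma recursive_in_mono:
  "recursive_in mu orc g n F \<Longrightarrow> (mu \<Longrightarrow> mu') \<Longrightarrow> (orc \<Longrightarrow> orc') \<Longrightarrow> recursive_in mu' orc' g n F"
  unfolding recursive_in_def by blast

lemma recursive_in_primitive: "primitive_recursive n F \<Longrightarrow> recursive_in mu orc g n F"
  by (auto simp: primitive_recursive_iff[of _ _ g] intro: recursive_in_mono)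

primrec subst_oracle :: "rf \<Rightarrow> rf \<Rightarrow> rf" where
  "subst_oracle o' Zero = Zero"
| "subst_oracle o' Succ = Succ"
| "subst_oracle o' (Proj i) = Proj i"
| "subst_oracle o' Oracle = o'"
| "subst_oracle o' (Comp f hs) = Comp (subst_oracle o' f) (map (subst_oracle o') hs)"
| "subst_oracle o' (PrimRec f h) = PrimRec (subst_oracle o' f) (subst_oracle o' h)"
| "subst_oracle o' (Mu h) = Mu (subst_oracle o' h)"

lemma rf_eval_subst_oracle:
  assumes "computes g o' 1 (unary p)" "has_arity r (length xs)"
  shows "rf_eval g (subst_oracle o' r) xs = rf_eval p r xs"
  using assms(2)
proof (induction r arbitrary: xs)
  case Oracle
  then show ?case using assms(1) by (auto simp: computes_def)
next
  case (Comp f hs)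
  then have "\<And>h. h \<in> set hs \<Longrightarrow> rf_eval g (subst_oracle o' h) xs = rf_eval p h xs" by auto
  with Comp show ?case by (auto simp: comp_def cong: map_cong)
next
  case (PrimRec f h)
  then have *: "rf_eval g (subst_oracle o' f) (tl xs) = rf_eval p f (tl xs)"
    "rf_eval g (subst_oracle o' h) (k # v # tl xs) = rf_eval p h (k # v # tl xs)" for k v
    by auto
  show ?case by (simp add: *)
next
  case (Mu h)
  then have "rf_eval g (subst_oracle o' h) (y # xs) = rf_eval p h (y # xs)" for y by simp
  then show ?case by (simp only: subst_oracle.simps rf_eval.simps)
qed auto

text \<open>Oracle calls are replaced by a code for the oracle. This yields transitivity of the
  reducibility and also the removal of a computable oracle.\<close>

lemma recursive_in_trans:
  assumes "recursive_in mu True p n F" "recursive_in mu orc g 1 (unary p)"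
  shows "recursive_in mu orc g n F"
proof -
  obtain r where r: "mu_free r \<or> mu" "computes p r n F"
    using assms(1) unfolding recursive_in_def by blast
  obtain s where s: "mu_free s \<or> mu" "oracle_free s \<or> orc" "computes g s 1 (unary p)"
    using assms(2) unfolding recursive_in_def by blast
  have "mu_free (subst_oracle s r) \<or> mu" using s(1) r(1) by (cases mu) (simp, induction r, auto)
  moreover have "oracle_free (subst_oracle s r) \<or> orc" using s(2) by (cases orc) (simp, induction r, auto)
  moreover have "has_arity (subst_oracle s r) n"
  proof -
    have "has_arity r n" using r(2) by (simp add: computes_def)
    moreover have "has_arity s 1" using s(3) by (simp add: computes_def)
    ultimately show ?thesis by (induction r arbitrary: n) auto
  qed
  moreover have "rf_eval g (subst_oracle s r) xs = Some (F xs)" if "length xs = n" for xs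
    using rf_eval_subst_oracle[OF s(3), of r xs] r(2) that by (simp add: computes_def)
  ultimately show ?thesis
    unfolding recursive_in_def computes_def by blast
qed

section \<open>Use principle and stagewise approximation\<close>

text \<open>Naming the intermediate values splits convergence into finitely many separate facts,
  which suits the inductions below better than the conditional in \<open>rf_eval\<close>. The lemmas
  on \<open>Mu\<close> and \<open>PrimRec\<close> have the same purpose.\<close>

lemma rf_eval_Comp_iff:
  "rf_eval g (Comp f hs) xs = Some v \<longleftrightarrow>
     (\<exists>u. (\<forall>h\<in>set hs. rf_eval g h xs = Some (u h)) \<and> rf_eval g f (map u hs) = Some v)"
proof
  assume *: "rf_eval g (Comp f hs) xs = Some v"
  then have ex: "\<forall>h\<in>set hs. rf_eval g h xs \<noteq> None" by (auto split: if_splits)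
  then have "\<forall>h\<in>set hs. rf_eval g h xs = Some (the (rf_eval g h xs))" by auto
  moreover have "rf_eval g f (map (\<lambda>h. the (rf_eval g h xs)) hs) = Some v"
    using * ex by auto
  ultimately show "\<exists>u. (\<forall>h\<in>set hs. rf_eval g h xs = Some (u h)) \<and> rf_eval g f (map u hs) = Some v"
    by (intro exI[of _ "\<lambda>h. the (rf_eval g h xs)"] conjI)
next
  assume "\<exists>u. (\<forall>h\<in>set hs. rf_eval g h xs = Some (u h)) \<and> rf_eval g f (map u hs) = Some v"
  then obtain u where u: "\<forall>h\<in>set hs. rf_eval g h xs = Some (u h)" "rf_eval g f (map u hs) = Some v"
    by blast
  then have "map (\<lambda>h. the (rf_eval g h xs)) hs = map u hs" by auto
  then have "rf_eval g f (map (\<lambda>h. the (rf_eval g h xs)) hs) = Some v"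
    using u(2) by (simp only:)
  moreover have "\<not> (\<exists>h\<in>set hs. rf_eval g h xs = None)" using u(1) by auto
  ultimately show "rf_eval g (Comp f hs) xs = Some v"
    by (simp only: rf_eval.simps if_False)
qed

lemma rf_eval_Mu_iff:
  "rf_eval g (Mu h) xs = Some y \<longleftrightarrow>
     rf_eval g h (y # xs) = Some 0 \<and> (\<forall>z<y. \<exists>v. rf_eval g h (z # xs) = Some (Suc v))"
proof -
  let ?P = "\<lambda>y. rf_eval g h (y # xs) = Some 0 \<and> (\<forall>z<y. \<exists>v. rf_eval g h (z # xs) = Some (Suc v))"
  have least: "(LEAST y. rf_eval g h (y # xs) = Some 0) = y" if "?P y" for y
  proof (rule Least_equality)
    show "y \<le> z" if "rf_eval g h (z # xs) = Some 0" for z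
      using \<open>?P y\<close> that by (metis not_less option.inject nat.distinct(1))
  qed (use that in blast)
  have eq: "rf_eval g (Mu h) xs =
      (if \<exists>y. ?P y then Some (LEAST y. rf_eval g h (y # xs) = Some 0) else None)"
    by (simp only: rf_eval.simps)
  show ?thesis
  proof
    assume "?P y"
    then show "rf_eval g (Mu h) xs = Some y" unfolding eq using least by auto
  next
    assume *: "rf_eval g (Mu h) xs = Some y"
    have "\<exists>y. ?P y"
    proof (rule ccontr)
      assume "\<not> (\<exists>y. ?P y)"
      with * show False unfolding eq by (simp only: if_False option.distinct)
    qed
    then obtain y' where y': "?P y'" by blast
    have "rf_eval g (Mu h) xs = Some (LEAST y. rf_eval g h (y # xs) = Some 0)"
      unfolding eq by (rule if_P) (use y' in blast)
    with * least[OF y'] have "y' = y" by simp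
    with y' show "?P y" by simp
  qed
qed

lemma rf_eval_PrimRec_Suc:
  "rf_eval g (PrimRec f h) (Suc k # xs) = Some v \<longleftrightarrow>
     (\<exists>u. rf_eval g (PrimRec f h) (k # xs) = Some u \<and> rf_eval g h (k # u # xs) = Some v)"
  by (auto simp: bind_eq_Some_conv)

declare rf_eval.simps(5-7) [simp del]

lemma finite_uniform_bound:
  fixes P :: "'a \<Rightarrow> nat \<Rightarrow> bool"
  assumes "finite S" "\<And>x. x \<in> S \<Longrightarrow> \<exists>s. P x s" "\<And>x s t. P x s \<Longrightarrow> s \<le> t \<Longrightarrow> P x t"
  obtains s where "\<And>x. x \<in> S \<Longrightarrow> P x s"
proof -
  obtain c where c: "\<And>x. x \<in> S \<Longrightarrow> P x (c x)" using assms(2) by metis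
  have "P x (\<Sum>x\<in>S. c x)" if "x \<in> S" for x
    using assms(3)[OF c[OF that]] member_le_sum[of x S c] assms(1) that by simp
  then show ?thesis by (rule that)
qed

text \<open>A convergent computation has a finite evaluation tree, so it suffices that
  \<open>m\<close> exceeds all oracle queries made in it.\<close>

lemma use_principle:
  assumes "rf_eval g r xs = Some v"
  obtains m where "\<And>g'. (\<And>i. i < m \<Longrightarrow> g' i = g i) \<Longrightarrow> rf_eval g' r xs = Some v"
proof -
  let ?U = "\<lambda>r xs v m. \<forall>g'. (\<forall>i<m. g' i = g i) \<longrightarrow> rf_eval g' r xs = Some v"
  have mono: "?U r xs v m \<Longrightarrow> m \<le> m' \<Longrightarrow> ?U r xs v m'" for r xs v m m'
    by (meson order_less_le_trans)
  have "\<exists>m. ?U r xs v m"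
    using assms
  proof (induction r arbitrary: xs v)
    case Oracle
    then have "v = g (xs ! 0)" by simp
    then have "?U Oracle xs v (Suc (xs ! 0))" by simp
    then show ?case by blast
  next
    case (Comp f hs)
    then obtain u where u: "\<forall>h\<in>set hs. rf_eval g h xs = Some (u h)" "rf_eval g f (map u hs) = Some v"
      by (auto simp: rf_eval_Comp_iff)
    obtain m where m: "\<And>h. h \<in> set hs \<Longrightarrow> ?U h xs (u h) m"
    proof (rule finite_uniform_bound[of "set hs" "\<lambda>h. ?U h xs (u h)"])
      show "\<And>h. h \<in> set hs \<Longrightarrow> \<exists>m. ?U h xs (u h) m" using Comp.IH(2) u(1) by blast
    qed (simp, erule (1) mono, blast)
    obtain m' where m': "?U f (map u hs) v m'" using Comp.IH(1) u(2) by blast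
    have "?U (Comp f hs) xs v (max m m')"
      using m mono[OF m'] unfolding rf_eval_Comp_iff by (meson max.cobounded1 max.cobounded2 order_less_le_trans)
    then show ?case by blast
  next
    case (PrimRec f h)
    have step: "\<exists>m. ?U (PrimRec f h) (k # ps) v m" if "rf_eval g (PrimRec f h) (k # ps) = Some v" for k ps v
      using that
    proof (induction k arbitrary: v)
      case 0
      then show ?case using PrimRec.IH(1)[of ps v] by (simp add: rf_eval.simps)
    next
      case (Suc k)
      then obtain u where u: "rf_eval g (PrimRec f h) (k # ps) = Some u" "rf_eval g h (k # u # ps) = Some v"
        unfolding rf_eval_PrimRec_Suc by blast
      obtain m where m: "?U (PrimRec f h) (k # ps) u m" using Suc.IH u(1) by blast
      obtain m' where m': "?U h (k # u # ps) v m'" using PrimRec.IH(2) u(2) by blast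
      have "?U (PrimRec f h) (Suc k # ps) v (max m m')"
        unfolding rf_eval_PrimRec_Suc using mono[OF m, of "max m m'"] mono[OF m', of "max m m'"] by auto
      then show ?case by blast
    qed
    \<comment> \<open>The list may be empty; \<open>PrimRec\<close> sees it only through
      \<open>hd\<close> and \<open>tl\<close>.\<close>
    have eq: "rf_eval g' (PrimRec f h) xs = rf_eval g' (PrimRec f h) (hd xs # tl xs)" for g'
      by (simp add: rf_eval.simps)
    show ?case using step PrimRec.prems unfolding eq by blast
  next
    case (Mu h)
    then have y: "rf_eval g h (v # xs) = Some 0" "\<forall>z<v. \<exists>w. rf_eval g h (z # xs) = Some (Suc w)"
      by (auto simp: rf_eval_Mu_iff)
    then obtain w where w: "\<And>z. z < v \<Longrightarrow> rf_eval g h (z # xs) = Some (Suc (w z))" by metis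
    obtain m where m: "\<And>z. z \<in> {..<v} \<Longrightarrow> ?U h (z # xs) (Suc (w z)) m"
    proof (rule finite_uniform_bound[of "{..<v}" "\<lambda>z. ?U h (z # xs) (Suc (w z))"])
      show "\<And>z. z \<in> {..<v} \<Longrightarrow> \<exists>m. ?U h (z # xs) (Suc (w z)) m" using Mu.IH w by blast
    qed (simp, erule (1) mono, blast)
    obtain m' where m': "?U h (v # xs) 0 m'" using Mu.IH y(1) by blast
    have "?U (Mu h) xs v (max m m')"
      unfolding rf_eval_Mu_iff using mono[OF m, of _ "max m m'"] mono[OF m', of "max m m'"]
      by (meson lessThan_iff max.cobounded1 max.cobounded2)
    then show ?case by blast
  qed auto
  then show ?thesis using that by blast
qed

text \<open>The value of \<open>A\<close> at stage \<open>s\<close> is \<open>0\<close> as long as the computation has not been seen to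
  converge, and \<open>Suc v\<close> once the output \<open>v\<close> has been found.\<close>

definition stagewise :: "nat \<Rightarrow> (nat list \<Rightarrow> nat) \<Rightarrow> (nat list \<Rightarrow> nat option) \<Rightarrow> bool" where
  "stagewise n A e \<longleftrightarrow>
     (\<forall>xs s t v. length xs = n \<longrightarrow> A (s # xs) = Suc v \<longrightarrow> s \<le> t \<longrightarrow> A (t # xs) = Suc v) \<and>
     (\<forall>xs v. length xs = n \<longrightarrow> e xs = Some v \<longleftrightarrow> (\<exists>s. A (s # xs) = Suc v))"

lemma stagewise_mono: "stagewise n A e \<Longrightarrow> length xs = n \<Longrightarrow> A (s # xs) = Suc v \<Longrightarrow> s \<le> t \<Longrightarrow> A (t # xs) = Suc v"
  unfolding stagewise_def by blast

lemma stagewise_iff: "stagewise n A e \<Longrightarrow> length xs = n \<Longrightarrow> e xs = Some v \<longleftrightarrow> (\<exists>s. A (s # xs) = Suc v)"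
  unfolding stagewise_def by blast

text \<open>A bounded search written as a sum; the shift by one leaves 0 to report that nothing was
  found, as in \<open>stagewise\<close>.\<close>

lemma sum_unique_index:
  fixes P :: "nat \<Rightarrow> bool"
  assumes "\<And>y z. P y \<Longrightarrow> P z \<Longrightarrow> y = z"
  shows "(\<Sum>y<s. of_bool (P y) * Suc y) = Suc v \<longleftrightarrow> v < s \<and> P v"
proof (cases "\<exists>y<s. P y")
  case True
  then obtain y where y: "y < s" "P y" by blast
  then have "(\<Sum>z<s. of_bool (P z) * Suc z) = (\<Sum>z<s. if z = y then Suc y else 0)"
    using assms by (intro sum.cong) auto
  then show ?thesis using y assms by auto
next
  case False
  then have "(\<Sum>z<s. of_bool (P z) * Suc z) = (\<Sum>z<s. 0 :: nat)" by (intro sum.cong) auto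
  then show ?thesis using False by auto
qed

text \<open>A form of Kleene's normal form theorem. All subcomputations receive the same stage, and
  by monotonicity the maximum of finitely many stages serves for all of them; an unbounded search at
  stage \<open>s\<close> inspects only candidates below \<open>s\<close>.\<close>

lemma stagewise_approximation:
  assumes "oracle_free r" "has_arity r n"
  shows "\<exists>A. recursive_in False False g (Suc n) A \<and> stagewise n A (rf_eval g r)"
  using assms
proof (induction r arbitrary: n)
  case Zero
  show ?case
    by (rule exI[of _ "\<lambda>_. Suc 0"]) (auto simp: stagewise_def intro: rec_intros)
next
  case Succ
  then show ?case
    by (intro exI[of _ "\<lambda>ys. Suc (Suc (ys ! 1))"]) (auto simp: stagewise_def intro!: rec_intros)
next
  case (Proj i)
  then show ?case
    by (intro exI[of _ "\<lambda>ys. Suc (ys ! Suc i)"]) (auto simp: stagewise_def intro!: rec_intros)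
next
  case Oracle
  then show ?case by simp
next
  case (Comp f hs)
  then obtain Af where Af: "recursive_in False False g (Suc (length hs)) Af"
      "stagewise (length hs) Af (rf_eval g f)"
    by fastforce
  have "\<exists>A. recursive_in False False g (Suc n) A \<and> stagewise n A (rf_eval g h)" if "h \<in> set hs" for h
    using Comp that by auto
  then obtain Ah where Ah: "\<And>h. h \<in> set hs \<Longrightarrow> recursive_in False False g (Suc n) (Ah h)"
      "\<And>h. h \<in> set hs \<Longrightarrow> stagewise n (Ah h) (rf_eval g h)"
    by metis
  define A where "A = (\<lambda>ys. if \<forall>h\<in>set hs. 0 < Ah h ys
      then Af (map (\<lambda>H. H ys) ((\<lambda>ys. ys ! 0) # map (\<lambda>h ys. Ah h ys - 1) hs)) else 0)"
  have A_iff: "A (s # xs) = Suc v \<longleftrightarrow>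
      (\<exists>u. (\<forall>h\<in>set hs. Ah h (s # xs) = Suc (u h)) \<and> Af (s # map u hs) = Suc v)" for s xs v
  proof
    assume *: "A (s # xs) = Suc v"
    then have "\<forall>h\<in>set hs. Ah h (s # xs) = Suc (Ah h (s # xs) - 1)"
      by (auto simp: A_def split: if_splits)
    moreover have "Af (s # map (\<lambda>h. Ah h (s # xs) - 1) hs) = Suc v"
      using * by (auto simp: A_def comp_def split: if_splits)
    ultimately show "\<exists>u. (\<forall>h\<in>set hs. Ah h (s # xs) = Suc (u h)) \<and> Af (s # map u hs) = Suc v"
      by (intro exI[of _ "\<lambda>h. Ah h (s # xs) - 1"]) blast
  next
    assume "\<exists>u. (\<forall>h\<in>set hs. Ah h (s # xs) = Suc (u h)) \<and> Af (s # map u hs) = Suc v"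
    then obtain u where u: "\<forall>h\<in>set hs. Ah h (s # xs) = Suc (u h)" "Af (s # map u hs) = Suc v" by blast
    then have "map (\<lambda>h. Ah h (s # xs) - 1) hs = map u hs" by auto
    then have "Af (s # map (\<lambda>h. Ah h (s # xs) - 1) hs) = Suc v" using u(2) by (simp only:)
    then show "A (s # xs) = Suc v" using u(1) by (simp add: A_def comp_def)
  qed
  have "recursive_in False False g (Suc n) A"
    unfolding A_def
    by (intro rec_if rec_const rec_ball_list rec_less rec_Comp)
      (auto simp: Ah Af intro!: rec_intros)
  moreover have "stagewise n A (rf_eval g (Comp f hs))"
    unfolding stagewise_def A_iff rf_eval_Comp_iff
  proof (intro conjI allI impI iffI)
    fix xs :: "nat list" and s t v assume len: "length xs = n" and "s \<le> t"
      and "\<exists>u. (\<forall>h\<in>set hs. Ah h (s # xs) = Suc (u h)) \<and> Af (s # map u hs) = Suc v"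
    then obtain u where "\<forall>h\<in>set hs. Ah h (s # xs) = Suc (u h)" "Af (s # map u hs) = Suc v" by blast
    then have "\<forall>h\<in>set hs. Ah h (t # xs) = Suc (u h)" "Af (t # map u hs) = Suc v"
      using stagewise_mono[OF Ah(2) len _ \<open>s \<le> t\<close>] stagewise_mono[OF Af(2) length_map _ \<open>s \<le> t\<close>]
      by blast+
    then show "\<exists>u. (\<forall>h\<in>set hs. Ah h (t # xs) = Suc (u h)) \<and> Af (t # map u hs) = Suc v" by blast
  next
    fix xs :: "nat list" and v assume len: "length xs = n"
      and "\<exists>u. (\<forall>h\<in>set hs. rf_eval g h xs = Some (u h)) \<and> rf_eval g f (map u hs) = Some v"
    then obtain u where u: "\<And>h. h \<in> set hs \<Longrightarrow> rf_eval g h xs = Some (u h)"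
        "rf_eval g f (map u hs) = Some v" by blast
    obtain s where s: "\<And>h. h \<in> set hs \<Longrightarrow> \<forall>t\<ge>s. Ah h (t # xs) = Suc (u h)"
    proof (rule finite_uniform_bound[of "set hs" "\<lambda>h s. \<forall>t\<ge>s. Ah h (t # xs) = Suc (u h)"])
      show "\<exists>s. \<forall>t\<ge>s. Ah h (t # xs) = Suc (u h)" if "h \<in> set hs" for h
        using u(1)[OF that] stagewise_iff[OF Ah(2)[OF that] len] stagewise_mono[OF Ah(2)[OF that] len]
        by metis
    qed auto
    obtain s' where s': "Af (s' # map u hs) = Suc v" using u(2) stagewise_iff[OF Af(2)] by auto
    have "Af (max s s' # map u hs) = Suc v" by (rule stagewise_mono[OF Af(2) _ s']) auto
    then show "\<exists>s u. (\<forall>h\<in>set hs. Ah h (s # xs) = Suc (u h)) \<and> Af (s # map u hs) = Suc v"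
      using s max.cobounded1 by metis
  next
    fix xs :: "nat list" and v assume len: "length xs = n"
      and "\<exists>s u. (\<forall>h\<in>set hs. Ah h (s # xs) = Suc (u h)) \<and> Af (s # map u hs) = Suc v"
    then obtain s u where *: "\<forall>h\<in>set hs. Ah h (s # xs) = Suc (u h)" "Af (s # map u hs) = Suc v"
      by blast
    have "rf_eval g f (map u hs) = Some v"
      using stagewise_iff[OF Af(2), of "map u hs"] *(2) by auto
    moreover have "\<forall>h\<in>set hs. rf_eval g h xs = Some (u h)"
      using stagewise_iff[OF Ah(2) len] *(1) by auto
    ultimately show "\<exists>u. (\<forall>h\<in>set hs. rf_eval g h xs = Some (u h)) \<and> rf_eval g f (map u hs) = Some v"
      by blast
  qed
  ultimately show ?case by blast
next
  case (PrimRec f h)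
  then obtain m where n: "n = Suc m" by (auto simp: gr0_conv_Suc)
  obtain Af where Af: "recursive_in False False g (Suc m) Af" "stagewise m Af (rf_eval g f)"
    using PrimRec n by auto
  obtain Ah where Ah: "recursive_in False False g (Suc (Suc (Suc m))) Ah"
      "stagewise (Suc (Suc m)) Ah (rf_eval g h)"
    using PrimRec n by (metis has_arity.simps(6) oracle_free.simps(3))
  \<comment> \<open>The value 0 is passed on by the recursion, so a step that has not converged yet
    blocks all later ones.\<close>
  define A where "A = (\<lambda>ys. rec_nat (Af (ys ! 0 # drop 2 ys))
      (\<lambda>k v. if v = 0 then 0 else Ah (ys ! 0 # k # (v - 1) # drop 2 ys)) (ys ! 1))"
  have A_eq: "A (s # k # ps) =
      rec_nat (Af (s # ps)) (\<lambda>k v. if v = 0 then 0 else Ah (s # k # (v - 1) # ps)) k" for s k ps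
    by (simp add: A_def eval_nat_numeral cong: if_cong)
  have A_0: "A (s # 0 # ps) = Af (s # ps)" for s ps by (simp add: A_eq)
  have A_Suc: "A (s # Suc k # ps) = Suc v \<longleftrightarrow>
      (\<exists>u. A (s # k # ps) = Suc u \<and> Ah (s # k # u # ps) = Suc v)" for s k ps v
    by (auto simp: A_eq gr0_conv_Suc)
  have "recursive_in False False g (Suc (Suc m)) A"
    unfolding A_def
  proof (intro rec_intros)
    show "recursive_in False False g (Suc (Suc m)) (\<lambda>ys. Af (ys ! 0 # drop 2 ys))"
      using rec_append_drop[of False False g "[\<lambda>ys. ys ! 0]" "Suc (Suc m)" 2 Af] Af(1)
      by (auto intro: rec_intros)
    have "recursive_in False False g (4 + m) (\<lambda>zs. Ah (map (\<lambda>H. H zs)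
        [\<lambda>zs. tl (tl zs) ! 0, \<lambda>zs. zs ! 0, \<lambda>zs. zs ! 1 - 1] @ drop 4 zs))"
      by (rule rec_append_drop) (auto simp: Ah(1) intro!: rec_intros)
    then have *: "recursive_in False False g (4 + m) (\<lambda>zs. Ah (tl (tl zs) ! 0 # zs ! 0 # (zs ! 1 - 1) # drop 4 zs))"
      by simp
    show "recursive_in False False g (Suc (Suc (Suc (Suc m))))
      (\<lambda>zs. Ah (tl (tl zs) ! 0 # zs ! 0 # (zs ! 1 - 1) # drop 2 (tl (tl zs))))"
      by (rule rec_cong[of _ _ _ _ "\<lambda>zs. Ah (tl (tl zs) ! 0 # zs ! 0 # (zs ! 1 - 1) # drop 4 zs)"])
        (use * in \<open>auto simp: drop_Suc eval_nat_numeral\<close>)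
  qed auto
  moreover have "stagewise n A (rf_eval g (PrimRec f h))"
    unfolding stagewise_def n
  proof (intro conjI allI impI)
    fix xs :: "nat list" and s t v
    assume "length xs = Suc m" "A (s # xs) = Suc v" "s \<le> t"
    then obtain k ps where xs: "xs = k # ps" "length ps = m" by (auto simp: length_Suc_conv)
    have "A (t # k # ps) = Suc v" using \<open>A (s # xs) = Suc v\<close> unfolding xs
    proof (induction k arbitrary: v)
      case 0
      then show ?case using stagewise_mono[OF Af(2) xs(2) _ \<open>s \<le> t\<close>] by (simp add: A_0)
    next
      case (Suc k)
      then obtain u where "A (s # k # ps) = Suc u" "Ah (s # k # u # ps) = Suc v"
        unfolding A_Suc by blast
      then show ?case
        using Suc.IH stagewise_mono[OF Ah(2) _ _ \<open>s \<le> t\<close>, of "k # u # ps"] xs(2) unfolding A_Suc by auto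
    qed
    then show "A (t # xs) = Suc v" by (simp add: xs)
  next
    fix xs :: "nat list" and v
    assume "length xs = Suc m"
    then obtain k ps where xs: "xs = k # ps" "length ps = m" by (auto simp: length_Suc_conv)
    have mono: "A (s # k # ps) = Suc v \<Longrightarrow> s \<le> t \<Longrightarrow> A (t # k # ps) = Suc v" for k s t v
    proof (induction k arbitrary: v)
      case 0
      then show ?case using stagewise_mono[OF Af(2) xs(2) _ \<open>s \<le> t\<close>] by (simp add: A_0)
    next
      case (Suc k)
      then obtain u where "A (s # k # ps) = Suc u" "Ah (s # k # u # ps) = Suc v"
        unfolding A_Suc by blast
      then show ?case
        using Suc.IH Suc.prems stagewise_mono[OF Ah(2) _ _ \<open>s \<le> t\<close>, of "k # u # ps"] xs(2) unfolding A_Suc by auto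
    qed
    have "rf_eval g (PrimRec f h) (k # ps) = Some v \<longleftrightarrow> (\<exists>s. A (s # k # ps) = Suc v)"
    proof (induction k arbitrary: v)
      case 0
      show ?case using stagewise_iff[OF Af(2) xs(2)] by (simp add: A_0 rf_eval.simps)
    next
      case (Suc k)
      have Ah_iff: "rf_eval g h (k # u # ps) = Some v \<longleftrightarrow> (\<exists>s. Ah (s # k # u # ps) = Suc v)" for u
        using stagewise_iff[OF Ah(2), of "k # u # ps"] xs(2) by simp
      have Ah_mono: "Ah (s # k # u # ps) = Suc v \<Longrightarrow> s \<le> t \<Longrightarrow> Ah (t # k # u # ps) = Suc v" for u s t
        by (rule stagewise_mono[OF Ah(2)]) (simp add: xs(2), assumption+)
      show ?case
        unfolding rf_eval_PrimRec_Suc Suc.IH Ah_iff A_Suc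
        using mono Ah_mono by (meson max.cobounded1 max.cobounded2)
    qed
    then show "rf_eval g (PrimRec f h) xs = Some v \<longleftrightarrow> (\<exists>s. A (s # xs) = Suc v)"
      by (simp add: xs)
  qed
  ultimately show ?case unfolding n by blast
next
  case (Mu h)
  then obtain Ah where Ah: "recursive_in False False g (Suc (Suc n)) Ah"
      "stagewise (Suc n) Ah (rf_eval g h)"
    by fastforce
  \<comment> \<open>Values are shifted by one: 1 is a zero already found and anything larger a
    nonzero value already found. At 0 the search has to wait.\<close>
  define P where "P = (\<lambda>s xs y. Ah (s # y # xs) = 1 \<and> (\<forall>z<y. 1 < Ah (s # z # xs)))"
  define A where "A = (\<lambda>ys. \<Sum>y<ys ! 0. of_bool (P (ys ! 0) (drop 1 ys) y) * Suc y)"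
  have A_iff: "A (s # xs) = Suc v \<longleftrightarrow> v < s \<and> P s xs v" for s xs v
  proof -
    have "P s xs y \<Longrightarrow> P s xs z \<Longrightarrow> y = z" for y z
      unfolding P_def by (metis less_irrefl linorder_neqE_nat)
    from sum_unique_index[of "P s xs", OF this] show ?thesis by (simp add: A_def)
  qed
  have gt1: "\<exists>w. a = Suc (Suc w)" if "1 < a" for a :: nat using that by presburger
  have P_mono: "P s xs y \<Longrightarrow> s \<le> t \<Longrightarrow> P t xs y" if "length xs = n" for s t xs y
  proof -
    assume y: "P s xs y" and st: "s \<le> t"
    have mono: "Ah (s # z # xs) = Suc w \<Longrightarrow> Ah (t # z # xs) = Suc w" for z w
      by (rule stagewise_mono[OF Ah(2) _ _ st]) (simp add: that, assumption)
    have "1 < Ah (t # z # xs)" if "z < y" for z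
    proof -
      obtain w where "Ah (s # z # xs) = Suc (Suc w)"
        using y \<open>z < y\<close> gt1[of "Ah (s # z # xs)"] unfolding P_def by blast
      from mono[OF this] show ?thesis by simp
    qed
    moreover have "Ah (t # y # xs) = 1" using y mono[of y 0] by (simp add: P_def)
    ultimately show "P t xs y" by (simp add: P_def)
  qed
  have "recursive_in False False g (Suc n) A"
    unfolding A_def P_def
  proof (intro rec_intros)
    have "recursive_in False False g (Suc (Suc n)) (\<lambda>zs. Ah (map (\<lambda>H. H zs)
        [\<lambda>zs. tl zs ! 0, \<lambda>zs. zs ! 0] @ drop 2 zs))"
      by (rule rec_append_drop) (auto simp: Ah(1) intro!: rec_intros)
    then show "recursive_in False False g (Suc (Suc n))
      (\<lambda>zs. Ah (tl zs ! 0 # zs ! 0 # drop 1 (tl zs)))"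
      by (rule rec_cong) (simp add: drop_Suc eval_nat_numeral)
    have "recursive_in False False g (Suc (Suc (Suc n))) (\<lambda>zs. Ah (map (\<lambda>H. H zs)
        [\<lambda>zs. tl (tl zs) ! 0, \<lambda>zs. zs ! 0] @ drop 3 zs))"
      by (rule rec_append_drop) (auto simp: Ah(1) intro!: rec_intros)
    then show "recursive_in False False g (Suc (Suc (Suc n)))
      (\<lambda>zs. Ah (tl (tl zs) ! 0 # zs ! 0 # drop 1 (tl (tl zs))))"
      by (rule rec_cong) (simp add: drop_Suc eval_nat_numeral)
  qed auto
  moreover have "stagewise n A (rf_eval g (Mu h))"
    unfolding stagewise_def A_iff rf_eval_Mu_iff
  proof (intro conjI allI impI)
    fix xs :: "nat list" and v assume len: "length xs = n"
    have Ah_iff: "rf_eval g h (y # xs) = Some w \<longleftrightarrow> (\<exists>s. Ah (s # y # xs) = Suc w)" for y w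
      using stagewise_iff[OF Ah(2), of "y # xs"] len by simp
    have Ah_mono: "Ah (s # y # xs) = Suc w \<Longrightarrow> s \<le> t \<Longrightarrow> Ah (t # y # xs) = Suc w" for y s t w
      by (rule stagewise_mono[OF Ah(2)]) (simp add: len, assumption+)
    show "(rf_eval g h (v # xs) = Some 0 \<and> (\<forall>z<v. \<exists>w. rf_eval g h (z # xs) = Some (Suc w))) \<longleftrightarrow>
        (\<exists>s. v < s \<and> P s xs v)"
      unfolding Ah_iff
    proof
      assume *: "(\<exists>s. Ah (s # v # xs) = Suc 0) \<and> (\<forall>z<v. \<exists>w s. Ah (s # z # xs) = Suc (Suc w))"
      then obtain s where s: "Ah (s # v # xs) = Suc 0" by blast
      obtain s' where s': "\<And>z. z \<in> {..<v} \<Longrightarrow> \<forall>t\<ge>s'. 1 < Ah (t # z # xs)"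
      proof (rule finite_uniform_bound[of "{..<v}" "\<lambda>z s. \<forall>t\<ge>s. 1 < Ah (t # z # xs)"])
        show "\<exists>s. \<forall>t\<ge>s. 1 < Ah (t # z # xs)" if z: "z \<in> {..<v}" for z
        proof -
          obtain w s where "Ah (s # z # xs) = Suc (Suc w)" using * z by blast
          then have "\<forall>t\<ge>s. Ah (t # z # xs) = Suc (Suc w)" using Ah_mono by blast
          then show ?thesis by (intro exI[of _ s]) simp
        qed
      qed auto
      have "P (max (Suc v) (max s s')) xs v"
        unfolding P_def using s' Ah_mono[OF s] by simp
      then show "\<exists>s. v < s \<and> P s xs v"
        by (intro exI[of _ "max (Suc v) (max s s')"]) simp
    next
      assume "\<exists>s. v < s \<and> P s xs v"
      then show "(\<exists>s. Ah (s # v # xs) = Suc 0) \<and> (\<forall>z<v. \<exists>w s. Ah (s # z # xs) = Suc (Suc w))"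
        unfolding P_def using gt1 by (auto; blast)
    qed
  qed (use P_mono in auto)
  ultimately show ?case by blast
qed

section \<open>Finitely many atoms\<close>

definition ba_le :: "ba_structure \<Rightarrow> nat \<Rightarrow> nat \<Rightarrow> bool" where
  "ba_le A x y \<longleftrightarrow> ba_meet A x y = x"

definition ba_atom :: "ba_structure \<Rightarrow> nat \<Rightarrow> bool" where
  "ba_atom A a \<longleftrightarrow> a \<noteq> ba_bot A \<and> (\<forall>x. ba_meet A a x = a \<or> ba_meet A a x = ba_bot A)"

text \<open>The ultrafilters, given as homomorphisms into the two-element algebra. They reduce
  inclusions and equations between elements to propositional logic at each point.\<close>

definition ba_points :: "ba_structure \<Rightarrow> (nat \<Rightarrow> bool) set" where
  "ba_points A = {\<chi>. \<chi> (ba_top A) \<and> \<not> \<chi> (ba_bot A) \<and>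
     (\<forall>x y. \<chi> (ba_meet A x y) \<longleftrightarrow> \<chi> x \<and> \<chi> y) \<and>
     (\<forall>x y. \<chi> (ba_join A x y) \<longleftrightarrow> \<chi> x \<or> \<chi> y) \<and>
     (\<forall>x. \<chi> (ba_compl A x) \<longleftrightarrow> \<not> \<chi> x)}"

locale ba =
  fixes A :: ba_structure
  assumes is_ba: "is_boolean_algebra A"
begin

sublocale abstract_boolean_algebra "ba_meet A" "ba_join A" "ba_compl A" "ba_bot A" "ba_top A"
  using is_ba by (simp add: is_boolean_algebra_def)

text \<open>The prime ideal theorem for a countable algebra: starting from \<open>z\<close>, meet
  with each element in turn or with its complement, always keeping the result nonzero. The
  ultrafilter consists of everything above a member of this decreasing sequence.\<close>

lemma point_through:
  assumes "z \<noteq> ba_bot A"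
  obtains \<chi> where "\<chi> \<in> ba_points A" "\<chi> z"
proof -
  define s where "s = rec_nat z (\<lambda>n s. if ba_meet A s n \<noteq> ba_bot A then ba_meet A s n
      else ba_meet A s (ba_compl A n))"
  have s_Suc: "s (Suc n) = (if ba_meet A (s n) n \<noteq> ba_bot A then ba_meet A (s n) n
      else ba_meet A (s n) (ba_compl A n))" for n by (simp add: s_def)
  have split: "ba_meet A x (ba_compl A y) = x" if "ba_meet A x y = ba_bot A" for x y
  proof -
    have "x = ba_meet A x (ba_join A y (ba_compl A y))" by simp
    also have "\<dots> = ba_join A (ba_meet A x y) (ba_meet A x (ba_compl A y))"
      by (rule conj_disj_distrib)
    finally show ?thesis using that by simp
  qed
  have s_nz: "s n \<noteq> ba_bot A" for n
  proof (induction n)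
    case 0
    then show ?case using assms by (simp add: s_def)
  next
    case (Suc n)
    then show ?case using split[of "s n" n] by (auto simp: s_Suc)
  qed
  have le_trans: "ba_le A x z" if "ba_le A x y" "ba_le A y z" for x y z
    using that unfolding ba_le_def by (metis conj.assoc)
  have "ba_le A (s (n + k)) (s n)" for n k
  proof (induction k)
    case (Suc k)
    have "ba_le A (s (Suc (n + k))) (s (n + k))"
      by (simp add: s_Suc ba_le_def conj.commute conj.left_commute)
    then show ?case using Suc le_trans by simp
  qed (simp add: ba_le_def)
  then have mono: "ba_le A (s m) (s n)" if "n \<le> m" for m n
    using that by (metis le_Suc_ex)
  define \<chi> where "\<chi> = (\<lambda>y. \<exists>n. ba_le A (s n) y)"
  have \<chi>_conj: "\<chi> (ba_meet A x y) \<longleftrightarrow> \<chi> x \<and> \<chi> y" for x y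
  proof
    assume "\<chi> (ba_meet A x y)"
    then show "\<chi> x \<and> \<chi> y" unfolding \<chi>_def ba_le_def
      by (metis conj.assoc conj.commute conj.right_idem)
  next
    assume "\<chi> x \<and> \<chi> y"
    then obtain n n' where n: "ba_le A (s n) x" "ba_le A (s n') y" unfolding \<chi>_def by blast
    then have "ba_le A (s (max n n')) x" "ba_le A (s (max n n')) y"
      using mono le_trans by (meson max.cobounded1 max.cobounded2)+
    then have "ba_le A (s (max n n')) (ba_meet A x y)" unfolding ba_le_def by (metis conj.assoc)
    then show "\<chi> (ba_meet A x y)" unfolding \<chi>_def by blast
  qed
  have \<chi>_bot: "\<not> \<chi> (ba_bot A)" using s_nz by (simp add: \<chi>_def ba_le_def) metis
  have \<chi>_compl: "\<chi> (ba_compl A x) \<longleftrightarrow> \<not> \<chi> x" for x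
  proof -
    have "ba_le A (s (Suc x)) x \<or> ba_le A (s (Suc x)) (ba_compl A x)"
      by (simp add: s_Suc ba_le_def)
    then have "\<chi> x \<or> \<chi> (ba_compl A x)" unfolding \<chi>_def by blast
    moreover have "\<not> (\<chi> x \<and> \<chi> (ba_compl A x))" using \<chi>_conj[of x "ba_compl A x"] \<chi>_bot by simp
    ultimately show ?thesis by blast
  qed
  have \<chi>_disj: "\<chi> (ba_join A x y) \<longleftrightarrow> \<chi> x \<or> \<chi> y" for x y
    using \<chi>_compl[of "ba_join A x y"] \<chi>_compl[of x] \<chi>_compl[of y]
      \<chi>_conj[of "ba_compl A x" "ba_compl A y"] by auto
  have "\<chi> (ba_top A)" using \<chi>_compl[of "ba_bot A"] \<chi>_bot by simp
  then have "\<chi> \<in> ba_points A"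
    using \<chi>_conj \<chi>_disj \<chi>_compl \<chi>_bot by (simp add: ba_points_def)
  moreover have "\<chi> z" unfolding \<chi>_def ba_le_def by (rule exI[of _ 0]) (simp add: s_def)
  ultimately show ?thesis by (rule that)
qed

lemma point_simps [simp]:
  assumes "\<chi> \<in> ba_points A"
  shows "\<chi> (ba_top A)" "\<not> \<chi> (ba_bot A)" "\<chi> (ba_meet A x y) \<longleftrightarrow> \<chi> x \<and> \<chi> y"
    "\<chi> (ba_join A x y) \<longleftrightarrow> \<chi> x \<or> \<chi> y" "\<chi> (ba_compl A x) \<longleftrightarrow> \<not> \<chi> x"
  using assms by (auto simp: ba_points_def)

lemma le_iff_points: "ba_le A x y \<longleftrightarrow> (\<forall>\<chi>\<in>ba_points A. \<chi> x \<longrightarrow> \<chi> y)"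
proof
  assume "ba_le A x y"
  then show "\<forall>\<chi>\<in>ba_points A. \<chi> x \<longrightarrow> \<chi> y" unfolding ba_le_def by (metis point_simps(3))
next
  assume *: "\<forall>\<chi>\<in>ba_points A. \<chi> x \<longrightarrow> \<chi> y"
  have "ba_meet A x (ba_compl A y) = ba_bot A"
  proof (rule ccontr)
    assume "ba_meet A x (ba_compl A y) \<noteq> ba_bot A"
    then obtain \<chi> where "\<chi> \<in> ba_points A" "\<chi> (ba_meet A x (ba_compl A y))" by (rule point_through)
    with * show False by auto
  qed
  then have "ba_meet A x (ba_join A y (ba_compl A y)) = ba_join A (ba_meet A x y) (ba_bot A)"
    by (simp only: conj_disj_distrib)
  then show "ba_le A x y" unfolding ba_le_def by simp
qed

lemma eq_iff_points: "x = y \<longleftrightarrow> (\<forall>\<chi>\<in>ba_points A. \<chi> x \<longleftrightarrow> \<chi> y)"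
proof
  assume "\<forall>\<chi>\<in>ba_points A. \<chi> x \<longleftrightarrow> \<chi> y"
  then have "ba_le A x y" "ba_le A y x" by (auto simp: le_iff_points)
  then show "x = y" unfolding ba_le_def by (metis conj.commute)
qed simp

lemma atom_point:
  assumes "ba_atom A a"
  shows "ba_le A a \<in> ba_points A"
proof -
  have 1: "ba_le A a x \<or> ba_le A a (ba_compl A x)" for x
    using assms unfolding ba_atom_def ba_le_def[of A a x] le_iff_points eq_iff_points by auto
  have 2: "\<not> (ba_le A a x \<and> ba_le A a (ba_compl A x))" for x
    using assms unfolding ba_atom_def le_iff_points eq_iff_points by auto
  have 3: "ba_le A a (ba_join A x y) \<longleftrightarrow> ba_le A a x \<or> ba_le A a y" for x y
    using 1[of x] 1[of y] 2[of "ba_join A x y"] unfolding le_iff_points by auto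
  have 4: "\<not> ba_le A a (ba_bot A)" using 2[of "ba_bot A"] unfolding le_iff_points by auto
  show ?thesis unfolding ba_points_def using 1 2 3 4 by (auto simp: le_iff_points)
qed

text \<open>One of \<open>x\<close> and its complement lies above the atom \<open>a\<close>, and an
  ultrafilter containing \<open>a\<close> has to contain that one. So it is the principal
  ultrafilter of \<open>a\<close>.\<close>

lemma atom_le_or_disjoint:
  assumes "ba_atom A a" "\<chi> \<in> ba_points A" "\<chi> a"
  shows "\<chi> x \<longleftrightarrow> ba_le A a x"
  using assms point_simps(5)[OF atom_point[OF assms(1)], of x] point_simps(5)[OF assms(2), of x]
  unfolding le_iff_points by blast

lemma atoms_le_iff_eq: "ba_atom A a \<Longrightarrow> ba_atom A b \<Longrightarrow> ba_le A a b \<longleftrightarrow> a = b"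
  unfolding ba_atom_def ba_le_def by (metis conj.commute conj.idem)

end

section \<open>Copies along permutations and their atomic diagrams\<close>

lemma iso_atom_iff:
  assumes "is_iso A C f"
  shows "ba_atom C (f a) \<longleftrightarrow> ba_atom A a"
proof -
  have bij: "bij f" and meet: "\<And>x y. ba_meet C (f x) (f y) = f (ba_meet A x y)"
    and bot: "ba_bot C = f (ba_bot A)"
    using assms by (auto simp: is_iso_def)
  have inj: "f x = f y \<longleftrightarrow> x = y" for x y using bij by (simp add: bij_is_inj inj_eq)
  have all: "(\<forall>y. P y) \<longleftrightarrow> (\<forall>x. P (f x))" for P
    using bij_is_surj[OF bij] by (metis surjD)
  have "ba_atom C (f a) \<longleftrightarrow> f a \<noteq> ba_bot C \<and>
      (\<forall>x. ba_meet C (f a) (f x) = f a \<or> ba_meet C (f a) (f x) = ba_bot C)"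
    unfolding ba_atom_def all[of "\<lambda>y. ba_meet C (f a) y = f a \<or> ba_meet C (f a) y = ba_bot C"] ..
  then show ?thesis unfolding meet bot inj ba_atom_def .
qed

text \<open>The number \<open>n\<close> becomes a name of the element \<open>g n\<close>; so
  building a copy of \<open>A\<close> means building a permutation of the natural numbers.\<close>

definition pullback :: "ba_structure \<Rightarrow> (nat \<Rightarrow> nat) \<Rightarrow> ba_structure" where
  "pullback A g = \<lparr>ba_join = \<lambda>x y. inv g (ba_join A (g x) (g y)),
     ba_meet = \<lambda>x y. inv g (ba_meet A (g x) (g y)),
     ba_compl = \<lambda>x. inv g (ba_compl A (g x)), ba_top = inv g (ba_top A), ba_bot = inv g (ba_bot A)\<rparr>"

lemma is_iso_pullback: "bij g \<Longrightarrow> is_iso (pullback A g) A g"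
  by (simp add: is_iso_def pullback_def bij_is_surj surj_f_inv_f)

primrec term_elems :: "ba_term \<Rightarrow> nat set" where
  "term_elems (Elem n) = {n}"
| "term_elems Top = {}"
| "term_elems Bot = {}"
| "term_elems (Compl t) = term_elems t"
| "term_elems (Join s t) = term_elems s \<union> term_elems t"
| "term_elems (Meet s t) = term_elems s \<union> term_elems t"

text \<open>Consequently the part of an atomic diagram below \<open>u\<close> mentions only names
  below \<open>u\<close>.\<close>

lemma term_elems_le_code: "k \<in> term_elems t \<Longrightarrow> k \<le> term_code t"
proof (induction t)
  case (Join s t)
  then show ?case
    by (auto intro: order_trans[OF _ le_prod_encode_2] order_trans[OF _ le_prod_encode_1]
        order_trans[OF order_trans[OF _ le_prod_encode_2] le_prod_encode_2]
        order_trans[OF order_trans[OF _ le_prod_encode_1] le_prod_encode_2])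
next
  case (Meet s t)
  then show ?case
    by (auto intro: order_trans[OF order_trans[OF _ le_prod_encode_2] le_prod_encode_2]
        order_trans[OF order_trans[OF _ le_prod_encode_1] le_prod_encode_2])
qed (auto intro: order_trans[OF _ le_prod_encode_2] le_prod_encode_2)

lemma term_elems_le_eq_code:
  "k \<in> term_elems s \<union> term_elems t \<Longrightarrow> k \<le> prod_encode (i, prod_encode (term_code s, term_code t))"
  using term_elems_le_code[of k s] term_elems_le_code[of k t]
  by (auto intro: order_trans[OF order_trans[OF _ le_prod_encode_2] le_prod_encode_2]
      order_trans[OF order_trans[OF _ le_prod_encode_1] le_prod_encode_2])

text \<open>Terms in names below \<open>u\<close> take values in the subalgebra \<open>Q\<close>,
  and the endomorphism \<sigma> carries the values in one copy to those in the other. Equations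
  survive because \<sigma> is a homomorphism, inequations because it is injective on
  \<open>Q\<close>.\<close>

lemma pullback_term_eq_iff:
  assumes "bij g" "bij h" "\<And>d. d < u \<Longrightarrow> g d \<in> Q \<and> h d = \<sigma> (g d)"
    and Q: "ba_top A \<in> Q" "ba_bot A \<in> Q" "\<And>x. x \<in> Q \<Longrightarrow> ba_compl A x \<in> Q"
      "\<And>x y. x \<in> Q \<Longrightarrow> y \<in> Q \<Longrightarrow> ba_meet A x y \<in> Q \<and> ba_join A x y \<in> Q"
    and \<sigma>: "\<sigma> (ba_top A) = ba_top A" "\<sigma> (ba_bot A) = ba_bot A"
      "\<And>x. \<sigma> (ba_compl A x) = ba_compl A (\<sigma> x)"
      "\<And>x y. \<sigma> (ba_meet A x y) = ba_meet A (\<sigma> x) (\<sigma> y)"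
      "\<And>x y. \<sigma> (ba_join A x y) = ba_join A (\<sigma> x) (\<sigma> y)"
      "inj_on \<sigma> Q"
    and i: "i < u"
  shows "i \<in> atomic_diagram (pullback A h) \<longleftrightarrow> i \<in> atomic_diagram (pullback A g)"
proof -
  have g: "g (inv g x) = x" and h: "h (inv h x) = x" for x
    using assms(1,2) by (auto simp: bij_is_surj surj_f_inv_f)
  have val: "g (term_val (pullback A g) t) \<in> Q \<and>
      h (term_val (pullback A h) t) = \<sigma> (g (term_val (pullback A g) t))"
    if "term_elems t \<subseteq> {..<u}" for t
    using that by (induction t) (simp_all add: assms(3) g h Q \<sigma>(1-5) pullback_def)
  have eq: "term_val (pullback A h) s = term_val (pullback A h) t \<longleftrightarrow>
      term_val (pullback A g) s = term_val (pullback A g) t"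
    if "term_elems s \<union> term_elems t \<subseteq> {..<u}" for s t
  proof -
    have "term_val (pullback A h) s = term_val (pullback A h) t \<longleftrightarrow>
        h (term_val (pullback A h) s) = h (term_val (pullback A h) t)"
      using assms(2) by (simp add: bij_is_inj inj_eq)
    also have "\<dots> \<longleftrightarrow> g (term_val (pullback A g) s) = g (term_val (pullback A g) t)"
      using val[of s] val[of t] that \<sigma>(6) by (auto simp: inj_on_def)
    also have "\<dots> \<longleftrightarrow> term_val (pullback A g) s = term_val (pullback A g) t"
      using assms(1) by (simp add: bij_is_inj inj_eq)
    finally show ?thesis .
  qed
  have small: "term_elems s \<union> term_elems t \<subseteq> {..<u}"
    if "i = eq_code s t \<or> i = neq_code s t" for s t
    using that i term_elems_le_eq_code[of _ s t] unfolding eq_code_def neq_code_def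
    by (metis lessThan_iff order_le_less_trans subsetI)
  show ?thesis unfolding atomic_diagram_def using eq small by blast
qed

lemma extend_to_bij:
  fixes \<phi> :: "nat \<Rightarrow> nat"
  assumes "finite D" "inj_on \<phi> D"
  obtains \<psi> where "bij \<psi>" "\<And>d. d \<in> D \<Longrightarrow> \<psi> d = \<phi> d"
proof -
  have "infinite (- D)" "infinite (- \<phi> ` D)" using assms(1) by (simp_all add: finite_compl)
  then have "bij_betw (enumerate (- \<phi> ` D) \<circ> the_inv_into UNIV (enumerate (- D))) (- D) (- \<phi> ` D)"
    by (intro bij_betw_trans[OF bij_betw_the_inv_into] bij_enumerate)
  then obtain \<rho> where \<rho>: "bij_betw \<rho> (- D) (- \<phi> ` D)" by blast
  define \<psi> where "\<psi> = (\<lambda>d. if d \<in> D then \<phi> d else \<rho> d)"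
  have "bij_betw \<psi> D (\<phi> ` D)" using assms(2) by (auto simp: \<psi>_def bij_betw_def inj_on_def)
  moreover have "bij_betw \<psi> (- D) (- \<phi> ` D)"
    using \<rho> by (subst bij_betw_cong[of _ _ \<rho>]) (auto simp: \<psi>_def)
  ultimately have "bij_betw \<psi> (D \<union> - D) (\<phi> ` D \<union> - \<phi> ` D)" by (rule bij_betw_combine) auto
  then have "bij \<psi>" by simp
  then show ?thesis by (rule that) (simp add: \<psi>_def)
qed

text \<open>The inverses are compared as well, so that the limit of a sequence of finite extensions
  is onto.\<close>

definition agree :: "nat \<Rightarrow> (nat \<Rightarrow> nat) \<Rightarrow> (nat \<Rightarrow> nat) \<Rightarrow> bool" where
  "agree m g h \<longleftrightarrow> (\<forall>k<m. g k = h k \<and> inv g k = inv h k)"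

definition computes_iso :: "ba_structure \<Rightarrow> rf \<Rightarrow> (nat \<Rightarrow> nat) \<Rightarrow> bool" where
  "computes_iso A r h \<longleftrightarrow> (\<exists>f. is_iso (pullback A h) A f \<and>
     computes (\<lambda>n. of_bool (n \<in> atomic_diagram (pullback A h))) r 1 (unary f))"

context ba
begin

text \<open>If \<open>b\<close> is an atom, this map replaces the truth value of its argument at the atom \<open>a\<close> by
  the one at \<open>b\<close>.  It turns the atom \<open>b\<close> into the join of \<open>a\<close> and \<open>b\<close>.\<close>

definition copy_atom :: "nat \<Rightarrow> nat \<Rightarrow> nat \<Rightarrow> nat" where
  "copy_atom a b x =
     ba_join A (ba_meet A x (ba_compl A a)) (if ba_le A b x then a else ba_bot A)"

lemma copy_atom_point:
  "\<chi> \<in> ba_points A \<Longrightarrow> \<chi> (copy_atom a b x) \<longleftrightarrow> (if \<chi> a then ba_le A b x else \<chi> x)"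
  by (simp add: copy_atom_def)

text \<open>Dual to the map on ultrafilters that sends those containing \<open>a\<close> to the
  principal one of \<open>b\<close> and fixes all others; precomposition with it respects the
  operations.\<close>

lemma copy_atom_hom:
  assumes "ba_atom A b"
  shows "copy_atom a b (ba_top A) = ba_top A" "copy_atom a b (ba_bot A) = ba_bot A"
    "copy_atom a b (ba_compl A x) = ba_compl A (copy_atom a b x)"
    "copy_atom a b (ba_meet A x y) = ba_meet A (copy_atom a b x) (copy_atom a b y)"
    "copy_atom a b (ba_join A x y) = ba_join A (copy_atom a b x) (copy_atom a b y)"
  using point_simps[OF atom_point[OF assms]]
  by (subst eq_iff_points, simp add: copy_atom_point)+

text \<open>Only the truth value at \<open>a\<close> is lost, and elements that do not separate
  \<open>a\<close> from \<open>a'\<close> recover it from the value at \<open>a'\<close>.\<close>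

lemma copy_atom_inj:
  assumes "ba_atom A a" "ba_atom A a'" "a \<noteq> a'"
  shows "inj_on (copy_atom a b) {x. ba_le A a x \<longleftrightarrow> ba_le A a' x}"
proof (rule inj_onI, clarify)
  fix x y
  assume x: "ba_le A a x \<longleftrightarrow> ba_le A a' x" and y: "ba_le A a y \<longleftrightarrow> ba_le A a' y"
    and eq: "copy_atom a b x = copy_atom a b y"
  have "\<not> ba_le A a' a" using assms atoms_le_iff_eq by auto
  then have "ba_le A a' x \<longleftrightarrow> ba_le A a' y"
    using arg_cong[OF eq, of "ba_le A a'"] by (simp add: copy_atom_point[OF atom_point[OF assms(2)]])
  then have a: "ba_le A a x \<longleftrightarrow> ba_le A a y" using x y by simp
  show "x = y"
    unfolding eq_iff_points
  proof
    fix \<chi> assume \<chi>: "\<chi> \<in> ba_points A"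
    show "\<chi> x \<longleftrightarrow> \<chi> y"
    proof (cases "\<chi> a")
      case True
      then show ?thesis using a atom_le_or_disjoint[OF assms(1) \<chi>] by simp
    next
      case False
      then show ?thesis using arg_cong[OF eq, of \<chi>] by (simp add: copy_atom_point[OF \<chi>])
    qed
  qed
qed

lemma copy_atom_id:
  assumes "ba_atom A a" "ba_le A a x \<longleftrightarrow> ba_le A b x"
  shows "copy_atom a b x = x"
  unfolding eq_iff_points using assms atom_le_or_disjoint[OF assms(1)] by (auto simp: copy_atom_point)

lemma copy_atom_not_atom:
  assumes "ba_atom A a" "ba_atom A b" "a \<noteq> b"
  shows "\<not> ba_atom A (copy_atom a b b)"
proof
  assume c: "ba_atom A (copy_atom a b b)"
  have "ba_le A b b" by (simp add: ba_le_def)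
  then have "ba_le A a (copy_atom a b b)" "ba_le A b (copy_atom a b b)"
    unfolding le_iff_points[of _ "copy_atom a b b"] by (auto simp: copy_atom_point)
  then show False using assms c atoms_le_iff_eq by metis
qed

text \<open>If some extension \<open>h0\<close> of the commitments lets \<open>r\<close> succeed,
  the answer on a name \<open>n\<close> of an atom \<open>b\<close> is an atom and rests on finitely
  many diagram facts. Renaming through \<open>copy_atom\<close> keeps these facts and makes
  \<open>n\<close> name a non-atom. Otherwise it is enough to keep the commitments.\<close>

lemma defeat_code:
  assumes inf: "infinite {a. ba_atom A a}" and "bij g"
  shows "\<exists>g' m'. bij g' \<and> m < m' \<and> agree m g' g \<and>
    (\<forall>h. bij h \<longrightarrow> agree m' h g' \<longrightarrow> \<not> computes_iso A r h)"
proof -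
  \<comment> \<open>The elements on which the commitments below \<open>m\<close> depend, through the
    values of \<open>g\<close> and of its inverse; \<sigma> will have to fix them.\<close>
  define X where "X = g ` {..<m} \<union> {..<m}"
  define type where "type = (\<lambda>X a. {x \<in> X. ba_le A a x})"
  have pigeonhole: "\<exists>b\<in>S. infinite {a \<in> S. type X a = type X b}" if "infinite S" "finite X" for S X
  proof (rule pigeonhole_infinite[OF that(1)])
    show "finite (type X ` S)"
      using that(2) by (rule finite_subset[rotated, OF finite_Pow_iff[THEN iffD2]]) (auto simp: type_def)
  qed
  \<comment> \<open>Infinitely many atoms relate to \<open>X\<close> exactly as \<open>b\<close>
    does. Any \<open>a\<close> among them gives a \<sigma> fixing \<open>X\<close>.\<close>
  obtain b where b: "ba_atom A b" and S_inf: "infinite {a. ba_atom A a \<and> type X a = type X b}"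
    using pigeonhole[OF inf, of X] by (auto simp: X_def)
  define n where "n = inv g b"
  have gn: "g n = b" using \<open>bij g\<close> by (simp add: n_def bij_is_surj surj_f_inv_f)
  \<comment> \<open>Exceeds \<open>n\<close>, so agreement up to \<open>m1\<close> keeps
    \<open>n\<close> a name of \<open>b\<close>.\<close>
  define m1 where "m1 = Suc (max m n)"
  show ?thesis
  proof (cases "\<exists>h. bij h \<and> agree m1 h g \<and> computes_iso A r h")
    case False
    then show ?thesis using \<open>bij g\<close>
      by (intro exI[of _ g] exI[of _ m1]) (auto simp: m1_def agree_def)
  next
    case True
    then obtain h0 f0 where h0: "bij h0" "agree m1 h0 g" and f0: "is_iso (pullback A h0) A f0"
      "computes (\<lambda>n. of_bool (n \<in> atomic_diagram (pullback A h0))) r 1 (unary f0)"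
      by (auto simp: computes_iso_def)
    have h0n: "h0 n = b" using h0(2) gn by (simp add: agree_def m1_def)
    have c: "ba_atom A (f0 n)"
      using iso_atom_iff[OF f0(1)] iso_atom_iff[OF is_iso_pullback[OF h0(1)]] b h0n by metis
    have "rf_eval (\<lambda>n. of_bool (n \<in> atomic_diagram (pullback A h0))) r [n] = Some (f0 n)"
      using f0(2) by (simp add: computes_def)
    then obtain u where u: "\<And>g'. (\<And>i. i < u \<Longrightarrow> g' i = of_bool (i \<in> atomic_diagram (pullback A h0)))
        \<Longrightarrow> rf_eval g' r [n] = Some (f0 n)"
      by (rule use_principle) blast
    \<comment> \<open>The names to be redirected through \<sigma>: those the computation may ask
      about, those below \<open>m1\<close>, and those that \<open>h0\<close> gives to the elements
      below \<open>m\<close>.\<close>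
    define D where "D = {..<u} \<union> {..<m1} \<union> inv h0 ` {..<m}"
    have "finite (h0 ` D)" by (simp add: D_def)
    then obtain a0 where "infinite {a. (ba_atom A a \<and> type X a = type X b) \<and> type (h0 ` D) a = type (h0 ` D) a0}"
      using pigeonhole[OF S_inf, of "h0 ` D"] by auto
    then have inf': "infinite ({a. (ba_atom A a \<and> type X a = type X b) \<and>
        type (h0 ` D) a = type (h0 ` D) a0} - {b})" (is "infinite ?S") by simp
    obtain a where a: "a \<in> ?S" using infinite_imp_nonempty[OF inf'] by (auto simp only: ex_in_conv[symmetric])
    have "infinite (?S - {a})" using inf' by simp
    from infinite_imp_nonempty[OF this] obtain a' where a': "a' \<in> ?S - {a}"
      by (auto simp only: ex_in_conv[symmetric])
    have atoms: "ba_atom A a" "ba_atom A a'" "a \<noteq> a'" "a \<noteq> b" using a a' by auto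
    define \<sigma> where "\<sigma> = copy_atom a b"
    define Q where "Q = {x. ba_le A a x \<longleftrightarrow> ba_le A a' x}"
    have \<sigma>_X: "\<sigma> x = x" if "x \<in> X" for x
    proof -
      have "ba_le A a x \<longleftrightarrow> ba_le A b x" using a that by (auto simp: type_def)
      then show ?thesis unfolding \<sigma>_def by (rule copy_atom_id[OF atoms(1)])
    qed
    have D_Q: "h0 ` D \<subseteq> Q"
    proof
      fix x assume x: "x \<in> h0 ` D"
      have "type (h0 ` D) a = type (h0 ` D) a'" using a a' by simp
      then show "x \<in> Q" using x by (auto simp: Q_def type_def)
    qed
    have \<sigma>_inj: "inj_on \<sigma> Q" unfolding \<sigma>_def Q_def by (rule copy_atom_inj[OF atoms(1-3)])
    have "inj_on (\<sigma> \<circ> h0) D"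
      using h0(1) inj_on_subset[OF \<sigma>_inj D_Q] by (intro comp_inj_on) (auto simp: bij_def inj_on_def)
    moreover have "finite D" by (simp add: D_def)
    ultimately obtain g' where g': "bij g'" "\<And>d. d \<in> D \<Longrightarrow> g' d = \<sigma> (h0 d)"
      using extend_to_bij[of D "\<sigma> \<circ> h0"] by auto
    have "agree m g' g"
      unfolding agree_def
    proof (intro allI impI conjI)
      fix k assume k: "k < m"
      have "k < m1" using k unfolding m1_def by linarith
      then have "h0 k = g k" "inv h0 k = inv g k" using h0(2) by (simp_all add: agree_def)
      then show "g' k = g k"
        using g'(2)[of k] \<sigma>_X[of "g k"] k \<open>k < m1\<close> by (simp add: D_def X_def)
      note \<open>inv h0 k = inv g k\<close>
      moreover have "g' (inv h0 k) = k"
        using g'(2)[of "inv h0 k"] k \<sigma>_X[of k] h0(1)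
        by (simp add: D_def X_def bij_is_surj surj_f_inv_f)
      ultimately show "inv g' k = inv g k" using g'(1) by (metis bij_is_inj inv_f_f)
    qed
    \<comment> \<open>Agreement up to \<open>m1 + u\<close> protects \<open>n\<close> and all names
      in the diagram facts used. So \<open>r\<close> repeats the answer \<open>f0 n\<close>, an
      atom, although \<open>h n\<close> is no longer one.\<close>
    moreover have "\<not> computes_iso A r h" if h: "bij h" "agree (m1 + u) h g'" for h
    proof
      assume "computes_iso A r h"
      then obtain f where f: "is_iso (pullback A h) A f"
        "computes (\<lambda>n. of_bool (n \<in> atomic_diagram (pullback A h))) r 1 (unary f)"
        by (auto simp: computes_iso_def)
      have "i \<in> atomic_diagram (pullback A h) \<longleftrightarrow> i \<in> atomic_diagram (pullback A h0)" if "i < u" for i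
      proof (rule pullback_term_eq_iff[OF h0(1) h(1) _ _ _ _ _ _ _ _ _ _ \<sigma>_inj that])
        show "h0 d \<in> Q \<and> h d = \<sigma> (h0 d)" if "d < u" for d
          using D_Q g'(2)[of d] h(2) that by (auto simp: D_def agree_def)
      qed (use point_simps[OF atom_point[OF atoms(1)]] point_simps[OF atom_point[OF atoms(2)]]
          copy_atom_hom[OF b] in \<open>auto simp: Q_def \<sigma>_def\<close>)
      then have "rf_eval (\<lambda>n. of_bool (n \<in> atomic_diagram (pullback A h))) r [n] = Some (f0 n)"
        by (intro u) simp
      then have "f n = f0 n" using f(2) by (simp add: computes_def)
      then have "ba_atom A (h n)"
        using c iso_atom_iff[OF f(1)] iso_atom_iff[OF is_iso_pullback[OF h(1)]] by metis
      moreover have "n < m1" unfolding m1_def by linarith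
      then have "h n = copy_atom a b b"
        using h(2) g'(2)[of n] h0n by (simp add: agree_def D_def \<sigma>_def)
      ultimately show False using copy_atom_not_atom[OF atoms(1) b atoms(4)] by simp
    qed
    ultimately show ?thesis using g'(1)
      by (intro exI[of _ g'] exI[of _ "m1 + u"]) (auto simp: m1_def)
  qed
qed

end

instance rf :: countable by countable_datatype

text \<open>Step \<open>e\<close> of the sequence defeats the code numbered \<open>e\<close>; the
  limit permutation gives a copy with no isomorphism computable from its diagram.\<close>

theorem relatively_computably_categorical_finite_atoms:
  assumes "is_boolean_algebra A" "relatively_computably_categorical A"
  shows "finite {a. ba_atom A a}"
proof (rule ccontr)
  assume inf: "infinite {a. ba_atom A a}"
  interpret ba A by standard (rule assms(1))
  define P where "P = (\<lambda>_::nat. \<lambda>(g :: nat \<Rightarrow> nat, m :: nat). bij g)"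
  define N where "N = (\<lambda>e (g, m::nat) (g' :: nat \<Rightarrow> nat, m'). m < m' \<and> agree m g' g \<and>
    (\<forall>h. bij h \<longrightarrow> agree m' h g' \<longrightarrow> \<not> computes_iso A (from_nat e) h))"
  have "\<exists>c. \<forall>e. P e (c e) \<and> N e (c e) (c (Suc e))"
  proof (rule dependent_nat_choice)
    show "\<exists>x. P 0 x" by (rule exI[of _ "(id, 0)"]) (simp add: P_def)
    show "\<exists>y. P (Suc e) y \<and> N e x y" if "P e x" for x e
      using that defeat_code[OF inf, of "fst x" "snd x" "from_nat e"]
      by (cases x) (simp add: P_def N_def)
  qed
  then obtain c where c: "\<And>e. P e (c e)" "\<And>e. N e (c e) (c (Suc e))" by blast
  define g where "g = (\<lambda>e. fst (c e))"
  define m where "m = (\<lambda>e. snd (c e))"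
  have bij: "bij (g e)" for e using c(1)[of e] by (simp add: P_def g_def split_beta)
  have m_Suc: "m e < m (Suc e)" and agree_Suc: "agree (m e) (g (Suc e)) (g e)"
    and defeat: "bij h \<Longrightarrow> agree (m (Suc e)) h (g (Suc e)) \<Longrightarrow> \<not> computes_iso A (from_nat e) h"
    for e h using c(2)[of e] by (auto simp: N_def g_def m_def split_beta)
  have "strict_mono m" using m_Suc by (simp add: strict_mono_Suc_iff)
  then have m_mono: "m e \<le> m e'" if "e \<le> e'" for e e' using that by (simp add: strict_mono_less_eq)
  have m_ge: "e \<le> m e" for e using \<open>strict_mono m\<close> by (rule strict_mono_imp_increasing)
  have agree_le: "agree (m e) (g (e + d)) (g e)" for e d
  proof (induction d)
    case (Suc d)
    show ?case using agree_Suc[of "e + d"] Suc m_mono[of e "e + d"] by (auto simp: agree_def)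
  qed (simp add: agree_def)
  \<comment> \<open>\<open>m (Suc k)\<close> exceeds \<open>k\<close>, so from stage
    \<open>Suc k\<close> on neither the value nor the preimage of \<open>k\<close> changes.\<close>
  define G where "G = (\<lambda>k. g (Suc k) k)"
  define H where "H = (\<lambda>k. inv (g (Suc k)) k)"
  have stable: "g e k = G k \<and> inv (g e) k = H k" if "k < m e" for e k
  proof -
    have "k < m (Suc k)" using m_ge[of "Suc k"] by simp
    then have "g (Suc k + e) k = G k \<and> inv (g (Suc k + e)) k = H k"
      using agree_le[of "Suc k" e] by (auto simp: agree_def G_def H_def)
    moreover have "g (e + Suc k) k = g e k \<and> inv (g (e + Suc k)) k = inv (g e) k"
      using agree_le[of e "Suc k"] that by (auto simp: agree_def)
    ultimately show ?thesis by (simp add: add.commute)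
  qed
  have stable': "\<exists>e. g e k = G k \<and> inv (g e) k = H k \<and> g e l = G l \<and> inv (g e) l = H l" for k l
    using stable[of k "Suc (max k l)"] stable[of l "Suc (max k l)"] m_ge[of "Suc (max k l)"]
    by (intro exI[of _ "Suc (max k l)"]) auto
  have HG: "H (G k) = k" for k
    using stable'[of k "G k"] bij by (metis bij_is_inj inv_f_f)
  have GH: "G (H k) = k" for k
    using stable'[of k "H k"] bij by (metis bij_is_surj surj_f_inv_f)
  have "bij G" using HG GH by (intro bijI') metis+
  have "inv G = H" using HG GH by (intro inv_equality)
  then have agree_G: "agree (m e) G (g e)" for e using stable by (simp add: agree_def)
  have "isomorphic (pullback A G) A"
    unfolding isomorphic_def using is_iso_pullback[OF \<open>bij G\<close>] by blast
  then obtain f r where "is_iso (pullback A G) A f"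
    "computes (\<lambda>n. of_bool (n \<in> atomic_diagram (pullback A G))) r 1 (unary f)"
    using assms(2) unfolding relatively_computably_categorical_def computable_relative_to_def by blast
  then have "computes_iso A (from_nat (to_nat r)) G" by (auto simp: computes_iso_def)
  then show False using defeat[OF \<open>bij G\<close> agree_G] by blast
qed

section \<open>Back and forth\<close>

definition ba_atomless :: "ba_structure \<Rightarrow> nat \<Rightarrow> bool" where
  "ba_atomless A p \<longleftrightarrow> p \<noteq> ba_bot A \<and> (\<forall>a. ba_atom A a \<longrightarrow> \<not> ba_le A a p)"

text \<open>Two kinds of pieces suffice: an atom is never split, and an atomless piece can answer
  any splitting of another one.\<close>

definition similar :: "ba_structure \<Rightarrow> ba_structure \<Rightarrow> nat \<Rightarrow> nat \<Rightarrow> bool" where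
  "similar A C p q \<longleftrightarrow> ba_atom A p \<and> ba_atom C q \<or> ba_atomless A p \<and> ba_atomless C q"

text \<open>The first components of a matching form a finite partition of unity, and so do the second
  components.\<close>

definition matching :: "ba_structure \<Rightarrow> ba_structure \<Rightarrow> (nat \<times> nat) set \<Rightarrow> bool" where
  "matching A C R \<longleftrightarrow> finite R \<and> (\<forall>(p, q)\<in>R. similar A C p q) \<and>
     (\<forall>\<chi>\<in>ba_points A. \<exists>!r. r \<in> R \<and> \<chi> (fst r)) \<and>
     (\<forall>\<chi>\<in>ba_points C. \<exists>!r. r \<in> R \<and> \<chi> (snd r))"

definition decides :: "ba_structure \<Rightarrow> nat \<Rightarrow> nat \<Rightarrow> bool" where
  "decides A x p \<longleftrightarrow> ba_le A p x \<or> ba_le A p (ba_compl A x)"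

definition refines :: "ba_structure \<Rightarrow> ba_structure \<Rightarrow> (nat \<times> nat) set \<Rightarrow> (nat \<times> nat) set \<Rightarrow> bool" where
  "refines A C R' R \<longleftrightarrow> (\<forall>(p', q')\<in>R'. \<exists>(p, q)\<in>R. ba_le A p' p \<and> ba_le C q' q)"

text \<open>Every pair of \<open>R\<close> decides \<open>x\<close> and \<open>y\<close> in the same
  way: the correspondence of unions of pieces induced by \<open>R\<close> takes \<open>x\<close> to
  \<open>y\<close>.\<close>

definition tied :: "ba_structure \<Rightarrow> ba_structure \<Rightarrow> (nat \<times> nat) set \<Rightarrow> nat \<Rightarrow> nat \<Rightarrow> bool" where
  "tied A C R x y \<longleftrightarrow> (\<forall>(p, q)\<in>R. ba_le A p x \<and> ba_le C q y \<or>
     ba_le A p (ba_compl A x) \<and> ba_le C q (ba_compl C y))"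

text \<open>Symmetry under exchange of the two algebras, so that the back step is the forth step
  applied to the converse.\<close>

lemma matching_converse: "matching C A (R\<inverse>) \<longleftrightarrow> matching A C R"
proof -
  have *: "(\<exists>!r. r \<in> R\<inverse> \<and> P (fst r)) \<longleftrightarrow> (\<exists>!r. r \<in> R \<and> P (snd r))"
    "(\<exists>!r. r \<in> R\<inverse> \<and> P (snd r)) \<longleftrightarrow> (\<exists>!r. r \<in> R \<and> P (fst r))" for P :: "nat \<Rightarrow> bool"
    by (auto simp: Ex1_def split_paired_Ex split_paired_All)
  have "(\<forall>(p, q)\<in>R\<inverse>. similar C A p q) \<longleftrightarrow> (\<forall>(p, q)\<in>R. similar A C p q)"
    unfolding similar_def by fast
  then show ?thesis unfolding matching_def * by auto
qed

lemma refines_converse: "refines C A (R'\<inverse>) (R\<inverse>) \<longleftrightarrow> refines A C R' R"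
  unfolding refines_def by fast

lemma tied_converse: "tied C A (R\<inverse>) y x \<longleftrightarrow> tied A C R x y"
  unfolding tied_def by fast

locale two_ba = A: ba A + C: ba C for A C
begin

lemma le_trans:
  "ba_le A x y \<Longrightarrow> ba_le A y z \<Longrightarrow> ba_le A x z" "ba_le C x y \<Longrightarrow> ba_le C y z \<Longrightarrow> ba_le C x z"
  unfolding A.le_iff_points C.le_iff_points by blast+

lemma refines_trans:
  assumes "refines A C R'' R'" "refines A C R' R"
  shows "refines A C R'' R"
  unfolding refines_def
proof clarify
  fix p'' q'' assume "(p'', q'') \<in> R''"
  then obtain p' q' where 1: "(p', q') \<in> R'" "ba_le A p'' p'" "ba_le C q'' q'"
    using assms(1) unfolding refines_def by blast
  then obtain p q where 2: "(p, q) \<in> R" "ba_le A p' p" "ba_le C q' q"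
    using assms(2) unfolding refines_def by blast
  then show "\<exists>(p, q)\<in>R. ba_le A p'' p \<and> ba_le C q'' q"
    using le_trans(1)[OF 1(2) 2(2)] le_trans(2)[OF 1(3) 2(3)] by blast
qed

lemma tied_refines:
  assumes "refines A C R' R" "tied A C R x y"
  shows "tied A C R' x y"
  using assms le_trans unfolding refines_def tied_def by (fast dest: le_trans)

lemma similar_nonzero:
  assumes "similar A C p q"
  shows "\<not> (ba_le A p x \<and> ba_le A p (ba_compl A x))" "\<not> (ba_le C q y \<and> ba_le C q (ba_compl C y))"
proof -
  have "p \<noteq> ba_bot A" "q \<noteq> ba_bot C"
    using assms by (auto simp: similar_def ba_atom_def ba_atomless_def)
  then obtain \<chi> \<psi> where "\<chi> \<in> ba_points A" "\<chi> p" "\<psi> \<in> ba_points C" "\<psi> q"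
    by (metis A.point_through C.point_through)
  then show "\<not> (ba_le A p x \<and> ba_le A p (ba_compl A x))" "\<not> (ba_le C q y \<and> ba_le C q (ba_compl C y))"
    unfolding A.le_iff_points C.le_iff_points by auto
qed

lemma tied_functional:
  assumes R: "matching A C R" and "tied A C R x y" "tied A C R x y'"
  shows "y = y'"
  unfolding C.eq_iff_points
proof
  fix \<chi> assume \<chi>: "\<chi> \<in> ba_points C"
  then obtain p q where pq: "(p, q) \<in> R" "\<chi> q"
    using R unfolding matching_def by (metis prod.collapse)
  then have "similar A C p q" using R unfolding matching_def by auto
  then have "ba_le C q y \<and> ba_le C q y' \<or> ba_le C q (ba_compl C y) \<and> ba_le C q (ba_compl C y')"
    using similar_nonzero(1)[of p q x] assms(2,3) pq(1) unfolding tied_def by blast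
  then show "\<chi> y \<longleftrightarrow> \<chi> y'" using \<chi> pq(2) unfolding C.le_iff_points by auto
qed

lemma finite_join:
  assumes "finite Q"
  shows "\<exists>y. \<forall>\<chi>\<in>ba_points C. \<chi> y \<longleftrightarrow> (\<exists>q\<in>Q. \<chi> q)"
  using assms
proof induction
  case empty
  show ?case by (rule exI[of _ "ba_bot C"]) simp
next
  case (insert q Q)
  then obtain y where "\<forall>\<chi>\<in>ba_points C. \<chi> y \<longleftrightarrow> (\<exists>q\<in>Q. \<chi> q)" by blast
  then show ?case by (intro exI[of _ "ba_join C q y"]) simp
qed

text \<open>The partner of \<open>x\<close> is the join of those pieces whose counterparts lie below
  \<open>x\<close>.\<close>

lemma tied_total:
  assumes R: "matching A C R" and dec: "\<And>p q. (p, q) \<in> R \<Longrightarrow> decides A x p"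
  shows "\<exists>y. tied A C R x y"
proof -
  have "finite {q. \<exists>p. (p, q) \<in> R \<and> ba_le A p x}"
  proof (rule finite_subset)
    show "finite (snd ` R)" using R by (simp add: matching_def)
  qed force
  from finite_join[OF this] obtain y where
    "\<forall>\<chi>\<in>ba_points C. \<chi> y \<longleftrightarrow> (\<exists>q\<in>{q. \<exists>p. (p, q) \<in> R \<and> ba_le A p x}. \<chi> q)" ..
  then have y: "\<chi> y \<longleftrightarrow> (\<exists>p q. (p, q) \<in> R \<and> ba_le A p x \<and> \<chi> q)" if "\<chi> \<in> ba_points C" for \<chi>
    using that by blast
  have "tied A C R x y"
    unfolding tied_def
  proof clarify
    fix p q
    assume pq: "(p, q) \<in> R"
      and *: "\<not> (ba_le A p (ba_compl A x) \<and> ba_le C q (ba_compl C y))"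
    show "ba_le A p x \<and> ba_le C q y"
    proof (cases "ba_le A p x")
      case True
      then show ?thesis using pq y unfolding C.le_iff_points by blast
    next
      case False
      then have "ba_le A p (ba_compl A x)" using dec[OF pq] by (simp add: decides_def)
      moreover have "ba_le C q (ba_compl C y)"
        unfolding C.le_iff_points
      proof clarify
        fix \<chi> assume \<chi>: "\<chi> \<in> ba_points C" "\<chi> q"
        have "\<not> \<chi> y"
        proof
          assume "\<chi> y"
          then obtain p' q' where "(p', q') \<in> R" "ba_le A p' x" "\<chi> q'" using y \<chi>(1) by blast
          moreover have "\<exists>!r. r \<in> R \<and> \<chi> (snd r)" using R \<chi>(1) by (simp add: matching_def)
          ultimately have "(p', q') = (p, q)" using pq \<chi>(2) by (metis snd_conv)
          then show False using False \<open>ba_le A p' x\<close> by simp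
        qed
        then show "\<chi> (ba_compl C y)" using \<chi>(1) by simp
      qed
      ultimately show ?thesis using * by blast
    qed
  qed
  then show ?thesis by blast
qed

text \<open>If \<open>x\<close> properly cuts \<open>p\<close>, then \<open>p\<close> is not an
  atom, so \<open>p\<close> and \<open>q\<close> are both atomless. Then some \<open>y\<close>
  properly cuts \<open>q\<close>, and any such \<open>y\<close> will do, since all nonzero parts are
  atomless again.\<close>

lemma split_pair:
  assumes "similar A C p q"
  shows "\<exists>S. finite S \<and> (\<forall>(p', q')\<in>S. similar A C p' q' \<and> decides A x p' \<and> ba_le A p' p \<and> ba_le C q' q) \<and>
    (\<forall>\<chi>\<in>ba_points A. \<chi> p \<longrightarrow> (\<exists>!r. r \<in> S \<and> \<chi> (fst r))) \<and>
    (\<forall>\<chi>\<in>ba_points C. \<chi> q \<longrightarrow> (\<exists>!r. r \<in> S \<and> \<chi> (snd r)))"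
proof (cases "decides A x p")
  case True
  have "ba_le A p p" "ba_le C q q" unfolding A.le_iff_points C.le_iff_points by auto
  with True assms show ?thesis by (intro exI[of _ "{(p, q)}"]) auto
next
  case False
  have p_nz: "ba_meet A p x \<noteq> ba_bot A" "ba_meet A p (ba_compl A x) \<noteq> ba_bot A"
    using False unfolding decides_def A.le_iff_points A.eq_iff_points by auto
  have "\<not> ba_atom A p"
  proof
    assume "ba_atom A p"
    then have "ba_meet A p x = p" using p_nz(1) by (auto simp: ba_atom_def)
    then have "ba_le A p x" by (simp add: ba_le_def)
    then show False using False by (simp add: decides_def)
  qed
  then have atomless: "ba_atomless A p" "ba_atomless C q" using assms by (auto simp: similar_def)
  have "\<not> ba_atom C q" using atomless(2) by (auto simp: ba_atomless_def ba_le_def)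
  then obtain y where y: "ba_meet C q y \<noteq> q" "ba_meet C q y \<noteq> ba_bot C"
    using atomless(2) by (auto simp: ba_atom_def ba_atomless_def)
  have q_nz: "ba_meet C q (ba_compl C y) \<noteq> ba_bot C"
    using y(1) unfolding C.eq_iff_points by auto
  have below: "ba_le A (ba_meet A p z) p" "ba_le C (ba_meet C q w) q" for z w
    unfolding A.le_iff_points C.le_iff_points by auto
  have "ba_atomless A (ba_meet A p z)" if "ba_meet A p z \<noteq> ba_bot A" for z
    using atomless(1) that le_trans(1)[OF _ below(1)] unfolding ba_atomless_def by blast
  moreover have "ba_atomless C (ba_meet C q z)" if "ba_meet C q z \<noteq> ba_bot C" for z
    using atomless(2) that le_trans(2)[OF _ below(2)] unfolding ba_atomless_def by blast
  ultimately have sim: "similar A C (ba_meet A p x) (ba_meet C q y)"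
    "similar A C (ba_meet A p (ba_compl A x)) (ba_meet C q (ba_compl C y))"
    using p_nz q_nz y(2) by (auto simp: similar_def)
  have dec: "decides A x (ba_meet A p x)" "decides A x (ba_meet A p (ba_compl A x))"
    unfolding decides_def A.le_iff_points by auto
  define S where "S = {(ba_meet A p x, ba_meet C q y),
    (ba_meet A p (ba_compl A x), ba_meet C q (ba_compl C y))}"
  have "\<exists>!r. r \<in> S \<and> \<chi> (fst r)" if "\<chi> \<in> ba_points A" "\<chi> p" for \<chi>
    using that by (cases "\<chi> x") (auto simp: S_def)
  then have "\<forall>\<chi>\<in>ba_points A. \<chi> p \<longrightarrow> (\<exists>!r. r \<in> S \<and> \<chi> (fst r))" by (intro ballI impI)
  moreover have "\<exists>!r. r \<in> S \<and> \<chi> (snd r)" if "\<chi> \<in> ba_points C" "\<chi> q" for \<chi>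
    using that by (cases "\<chi> y") (auto simp: S_def)
  then have "\<forall>\<chi>\<in>ba_points C. \<chi> q \<longrightarrow> (\<exists>!r. r \<in> S \<and> \<chi> (snd r))" by (intro ballI impI)
  moreover have "finite S"
    "\<forall>(p', q')\<in>S. similar A C p' q' \<and> decides A x p' \<and> ba_le A p' p \<and> ba_le C q' q"
    using sim dec below by (simp_all add: S_def)
  ultimately show ?thesis by (intro exI[of _ S] conjI)
qed

lemma forth:
  assumes R: "matching A C R"
  shows "\<exists>R'. matching A C R' \<and> refines A C R' R \<and> (\<forall>(p, q)\<in>R'. decides A x p)"
proof -
  have sim: "similar A C (fst r) (snd r)" if "r \<in> R" for r
    using R that by (auto simp: matching_def)
  let ?split = "\<lambda>r S. finite S \<and>
    (\<forall>(p', q')\<in>S. similar A C p' q' \<and> decides A x p' \<and> ba_le A p' (fst r) \<and> ba_le C q' (snd r)) \<and>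
    (\<forall>\<chi>\<in>ba_points A. \<chi> (fst r) \<longrightarrow> (\<exists>!s. s \<in> S \<and> \<chi> (fst s))) \<and>
    (\<forall>\<chi>\<in>ba_points C. \<chi> (snd r) \<longrightarrow> (\<exists>!s. s \<in> S \<and> \<chi> (snd s)))"
  have "\<forall>r\<in>R. \<exists>S. ?split r S" using split_pair[OF sim] by blast
  from bchoice[OF this] obtain S where split: "\<forall>r\<in>R. ?split r (S r)" ..
  have S1: "finite (S r)" if "r \<in> R" for r
    using bspec[OF split that] by (elim conjE)
  have S2: "similar A C p' q' \<and> decides A x p' \<and> ba_le A p' (fst r) \<and> ba_le C q' (snd r)"
    if "r \<in> R" "(p', q') \<in> S r" for r p' q'
  proof -
    have "\<forall>(p', q')\<in>S r. similar A C p' q' \<and> decides A x p' \<and> ba_le A p' (fst r) \<and> ba_le C q' (snd r)"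
      using bspec[OF split that(1)] by (elim conjE)
    from bspec[OF this that(2)] show ?thesis by simp
  qed
  have S3: "\<exists>!s. s \<in> S r \<and> \<chi> (fst s)" if "r \<in> R" "\<chi> \<in> ba_points A" "\<chi> (fst r)" for r \<chi>
  proof -
    have "\<forall>\<chi>\<in>ba_points A. \<chi> (fst r) \<longrightarrow> (\<exists>!s. s \<in> S r \<and> \<chi> (fst s))"
      using bspec[OF split that(1)] by (elim conjE)
    from bspec[OF this that(2)] that(3) show ?thesis ..
  qed
  have S4: "\<exists>!s. s \<in> S r \<and> \<chi> (snd s)" if "r \<in> R" "\<chi> \<in> ba_points C" "\<chi> (snd r)" for r \<chi>
  proof -
    have "\<forall>\<chi>\<in>ba_points C. \<chi> (snd r) \<longrightarrow> (\<exists>!s. s \<in> S r \<and> \<chi> (snd s))"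
      using bspec[OF split that(1)] by (elim conjE)
    from bspec[OF this that(2)] that(3) show ?thesis ..
  qed
  define R' where "R' = (\<Union>r\<in>R. S r)"
  have unique: "\<exists>!s. s \<in> R' \<and> \<chi> (k s)"
    if ex: "\<exists>!r. r \<in> R \<and> \<chi> (k r)" and sub: "\<And>r. r \<in> R \<Longrightarrow> \<chi> (k r) \<Longrightarrow> \<exists>!s. s \<in> S r \<and> \<chi> (k s)"
      and down: "\<And>r s. r \<in> R \<Longrightarrow> s \<in> S r \<Longrightarrow> \<chi> (k s) \<Longrightarrow> \<chi> (k r)"
    for \<chi> :: "nat \<Rightarrow> bool" and k :: "nat \<times> nat \<Rightarrow> nat"
  proof -
    obtain r where r: "r \<in> R" "\<chi> (k r)" "\<And>r'. r' \<in> R \<Longrightarrow> \<chi> (k r') \<Longrightarrow> r' = r" using ex by blast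
    from sub[OF r(1,2)] obtain s where
      "s \<in> S r \<and> \<chi> (k s)" "\<forall>s'. s' \<in> S r \<and> \<chi> (k s') \<longrightarrow> s' = s"
      by (rule ex1E)
    then have s: "s \<in> S r" "\<chi> (k s)" "\<And>s'. s' \<in> S r \<Longrightarrow> \<chi> (k s') \<Longrightarrow> s' = s" by blast+
    show ?thesis
    proof (rule ex1I[of _ s])
      show "s \<in> R' \<and> \<chi> (k s)" using r(1) s(1,2) unfolding R'_def by blast
      fix s' assume s': "s' \<in> R' \<and> \<chi> (k s')"
      then obtain r' where "r' \<in> R" "s' \<in> S r'" unfolding R'_def by blast
      moreover from this have "r' = r" using down s' by (intro r(3)) simp_all
      ultimately show "s' = s" using s' by (intro s(3)) simp_all
    qed
  qed
  have "matching A C R'"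
    unfolding matching_def
  proof (intro conjI ballI)
    show "finite R'" using R S1 by (auto simp: R'_def matching_def)
    show "case r of (p, q) \<Rightarrow> similar A C p q" if "r \<in> R'" for r
      using that S2 by (fastforce simp: R'_def)
    show "\<exists>!s. s \<in> R' \<and> \<chi> (fst s)" if \<chi>: "\<chi> \<in> ba_points A" for \<chi>
    proof (rule unique)
      show "\<exists>!r. r \<in> R \<and> \<chi> (fst r)" using R \<chi> by (simp add: matching_def)
      show "\<chi> (fst r)" if "r \<in> R" "s \<in> S r" "\<chi> (fst s)" for r s
        using S2[OF that(1), of "fst s" "snd s"] that \<chi> by (auto simp: A.le_iff_points)
    qed (rule S3[OF _ \<chi>])
    show "\<exists>!s. s \<in> R' \<and> \<chi> (snd s)" if \<chi>: "\<chi> \<in> ba_points C" for \<chi>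
    proof (rule unique)
      show "\<exists>!r. r \<in> R \<and> \<chi> (snd r)" using R \<chi> by (simp add: matching_def)
      show "\<chi> (snd r)" if "r \<in> R" "s \<in> S r" "\<chi> (snd s)" for r s
        using S2[OF that(1), of "fst s" "snd s"] that \<chi> by (auto simp: C.le_iff_points)
    qed (rule S4[OF _ \<chi>])
  qed
  moreover have "refines A C R' R" unfolding refines_def R'_def using S2 by fastforce
  moreover have "\<forall>(p, q)\<in>R'. decides A x p" unfolding R'_def using S2 by fastforce
  ultimately show ?thesis by blast
qed

end

lemma two_ba_swap: "two_ba A C \<Longrightarrow> two_ba C A"
  by (simp add: two_ba_def)

context two_ba
begin

lemma back_and_forth_step:
  assumes "matching A C R"
  shows "\<exists>R'. matching A C R' \<and> refines A C R' R \<and>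
    (\<forall>(p, q)\<in>R'. decides A x p \<and> decides C x q)"
proof -
  obtain R1 where R1: "matching A C R1" "refines A C R1 R" "\<forall>(p, q)\<in>R1. decides A x p"
    using forth[OF assms] by blast
  interpret swap: two_ba C A by (rule two_ba_swap) unfold_locales
  have "matching C A (R1\<inverse>)" using R1(1) by (simp add: matching_converse)
  then obtain R2 where "matching C A (R2\<inverse>)" "refines C A (R2\<inverse>) (R1\<inverse>)"
      and dec: "\<forall>(q, p)\<in>R2\<inverse>. decides C x q"
    using swap.forth[of "R1\<inverse>" x] by (metis converse_converse)
  then have R2: "matching A C R2" "refines A C R2 R1"
    by (simp_all add: matching_converse refines_converse)
  have "\<forall>(p, q)\<in>R2. decides A x p \<and> decides C x q"
  proof clarify
    fix p q assume pq: "(p, q) \<in> R2"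
    then obtain p' q' where "(p', q') \<in> R1" "ba_le A p p'"
      using R2(2) unfolding refines_def by blast
    then show "decides A x p \<and> decides C x q"
      using R1(3) dec pq le_trans(1) unfolding decides_def by fast
  qed
  then show ?thesis using R2 refines_trans[OF R2(2) R1(2)] by blast
qed

text \<open>Stage \<open>Suc n\<close> decides the number \<open>n\<close> in both algebras, so
  every element acquires a partner on the other side. Refinement preserves ties, and partners are
  unique because pieces are nonzero and cover everything.\<close>

theorem isomorphic_if_matching:
  assumes R0: "matching A C R0"
  shows "isomorphic A C"
proof -
  have "\<exists>R. \<forall>n. matching A C (R n) \<and> (refines A C (R (Suc n)) (R n) \<and>
      (\<forall>(p, q)\<in>R (Suc n). decides A n p \<and> decides C n q))"
    by (rule dependent_nat_choice) (use R0 back_and_forth_step in blast)+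
  then obtain R where match: "\<And>n. matching A C (R n)" and ref: "\<And>n. refines A C (R (Suc n)) (R n)"
    and dec: "\<And>n p q. (p, q) \<in> R (Suc n) \<Longrightarrow> decides A n p \<and> decides C n q"
    by blast
  have tied_Suc: "tied A C (R n) x y \<Longrightarrow> tied A C (R (n + k)) x y" for n k x y
    by (induction k) (auto intro: tied_refines ref)
  then have tied_mono: "tied A C (R n) x y \<Longrightarrow> n \<le> m \<Longrightarrow> tied A C (R m) x y" for n m x y
    by (metis le_Suc_ex)
  define T where "T = (\<lambda>x y. \<exists>n. tied A C (R n) x y)"
  interpret swap: two_ba C A by (rule two_ba_swap) unfold_locales
  have T_common: "\<exists>n. tied A C (R n) x y \<and> tied A C (R n) x' y'" if "T x y" "T x' y'" for x y x' y'
    using that tied_mono unfolding T_def by (meson max.cobounded1 max.cobounded2)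
  have T_fun: "y = y'" if "T x y" "T x y'" for x y y'
    using T_common[OF that] tied_functional[OF match] by blast
  have T_inj: "x = x'" if "T x y" "T x' y" for x x' y
  proof -
    obtain n where "tied A C (R n) x y" "tied A C (R n) x' y"
      using T_common[OF \<open>T x y\<close> \<open>T x' y\<close>] by blast
    then show ?thesis
      using swap.tied_functional[of "(R n)\<inverse>" y x x'] match by (simp add: matching_converse tied_converse)
  qed
  have T_total: "\<exists>y. T x y" for x
    using tied_total[OF match, of "Suc x"] dec unfolding T_def by blast
  have T_surj: "\<exists>x. T x y" for y
  proof -
    have "\<exists>x. tied C A ((R (Suc y))\<inverse>) y x"
      by (rule swap.tied_total) (use match dec in \<open>auto simp: matching_converse\<close>)
    then show ?thesis unfolding T_def tied_converse by blast
  qed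
  have T_meet: "T (ba_meet A x x') (ba_meet C y y')" if "T x y" "T x' y'" for x y x' y'
  proof -
    obtain n where n: "tied A C (R n) x y" "tied A C (R n) x' y'"
      using T_common[OF \<open>T x y\<close> \<open>T x' y'\<close>] by blast
    have "tied A C (R n) (ba_meet A x x') (ba_meet C y y')"
      unfolding tied_def
    proof (intro ballI, clarify)
      fix p q
      assume pq: "(p, q) \<in> R n" and
        *: "\<not> (ba_le A p (ba_compl A (ba_meet A x x')) \<and> ba_le C q (ba_compl C (ba_meet C y y')))"
      have "ba_le A p x \<and> ba_le C q y \<or> ba_le A p (ba_compl A x) \<and> ba_le C q (ba_compl C y)"
        "ba_le A p x' \<and> ba_le C q y' \<or> ba_le A p (ba_compl A x') \<and> ba_le C q (ba_compl C y')"
        using n pq unfolding tied_def by blast+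
      moreover have "ba_le A p (ba_compl A z) \<Longrightarrow> z = x \<or> z = x' \<Longrightarrow> ba_le A p (ba_compl A (ba_meet A x x'))"
        "ba_le C q (ba_compl C w) \<Longrightarrow> w = y \<or> w = y' \<Longrightarrow> ba_le C q (ba_compl C (ba_meet C y y'))" for z w
        unfolding A.le_iff_points C.le_iff_points by auto
      ultimately have "ba_le A p x \<and> ba_le C q y" "ba_le A p x' \<and> ba_le C q y'" using * by blast+
      then show "ba_le A p (ba_meet A x x') \<and> ba_le C q (ba_meet C y y')"
        unfolding A.le_iff_points C.le_iff_points by auto
    qed
    then show ?thesis unfolding T_def by blast
  qed
  have T_compl: "T (ba_compl A x) (ba_compl C y)" if "T x y" for x y
    using that unfolding T_def tied_def by auto
  have T_top: "T (ba_top A) (ba_top C)"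
    unfolding T_def tied_def A.le_iff_points C.le_iff_points by auto
  have T_join: "T (ba_join A x x') (ba_join C y y')" if "T x y" "T x' y'" for x y x' y'
    using T_compl[OF T_meet[OF T_compl[OF that(1)] T_compl[OF that(2)]]] by simp
  have T_bot: "T (ba_bot A) (ba_bot C)" using T_compl[OF T_top] by simp
  obtain f where f: "\<And>x. T x (f x)" using T_total by metis
  have "bij f"
    unfolding bij_def
  proof
    show "inj f" using f T_inj by (metis injI)
    show "surj f" using f T_fun T_surj by (metis surjI)
  qed
  then have "is_iso A C f"
    unfolding is_iso_def using T_fun[OF f] T_meet[OF f f] T_join[OF f f] T_compl[OF f] T_top T_bot by blast
  then show ?thesis unfolding isomorphic_def by blast
qed

end

context ba
begin

text \<open>If the atoms covered everything, an element would be determined by the atoms below it.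
  Then there would be only finitely many elements, whereas the domain is the set of all natural
  numbers.\<close>

lemma atomless_part:
  assumes fin: "finite {a. ba_atom A a}"
  shows "\<exists>r. ba_atomless A r \<and> (\<forall>\<chi>\<in>ba_points A. \<chi> r \<longleftrightarrow> \<not> (\<exists>a. ba_atom A a \<and> \<chi> a))"
proof -
  interpret two_ba A A by unfold_locales
  obtain y where "\<forall>\<chi>\<in>ba_points A. \<chi> y \<longleftrightarrow> (\<exists>a\<in>{a. ba_atom A a}. \<chi> a)"
    using finite_join[OF fin] ..
  then have y: "\<chi> y \<longleftrightarrow> (\<exists>a. ba_atom A a \<and> \<chi> a)" if "\<chi> \<in> ba_points A" for \<chi>
    using that by simp
  define r where "r = ba_compl A y"
  have r: "\<chi> r \<longleftrightarrow> \<not> (\<exists>a. ba_atom A a \<and> \<chi> a)" if "\<chi> \<in> ba_points A" for \<chi>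
    using y that by (simp add: r_def)
  have "r \<noteq> ba_bot A"
  proof
    assume "r = ba_bot A"
    then have cover: "\<exists>a. ba_atom A a \<and> \<chi> a" if "\<chi> \<in> ba_points A" for \<chi>
      using r[OF that] that by simp
    have "inj (\<lambda>x. {a. ba_atom A a \<and> ba_le A a x})"
    proof (rule injI)
      fix x x' assume eq: "{a. ba_atom A a \<and> ba_le A a x} = {a. ba_atom A a \<and> ba_le A a x'}"
      show "x = x'"
        unfolding eq_iff_points
      proof
        fix \<chi> assume \<chi>: "\<chi> \<in> ba_points A"
        then obtain a where a: "ba_atom A a" "\<chi> a" using cover by blast
        then show "\<chi> x \<longleftrightarrow> \<chi> x'"
          using eq atom_le_or_disjoint[OF a(1) \<chi> a(2)] by blast
      qed
    qed
    moreover have "finite (range (\<lambda>x. {a. ba_atom A a \<and> ba_le A a x}))"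
      by (rule finite_subset[of _ "Pow {a. ba_atom A a}"]) (use fin in auto)
    ultimately show False using finite_imageD infinite_UNIV_nat by blast
  qed
  moreover have "\<not> ba_le A a r" if "ba_atom A a" for a
    using r[OF atom_point[OF that]] that by (auto simp: ba_le_def)
  ultimately have "ba_atomless A r" by (auto simp: ba_atomless_def)
  then show ?thesis using r by blast
qed

end

text \<open>The initial matching pairs the atoms by any bijection, and the atomless complements of
  their joins with each other.\<close>

theorem isomorphic_if_card_atoms_eq:
  assumes "is_boolean_algebra A" "is_boolean_algebra C"
    and finA: "finite {a. ba_atom A a}" and finC: "finite {a. ba_atom C a}"
    and card: "card {a. ba_atom A a} = card {a. ba_atom C a}"
  shows "isomorphic A C"
proof -
  interpret two_ba A C using assms(1,2) by unfold_locales
  obtain \<beta> where \<beta>: "bij_betw \<beta> {a. ba_atom A a} {a. ba_atom C a}"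
    using finite_same_card_bij[OF finA finC card] by blast
  from A.atomless_part[OF finA] obtain r where
    "ba_atomless A r \<and> (\<forall>\<chi>\<in>ba_points A. \<chi> r \<longleftrightarrow> \<not> (\<exists>a. ba_atom A a \<and> \<chi> a))" ..
  then have r: "ba_atomless A r" "\<And>\<chi>. \<chi> \<in> ba_points A \<Longrightarrow> \<chi> r \<longleftrightarrow> \<not> (\<exists>a. ba_atom A a \<and> \<chi> a)"
    by simp_all
  from C.atomless_part[OF finC] obtain s where
    "ba_atomless C s \<and> (\<forall>\<chi>\<in>ba_points C. \<chi> s \<longleftrightarrow> \<not> (\<exists>a. ba_atom C a \<and> \<chi> a))" ..
  then have s: "ba_atomless C s" "\<And>\<chi>. \<chi> \<in> ba_points C \<Longrightarrow> \<chi> s \<longleftrightarrow> \<not> (\<exists>a. ba_atom C a \<and> \<chi> a)"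
    by simp_all
  define R where "R = insert (r, s) ((\<lambda>a. (a, \<beta> a)) ` {a. ba_atom A a})"
  have \<beta>_atom: "ba_atom A a \<Longrightarrow> ba_atom C (\<beta> a)" for a using \<beta> by (auto simp: bij_betw_def)
  have "matching A C R"
    unfolding matching_def
  proof (intro conjI ballI)
    show "finite R" using finA by (simp add: R_def)
    show "case x of (p, q) \<Rightarrow> similar A C p q" if "x \<in> R" for x
      using that r(1) s(1) \<beta>_atom by (auto simp: R_def similar_def)
    show "\<exists>!x. x \<in> R \<and> \<chi> (fst x)" if \<chi>: "\<chi> \<in> ba_points A" for \<chi>
    proof (cases "\<chi> r")
      case True
      then show ?thesis using r(2)[OF \<chi>] by (intro ex1I[of _ "(r, s)"]) (auto simp: R_def)
    next
      case False
      then obtain a where a: "ba_atom A a" "\<chi> a" using r(2)[OF \<chi>] by blast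
      have "a' = a" if "ba_atom A a'" "\<chi> a'" for a'
        using A.atom_le_or_disjoint[OF a(1) \<chi> a(2), of a'] A.atoms_le_iff_eq[OF a(1) that(1)] that(2)
        by blast
      note unique = this
      show ?thesis
      proof (rule ex1I[of _ "(a, \<beta> a)"])
        show "(a, \<beta> a) \<in> R \<and> \<chi> (fst (a, \<beta> a))" using a by (simp add: R_def)
        show "x = (a, \<beta> a)" if x: "x \<in> R \<and> \<chi> (fst x)" for x
        proof -
          have "x \<noteq> (r, s)" using x False by auto
          then obtain a' where "x = (a', \<beta> a')" "ba_atom A a'" using x by (auto simp: R_def)
          then show ?thesis using unique[of a'] x by simp
        qed
      qed
    qed
    show "\<exists>!x. x \<in> R \<and> \<chi> (snd x)" if \<chi>: "\<chi> \<in> ba_points C" for \<chi>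
    proof (cases "\<chi> s")
      case True
      then show ?thesis using s(2)[OF \<chi>] \<beta>_atom by (intro ex1I[of _ "(r, s)"]) (auto simp: R_def)
    next
      case False
      then obtain b where b: "ba_atom C b" "\<chi> b" using s(2)[OF \<chi>] by blast
      then obtain a where a: "ba_atom A a" "b = \<beta> a" using \<beta> by (auto simp: bij_betw_def)
      have "a' = a" if "ba_atom A a'" "\<chi> (\<beta> a')" for a'
      proof -
        have "\<beta> a' = \<beta> a"
          using C.atom_le_or_disjoint[OF b(1) \<chi> b(2), of "\<beta> a'"] that(2)
            C.atoms_le_iff_eq[OF b(1) \<beta>_atom[OF that(1)]] a(2) by blast
        then show ?thesis using \<beta> that(1) a(1) by (auto simp: bij_betw_def inj_on_def)
      qed
      note unique = this
      show ?thesis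
      proof (rule ex1I[of _ "(a, \<beta> a)"])
        show "(a, \<beta> a) \<in> R \<and> \<chi> (snd (a, \<beta> a))" using a b by (simp add: R_def)
        show "x = (a, \<beta> a)" if x: "x \<in> R \<and> \<chi> (snd x)" for x
        proof -
          have "x \<noteq> (r, s)" using x False by auto
          then obtain a' where "x = (a', \<beta> a')" "ba_atom A a'" using x by (auto simp: R_def)
          then show ?thesis using unique[of a'] x by simp
        qed
      qed
    qed
  qed
  then show ?thesis by (rule isomorphic_if_matching)
qed

section \<open>Computability of the atomic diagram\<close>

lemma is_iso_inv:
  assumes "is_iso A C f"
  shows "is_iso C A (inv f)"
proof -
  have f: "bij f" using assms by (simp add: is_iso_def)
  have inv: "inv f (f x) = x" "f (inv f y) = y" for x y
    using f by (simp_all add: bij_is_inj bij_is_surj surj_f_inv_f)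
  have eq: "inv f y = x \<longleftrightarrow> y = f x" for x y using inv by metis
  show ?thesis using assms f unfolding is_iso_def eq by (simp add: inv bij_imp_bij_inv)
qed

lemma is_iso_comp: "is_iso A C f \<Longrightarrow> is_iso C E h \<Longrightarrow> is_iso A E (h \<circ> f)"
  unfolding is_iso_def by (simp add: bij_comp)

text \<open>Course-of-values recursion: \<open>history step x\<close> is the list of the values below \<open>x\<close>, coded by
  iterated pairing with the most recent value in front.\<close>

definition history :: "(nat \<Rightarrow> nat \<Rightarrow> nat) \<Rightarrow> nat \<Rightarrow> nat" where
  "history step x = rec_nat 0 (\<lambda>k h. prod_encode (step k h, h)) x"

definition lookup :: "nat \<Rightarrow> nat \<Rightarrow> nat" where
  "lookup h j = fst (prod_decode (rec_nat h (\<lambda>_ v. snd (prod_decode v)) j))"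

text \<open>The front entry of \<open>history step x\<close> belongs to \<open>x - 1\<close>, so the
  entry of \<open>y\<close> sits at depth \<open>x - Suc y\<close>.\<close>

lemma lookup_history:
  assumes "y < x"
  shows "lookup (history step x) (x - Suc y) = step y (history step y)"
proof -
  have "rec_nat (history step (y + j)) (\<lambda>_ v. snd (prod_decode v)) j = history step y" for j y
  proof (induction j arbitrary: y)
    case (Suc j)
    show ?case using Suc[of "Suc y"] by (simp add: history_def)
  qed simp
  from this[of "Suc y" "x - Suc y"] show ?thesis
    using assms by (simp add: lookup_def) (simp add: history_def)
qed

lemma rec_history:
  assumes "recursive_in mu orc g 2 (binary step)" "recursive_in mu orc g n a"
  shows "recursive_in mu orc g n (\<lambda>xs. history step (a xs))"
  unfolding history_def
  by (intro rec_intros assms rec_binary[OF assms(1)]) auto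

lemma rec_lookup [rec_intros]:
  assumes "recursive_in mu orc g n a" "recursive_in mu orc g n b"
  shows "recursive_in mu orc g n (\<lambda>xs. lookup (a xs) (b xs))"
  unfolding lookup_def by (intro rec_intros assms) auto

definition term_step :: "ba_structure \<Rightarrow> nat \<Rightarrow> nat \<Rightarrow> nat" where
  "term_step C x h = (let t = fst (prod_decode x); y = snd (prod_decode x);
     v = lookup h (x - Suc y);
     a = lookup h (x - Suc (fst (prod_decode y))); b = lookup h (x - Suc (snd (prod_decode y))) in
     if t = 0 then Suc y
     else if t = 1 then (if y = 0 then Suc (ba_top C) else 0)
     else if t = 2 then (if y = 0 then Suc (ba_bot C) else 0)
     else if t = 3 then (if v = 0 then 0 else Suc (ba_compl C (v - 1)))
     else if t = 4 then (if a = 0 \<or> b = 0 then 0 else Suc (ba_join C (a - 1) (b - 1)))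
     else if t = 5 then (if a = 0 \<or> b = 0 then 0 else Suc (ba_meet C (a - 1) (b - 1)))
     else 0)"

text \<open>This is \<open>Suc v\<close> if \<open>x\<close> is the code of a term with value \<open>v\<close>, and \<open>0\<close> if \<open>x\<close> is no such code.\<close>

definition coded_val :: "ba_structure \<Rightarrow> nat \<Rightarrow> nat" where
  "coded_val C x = term_step C x (history (term_step C) x)"

text \<open>The descent behind the course-of-values recursion. It fails for tag 0, as
  \<open>prod_encode (0, 1) = 1\<close>, but that tag marks \<open>Elem\<close>, where no recursive
  call is made.\<close>

lemma less_prod_encode: "0 < t \<Longrightarrow> y < prod_encode (t, y)"
proof -
  assume "0 < t"
  have "n \<le> triangle n" for n by (induction n) auto
  from this[of "t + y"] \<open>0 < t\<close> show ?thesis by (simp add: prod_encode_def)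
qed

lemma coded_val_eq:
  "coded_val C (prod_encode (t, y)) =
    (if t = 0 then Suc y
     else if t = 1 then (if y = 0 then Suc (ba_top C) else 0)
     else if t = 2 then (if y = 0 then Suc (ba_bot C) else 0)
     else if t = 3 then (if coded_val C y = 0 then 0 else Suc (ba_compl C (coded_val C y - 1)))
     else if t = 4 \<or> t = 5 then
       (let a = coded_val C (fst (prod_decode y)); b = coded_val C (snd (prod_decode y)) in
        if a = 0 \<or> b = 0 then 0
        else if t = 4 then Suc (ba_join C (a - 1) (b - 1)) else Suc (ba_meet C (a - 1) (b - 1)))
     else 0)"
proof (cases "t = 0")
  case False
  let ?x = "prod_encode (t, y)"
  have y: "y < ?x" using False by (simp add: less_prod_encode)
  have "fst (prod_decode y) \<le> y" "snd (prod_decode y) \<le> y"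
    by (metis le_prod_encode_1 prod.collapse prod_decode_inverse)
      (metis le_prod_encode_2 prod.collapse prod_decode_inverse)
  then have ab: "fst (prod_decode y) < ?x" "snd (prod_decode y) < ?x" using y by simp_all
  show ?thesis
    unfolding coded_val_def[of C "prod_encode (t, y)"] term_step_def[of C "prod_encode (t, y)"]
      Let_def prod_encode_inverse fst_conv snd_conv
    unfolding lookup_history[OF y] lookup_history[OF ab(1)] lookup_history[OF ab(2)]
    unfolding coded_val_def[symmetric]
    using False by simp
qed (simp add: coded_val_def term_step_def)

lemma coded_val_term_code: "coded_val C (term_code t) = Suc (term_val C t)"
  by (induction t) (simp_all add: coded_val_eq)

lemma coded_val_imp_term_code:
  assumes "coded_val C x \<noteq> 0"
  shows "\<exists>t. x = term_code t"
  using assms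
proof (induction x rule: less_induct)
  case (less x)
  obtain t y where x: "x = prod_encode (t, y)" by (metis prod_decode_inverse surj_pair)
  show ?case
  proof (cases "t = 0")
    case True
    then show ?thesis by (intro exI[of _ "Elem y"]) (simp add: x)
  next
    case False
    have y: "y < x" using False by (simp add: x less_prod_encode)
    obtain a b where ab: "y = prod_encode (a, b)" by (metis prod_decode_inverse surj_pair)
    have lt: "a < x" "b < x" using y le_prod_encode_1[of a b] le_prod_encode_2[of b a] by (simp_all add: ab)
    consider "t = 1" "y = 0" | "t = 2" "y = 0" | "t = 3" "coded_val C y \<noteq> 0"
      | "t = 4 \<or> t = 5" "coded_val C a \<noteq> 0" "coded_val C b \<noteq> 0"
      using less.prems False unfolding x coded_val_eq by (auto simp: ab Let_def split: if_splits)
    then show ?thesis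
    proof cases
      case 1
      then show ?thesis by (intro exI[of _ Top]) (simp add: x)
    next
      case 2
      then show ?thesis by (intro exI[of _ Bot]) (simp add: x)
    next
      case 3
      then obtain s where "y = term_code s" using less.IH[OF y] by blast
      with 3 show ?thesis by (intro exI[of _ "Compl s"]) (simp add: x)
    next
      case 4
      then obtain s s' where "a = term_code s" "b = term_code s'" using less.IH lt by blast
      then have "x = term_code (Join s s') \<or> x = term_code (Meet s s')" using 4(1) by (auto simp: x ab)
      then show ?thesis by blast
    qed
  qed
qed

lemma atomic_diagram_iff:
  "x \<in> atomic_diagram C \<longleftrightarrow>
    (let i = fst (prod_decode x); w = snd (prod_decode x);
       a = coded_val C (fst (prod_decode w)); b = coded_val C (snd (prod_decode w)) in
     a \<noteq> 0 \<and> b \<noteq> 0 \<and> (i = 0 \<and> a = b \<or> i = 1 \<and> a \<noteq> b))"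
proof -
  obtain i a b where x: "x = prod_encode (i, prod_encode (a, b))"
    by (metis prod_decode_inverse surj_pair)
  show ?thesis
  proof
    assume "x \<in> atomic_diagram C"
    then show "let i = fst (prod_decode x); w = snd (prod_decode x);
       a = coded_val C (fst (prod_decode w)); b = coded_val C (snd (prod_decode w)) in
     a \<noteq> 0 \<and> b \<noteq> 0 \<and> (i = 0 \<and> a = b \<or> i = 1 \<and> a \<noteq> b)"
      by (auto simp: atomic_diagram_def eq_code_def neq_code_def coded_val_term_code)
  next
    assume *: "let i = fst (prod_decode x); w = snd (prod_decode x);
       a = coded_val C (fst (prod_decode w)); b = coded_val C (snd (prod_decode w)) in
     a \<noteq> 0 \<and> b \<noteq> 0 \<and> (i = 0 \<and> a = b \<or> i = 1 \<and> a \<noteq> b)"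
    then have "coded_val C a \<noteq> 0" "coded_val C b \<noteq> 0" by (simp_all add: x Let_def)
    then obtain s t where st: "a = term_code s" "b = term_code t"
      using coded_val_imp_term_code by metis
    then have "i = 0 \<and> term_val C s = term_val C t \<or> i = 1 \<and> term_val C s \<noteq> term_val C t"
      using * by (auto simp: x Let_def coded_val_term_code)
    then show "x \<in> atomic_diagram C"
      unfolding atomic_diagram_def eq_code_def neq_code_def x st by blast
  qed
qed

lemma punctual_atomic_diagram:
  assumes "punctual C"
  shows "recursive_in mu orc g 1 (unary (\<lambda>x. of_bool (x \<in> atomic_diagram C)))"
proof -
  have ops: "recursive_in mu orc g 2 (binary (ba_join C))" "recursive_in mu orc g 2 (binary (ba_meet C))"
    "recursive_in mu orc g 1 (unary (ba_compl C))"
    using assms by (auto simp: punctual_def intro: recursive_in_primitive)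
  have step: "recursive_in mu orc g 2 (binary (term_step C))"
    unfolding term_step_def Let_def
    by (intro rec_intros rec_binary[OF ops(1)] rec_binary[OF ops(2)] rec_unary[OF ops(3)]) auto
  have "recursive_in mu orc g 1 (unary (coded_val C))"
    unfolding coded_val_def
    by (intro rec_binary[OF step] rec_history[OF step] rec_intros) auto
  note val = rec_unary[OF this]
  show ?thesis
    unfolding atomic_diagram_iff Let_def by (intro rec_intros val) auto
qed

lemma computable_inv:
  assumes "bij f" "computable 1 (unary f)"
  shows "computable 1 (unary (inv f))"
proof -
  have f: "recursive_in True False g 1 (unary f)" for g
    using assms(2) by (simp add: computable_iff[of _ _ g])
  have "recursive_in True False g 1 (\<lambda>xs. LEAST y. of_bool (f ((y # xs) ! 0) \<noteq> (y # xs) ! 1) = (0 :: nat))" for g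
  proof (rule rec_Mu)
    show "recursive_in True False g (Suc 1) (\<lambda>xs. of_bool (f (xs ! 0) \<noteq> xs ! 1))"
      by (intro rec_intros rec_unary[OF f]) auto
    show "\<exists>y. of_bool (f ((y # xs) ! 0) \<noteq> (y # xs) ! 1) = (0 :: nat)" for xs :: "nat list"
      using assms(1) by (intro exI[of _ "inv f (xs ! 0)"]) (simp add: bij_is_surj surj_f_inv_f)
  qed simp
  moreover have "(LEAST y. of_bool (f y \<noteq> x) = (0 :: nat)) = inv f x" for x
  proof (rule Least_equality)
    show "of_bool (f (inv f x) \<noteq> x) = (0 :: nat)" using assms(1) by (simp add: bij_is_surj surj_f_inv_f)
    show "inv f x \<le> y" if "of_bool (f y \<noteq> x) = (0 :: nat)" for y
      using that assms(1) by (auto simp: bij_is_inj)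
  qed
  ultimately show ?thesis unfolding computable_iff[of _ _ "\<lambda>_. 0"] by simp
qed

theorem Cone_subset_PrCat:
  assumes "relatively_computably_categorical A"
  shows "Cone_Delta01 \<subseteq> PrCat A"
proof
  fix d assume d: "d \<in> Cone_Delta01"
  show "d \<in> PrCat A"
    unfolding PrCat_def
  proof (intro CollectI conjI allI impI)
    show "d \<in> PR_degrees" using d by (simp add: Cone_Delta01_def)
    fix C assume C: "punctual C \<and> isomorphic C A"
    then obtain f r where f: "is_iso C A f"
      "computes (\<lambda>n. of_bool (n \<in> atomic_diagram C)) r 1 (unary f)"
      using assms unfolding relatively_computably_categorical_def computable_relative_to_def by blast
    have "recursive_in True True (\<lambda>n. of_bool (n \<in> atomic_diagram C)) 1 (unary f)"
      using f(2) unfolding recursive_in_def by blast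
    then have "recursive_in True False (\<lambda>_. 0) 1 (unary f)"
      by (rule recursive_in_trans) (rule punctual_atomic_diagram, use C in simp)
    then have comp: "computable 1 (unary f)" by (simp add: computable_iff[of _ _ "\<lambda>_. 0"])
    have bij: "bij f" using f(1) by (simp add: is_iso_def)
    show "\<exists>f. is_iso A C f \<and> le_PR_degree f d \<and> le_PR_degree (inv f) d"
      using is_iso_inv[OF f(1)] comp computable_inv[OF bij comp] d inv_inv_eq[OF bij]
      by (intro exI[of _ "inv f"]) (simp add: Cone_Delta01_def)
  qed
qed

section \<open>Interval algebras\<close>

definition region :: "(nat \<Rightarrow> real) \<Rightarrow> nat \<Rightarrow> nat set" where
  "region key x = {p. odd (card {s \<in> set_decode x. key s \<le> key p})}"

definition later :: "(nat \<Rightarrow> real) \<Rightarrow> nat \<Rightarrow> nat \<Rightarrow> nat" where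
  "later key s t = (if key s \<le> key t then t else s)"

text \<open>The later of two end points is one of them, hence below \<open>x + y\<close>; an
  explicit bound turns the set into a bounded sum.\<close>

definition interval_meet :: "(nat \<Rightarrow> real) \<Rightarrow> nat \<Rightarrow> nat \<Rightarrow> nat" where
  "interval_meet key x y = set_encode {u. u < x + y \<and>
     odd (card {(s, t). s \<in> set_decode x \<and> t \<in> set_decode y \<and> later key s t = u})}"

definition interval_compl :: "nat \<Rightarrow> nat \<Rightarrow> nat" where
  "interval_compl z x = (if z \<in> set_decode x then x - 2 ^ z else x + 2 ^ z)"

text \<open>The interval algebra of the linear order that \<open>key\<close> induces on the natural numbers, with
  least element \<open>z\<close>.  A natural number codes the finite set of its binary digits, and thereby the
  symmetric difference of the final segments starting at the elements of this set; \<open>region\<close> is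
  the resulting set of points.  Hence the number codes correspond bijectively to the finite unions
  of half-open intervals.  The meet is computed in the Boolean ring of symmetric differences, where
  the product of the final segments starting at \<open>s\<close> and \<open>t\<close> is the one starting at the later of
  the two points.\<close>

definition interval_algebra :: "(nat \<Rightarrow> real) \<Rightarrow> nat \<Rightarrow> ba_structure" where
  "interval_algebra key z = \<lparr>
     ba_join = \<lambda>x y. interval_compl z (interval_meet key (interval_compl z x) (interval_compl z y)),
     ba_meet = interval_meet key, ba_compl = interval_compl z, ba_top = 2 ^ z, ba_bot = 0\<rparr>"

lemma set_decode_less: "s \<in> set_decode x \<Longrightarrow> s < x"
proof -
  assume "s \<in> set_decode x"
  then have "x div 2 ^ s \<noteq> 0" unfolding set_decode_def by (auto intro: ccontr)
  then have "2 ^ s \<le> x" by (metis div_less not_less)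
  then show "s < x" using less_exp[of s] by linarith
qed

text \<open>Cancellation modulo 2: keeping only end points of odd multiplicity does not change the
  parity of the total.\<close>

lemma odd_card_odd:
  fixes c :: "'a \<Rightarrow> nat"
  assumes "finite U"
  shows "odd (card {u \<in> U. odd (c u)}) \<longleftrightarrow> odd (\<Sum>u\<in>U. c u)"
  using assms
proof induction
  case (insert v U)
  have "{u \<in> insert v U. odd (c u)} = (if odd (c v) then insert v {u \<in> U. odd (c u)} else {u \<in> U. odd (c u)})"
    by auto
  then show ?case using insert by simp
qed simp

lemma min_key:
  fixes key :: "nat \<Rightarrow> real"
  assumes "finite D" "D \<noteq> {}"
  obtains p where "p \<in> D" "\<And>q. q \<in> D \<Longrightarrow> key p \<le> key q"
proof -
  have fin: "finite (key ` D)" "key ` D \<noteq> {}" using assms by simp_all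
  obtain p where "p \<in> D" "key p = Min (key ` D)" using Min_in[OF fin] by (metis imageE)
  then show ?thesis using Min_le[OF fin(1)] by (intro that[of p]) auto
qed

locale interval_order =
  fixes key :: "nat \<Rightarrow> real" and z :: nat
  assumes inj_key: "inj key" and least: "\<And>p. key z \<le> key p"
begin

abbreviation "I \<equiv> interval_algebra key z"

lemma key_eq_iff [simp]: "key p = key q \<longleftrightarrow> p = q"
  using inj_key by (simp add: inj_eq)

text \<open>Up to the leftmost point \<open>p\<close> of the symmetric difference, the two sets of
  end points differ in \<open>p\<close> alone, so \<open>p\<close> lies in exactly one of the
  regions.\<close>

lemma region_eqD:
  assumes "region key x = region key y"
  shows "x = y"
proof (rule ccontr)
  assume "x \<noteq> y"
  let ?D = "(set_decode x - set_decode y) \<union> (set_decode y - set_decode x)"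
  have "set_decode x \<noteq> set_decode y" using \<open>x \<noteq> y\<close> by (metis set_decode_inverse)
  then have "?D \<noteq> {}" by blast
  moreover have "finite ?D" by simp
  ultimately obtain p where p: "p \<in> ?D" and min: "\<And>q. q \<in> ?D \<Longrightarrow> key p \<le> key q"
    using min_key[of ?D key] by blast
  have differ: "p \<in> region key x \<longleftrightarrow> p \<notin> region key y"
    if "p \<in> set_decode x - set_decode y"
      "\<And>q. q \<in> (set_decode x - set_decode y) \<union> (set_decode y - set_decode x) \<Longrightarrow> key p \<le> key q"
    for x y
  proof -
    have "{s \<in> set_decode x. key s \<le> key p} = insert p {s \<in> set_decode y. key s \<le> key p}"
    proof (intro set_eqI iffI)
      fix s assume s: "s \<in> {s \<in> set_decode x. key s \<le> key p}"
      have "s \<notin> set_decode y \<Longrightarrow> key p \<le> key s" using that(2)[of s] s by blast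
      then show "s \<in> insert p {s \<in> set_decode y. key s \<le> key p}" using s by fastforce
    next
      fix s assume s: "s \<in> insert p {s \<in> set_decode y. key s \<le> key p}"
      have "s \<notin> set_decode x \<Longrightarrow> s \<in> set_decode y \<Longrightarrow> key p \<le> key s" using that(2)[of s] by blast
      then show "s \<in> {s \<in> set_decode x. key s \<le> key p}" using s that(1) by fastforce
    qed
    then show ?thesis using that(1) by (simp add: region_def)
  qed
  show False using differ[of x y] differ[of y x] p min assms by blast
qed

text \<open>A product is odd if and only if both factors are. The pairs of end points up to
  \<open>p\<close> number such a product, and they are grouped by their later component.\<close>

lemma region_meet: "region key (interval_meet key x y) = region key x \<inter> region key y"
proof (rule set_eqI)
  fix p
  define S where "S = set_decode x"
  define T where "T = set_decode y"
  have fin: "finite S" "finite T" by (simp_all add: S_def T_def)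
  define c where "c = (\<lambda>u. card {(s, t). s \<in> S \<and> t \<in> T \<and> later key s t = u})"
  define U where "U = {u. u < x + y \<and> key u \<le> key p}"
  define P where "P = {s \<in> S. key s \<le> key p} \<times> {t \<in> T. key t \<le> key p}"
  have "set_decode (interval_meet key x y) = {u. u < x + y \<and> odd (c u)}"
    by (simp add: interval_meet_def c_def S_def T_def)
  then have eq: "{u \<in> set_decode (interval_meet key x y). key u \<le> key p} = {u \<in> U. odd (c u)}"
    by (auto simp: U_def)
  have "p \<in> region key (interval_meet key x y) \<longleftrightarrow> odd (card {u \<in> U. odd (c u)})"
    by (simp only: region_def mem_Collect_eq eq)
  also have "\<dots> \<longleftrightarrow> odd (\<Sum>u\<in>U. c u)"
    by (rule odd_card_odd) (simp add: U_def)
  also have "(\<Sum>u\<in>U. c u) = (\<Sum>u\<in>U. \<Sum>st\<in>{st. st \<in> P \<and> (\<lambda>(s, t). later key s t) st = u}. 1)"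
  proof (rule sum.cong)
    fix u assume "u \<in> U"
    then have "{(s, t). s \<in> S \<and> t \<in> T \<and> later key s t = u} =
        {st. st \<in> P \<and> (\<lambda>(s, t). later key s t) st = u}"
      by (auto simp: P_def U_def later_def)
    then show "c u = (\<Sum>st\<in>{st. st \<in> P \<and> (\<lambda>(s, t). later key s t) st = u}. 1)"
      by (simp add: c_def)
  qed simp
  also have "\<dots> = (\<Sum>st\<in>P. 1)"
  proof (rule sum.group)
    have "s \<in> S \<Longrightarrow> s < x + y" "s \<in> T \<Longrightarrow> s < x + y" for s
      using set_decode_less[of s x] set_decode_less[of s y] by (auto simp: S_def T_def)
    then show "(\<lambda>(s, t). later key s t) ` P \<subseteq> U" by (auto simp: P_def U_def later_def)
  qed (use fin in \<open>auto simp: P_def U_def\<close>)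
  also have "\<dots> = card {s \<in> S. key s \<le> key p} * card {t \<in> T. key t \<le> key p}"
    by (simp add: P_def card_cartesian_product)
  finally show "p \<in> region key (interval_meet key x y) \<longleftrightarrow> p \<in> region key x \<inter> region key y"
    by (simp add: region_def S_def T_def)
qed

lemma set_decode_compl:
  "set_decode (interval_compl z x) = (if z \<in> set_decode x then set_decode x - {z} else insert z (set_decode x))"
proof (cases "z \<in> set_decode x")
  case True
  have "x = set_encode (insert z (set_decode x - {z}))" using True by (simp add: insert_absorb)
  also have "\<dots> = 2 ^ z + set_encode (set_decode x - {z})" by (subst set_encode_insert) auto
  finally have "x - 2 ^ z = set_encode (set_decode x - {z})" by linarith
  then show ?thesis using True by (simp add: interval_compl_def)
next
  case False
  then have "x + 2 ^ z = set_encode (insert z (set_decode x))" by (simp add: set_encode_insert)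
  then have "set_decode (x + 2 ^ z) = insert z (set_decode x)"
    by (metis finite_insert finite_set_decode set_encode_inverse)
  then show ?thesis using False by (simp add: interval_compl_def)
qed

text \<open>The least point \<open>z\<close> is counted at every \<open>p\<close>, so toggling it
  flips all parities.\<close>

lemma region_compl: "region key (interval_compl z x) = - region key x"
proof -
  have "p \<in> region key (interval_compl z x) \<longleftrightarrow> p \<notin> region key x" for p
  proof (cases "z \<in> set_decode x")
    case True
    then have "{s \<in> set_decode x. key s \<le> key p} =
        insert z {s \<in> set_decode (interval_compl z x). key s \<le> key p}"
      using least by (auto simp: set_decode_compl)
    moreover have "z \<notin> set_decode (interval_compl z x)" using True by (simp add: set_decode_compl)
    ultimately show ?thesis by (simp add: region_def)
  next
    case False
    then have "{s \<in> set_decode (interval_compl z x). key s \<le> key p} =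
        insert z {s \<in> set_decode x. key s \<le> key p}"
      using least by (auto simp: set_decode_compl)
    then show ?thesis using False by (simp add: region_def)
  qed
  then show ?thesis by blast
qed

lemma region_simps [simp]:
  "region key (ba_meet I x y) = region key x \<inter> region key y"
  "region key (ba_join I x y) = region key x \<union> region key y"
  "region key (ba_compl I x) = - region key x"
  "region key (ba_top I) = UNIV"
  "region key (ba_bot I) = {}"
proof -
  have bot: "region key 0 = {}" by (simp add: region_def)
  have "interval_compl z 0 = 2 ^ z" by (simp add: interval_compl_def)
  then have "region key (2 ^ z) = UNIV" using region_compl[of 0] bot by simp
  then show "region key (ba_top I) = UNIV" by (simp add: interval_algebra_def)
qed (auto simp: interval_algebra_def region_meet region_compl region_def[of _ 0])

lemma region_eq_iff: "region key x = region key y \<longleftrightarrow> x = y"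
  using region_eqD by blast

text \<open>By \<open>region\<close> the structure embeds into a power set algebra, so the axioms
  are set identities.\<close>

lemma is_boolean_algebra_interval: "is_boolean_algebra I"
  unfolding is_boolean_algebra_def
  by unfold_locales (rule region_eqD, auto)+

lemma ba_le_interval: "ba_le I x y \<longleftrightarrow> region key x \<subseteq> region key y"
  unfolding ba_le_def region_eq_iff[symmetric] by auto

lemma region_min:
  assumes "s \<in> set_decode x" "\<And>t. t \<in> set_decode x \<Longrightarrow> key s \<le> key t"
    "\<And>t. t \<in> set_decode x \<Longrightarrow> t \<noteq> s \<Longrightarrow> key p < key t"
  shows "p \<in> region key x \<longleftrightarrow> key s \<le> key p"
proof -
  have "{t \<in> set_decode x. key t \<le> key p} = (if key s \<le> key p then {s} else {})"
    using assms by (auto simp: not_le) (meson dual_order.trans not_le)+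
  then show ?thesis by (simp add: region_def)
qed

lemma region_pair:
  assumes "key s < key t"
  shows "region key (set_encode {s, t}) = {p. key s \<le> key p \<and> key p < key t}"
proof -
  have "s \<noteq> t" using assms by auto
  have eq: "{u \<in> {s, t}. key u \<le> key p} =
      (if key p < key s then {} else if key p < key t then {s} else {s, t})" for p
    using assms by auto
  have dec: "set_decode (set_encode {s, t}) = {s, t}" by (rule set_encode_inverse) simp
  show ?thesis unfolding region_def dec eq using \<open>s \<noteq> t\<close> assms by (auto split: if_splits)
qed

text \<open>The interval from \<open>s\<close> to \<open>u\<close> would cut \<open>a\<close>
  properly: \<open>s\<close> lies in it and \<open>u\<close> does not, but both lie in the region of
  \<open>a\<close>.\<close>

lemma atom_no_gap:
  assumes "ba_atom I a" and s: "s \<in> set_decode a" "\<And>t. t \<in> set_decode a \<Longrightarrow> key s \<le> key t"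
    and u: "key s < key u" "\<And>t. t \<in> set_decode a \<Longrightarrow> t \<noteq> s \<Longrightarrow> key u < key t"
  shows False
proof -
  let ?y = "set_encode {s, u}"
  have "s \<in> region key a"
    using region_min[of s a s] s u(1) u(2) by (metis dual_order.strict_trans order_refl)
  moreover have "s \<in> region key ?y" using u(1) by (simp add: region_pair)
  ultimately have "ba_meet I a ?y \<noteq> ba_bot I"
    unfolding region_eq_iff[symmetric] region_simps by blast
  moreover have "u \<in> region key a" using region_min[of s a u] s u by auto
  then have "ba_meet I a ?y \<noteq> a"
    unfolding region_eq_iff[symmetric] region_simps using region_pair[OF u(1)] by auto
  ultimately show False using assms(1) by (auto simp: ba_atom_def)
qed

end

text \<open>The isomorphism renames the end points by \<kappa>, which moves regions by \<kappa>
  too.\<close>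

lemma interval_algebra_relabel:
  assumes "interval_order key z" and "bij \<kappa>"
  shows "interval_order (key \<circ> \<kappa>) (inv \<kappa> z)"
    and "isomorphic (interval_algebra (key \<circ> \<kappa>) (inv \<kappa> z)) (interval_algebra key z)"
proof -
  interpret F: interval_order key z by (rule assms(1))
  have \<kappa>: "inj \<kappa>" "surj \<kappa>" using assms(2) by (simp_all add: bij_def)
  show 1: "interval_order (key \<circ> \<kappa>) (inv \<kappa> z)"
    using F.inj_key F.least \<kappa> by unfold_locales (simp_all add: inj_compose surj_f_inv_f)
  interpret C: interval_order "key \<circ> \<kappa>" "inv \<kappa> z" by (rule 1)
  define f where "f = (\<lambda>x. set_encode (\<kappa> ` set_decode x))"
  have region: "region key (f x) = \<kappa> ` region (key \<circ> \<kappa>) x" for x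
  proof -
    have "{s \<in> set_decode (f x). key s \<le> key (\<kappa> p)} = \<kappa> ` {s \<in> set_decode x. (key \<circ> \<kappa>) s \<le> (key \<circ> \<kappa>) p}" for p
      by (auto simp: f_def)
    then have "card {s \<in> set_decode (f x). key s \<le> key (\<kappa> p)} =
        card {s \<in> set_decode x. (key \<circ> \<kappa>) s \<le> (key \<circ> \<kappa>) p}" for p
      using \<kappa>(1) by (simp add: card_image inj_on_subset)
    then have "\<kappa> p \<in> region key (f x) \<longleftrightarrow> p \<in> region (key \<circ> \<kappa>) x" for p
      by (simp add: region_def)
    then show ?thesis using \<kappa> by (metis (no_types, lifting) image_iff set_eqI surjD inj_image_mem_iff)
  qed
  have "bij f"
  proof (rule bijI)
    show "inj f"
      by (rule injI) (metis C.region_eqD region inj_image_eq_iff \<kappa>(1))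
    have "f (set_encode (inv \<kappa> ` set_decode y)) = y" for y
      using \<kappa>(2) by (simp add: f_def image_image surj_f_inv_f)
    then show "surj f" by (rule surjI)
  qed
  moreover have "f (ba_join C.I x y) = ba_join F.I (f x) (f y)" for x y
    unfolding F.region_eq_iff[symmetric] by (simp add: region image_Un)
  moreover have "f (ba_meet C.I x y) = ba_meet F.I (f x) (f y)" for x y
    unfolding F.region_eq_iff[symmetric] using \<kappa>(1) by (simp add: region image_Int)
  moreover have "f (ba_compl C.I x) = ba_compl F.I (f x)" for x
    unfolding F.region_eq_iff[symmetric] using assms(2) by (simp add: region bij_image_Compl_eq)
  moreover have "f (ba_top C.I) = ba_top F.I" "f (ba_bot C.I) = ba_bot F.I"
    unfolding F.region_eq_iff[symmetric] using \<kappa>(2) by (simp_all add: region)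
  ultimately show "isomorphic C.I F.I" unfolding isomorphic_def is_iso_def by blast
qed

text \<open>The van der Corput sequence: the binary digits of \<open>n\<close> are reflected at the binary point.\<close>

fun vdc :: "nat \<Rightarrow> real" where
  "vdc n = (if n = 0 then 0 else (of_bool (odd n) + vdc (n div 2)) / 2)"

declare vdc.simps [simp del]

lemma vdc_0 [simp]: "vdc 0 = 0"
  by (simp add: vdc.simps)

lemma vdc_rec: "vdc n = (of_bool (odd n) + vdc (n div 2)) / 2"
  by (cases "n = 0") (simp_all add: vdc.simps[of n])

lemma vdc_bounds: "0 \<le> vdc n \<and> vdc n < 1"
proof (induction n rule: less_induct)
  case (less n)
  show ?case
  proof (cases "n = 0")
    case False
    then have "0 \<le> vdc (n div 2) \<and> vdc (n div 2) < 1" by (intro less) simp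
    then show ?thesis using vdc_rec[of n] by (cases "odd n") auto
  qed simp
qed

lemma inj_vdc: "inj vdc"
proof (rule injI)
  show "m = n" if "vdc m = vdc n" for m n
    using that
  proof (induction m arbitrary: n rule: less_induct)
    case (less m)
    have eq: "of_bool (odd m) + vdc (m div 2) = of_bool (odd n) + vdc (n div 2)"
      using less.prems vdc_rec[of m] vdc_rec[of n] by simp
    then have par: "odd m \<longleftrightarrow> odd n"
      using vdc_bounds[of "m div 2"] vdc_bounds[of "n div 2"] by (auto simp: of_bool_def split: if_splits)
    then have half: "vdc (m div 2) = vdc (n div 2)" using eq by simp
    show "m = n"
    proof (cases "m = 0")
      case True
      have "n = 0" if "vdc n = 0" for n
        using that
      proof (induction n rule: less_induct)
        case (less n)
        have "even n" "vdc (n div 2) = 0"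
          using less.prems vdc_rec[of n] vdc_bounds[of "n div 2"] by (auto simp: of_bool_def split: if_splits)
        then show ?case using less.IH[of "n div 2"] by (cases "n = 0") (auto elim: evenE)
      qed
      then show ?thesis using less.prems True by simp
    next
      case False
      then have "m div 2 = n div 2" using less.IH[of "m div 2"] half by simp
      then show ?thesis using par by (metis odd_two_times_div_two_succ even_two_times_div_two)
    qed
  qed
qed

lemma vdc_add_power: "i < 2 ^ K \<Longrightarrow> vdc (i + 2 ^ K) = vdc i + 1 / 2 ^ Suc K"
proof (induction K arbitrary: i)
  case 0
  then show ?case using vdc_rec[of 1] by simp
next
  case (Suc K)
  have "i div 2 < 2 ^ K" using Suc.prems by auto
  then have IH: "vdc (i div 2 + 2 ^ K) = vdc (i div 2) + 1 / 2 ^ Suc K" by (rule Suc.IH)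
  have "(i + 2 ^ Suc K) div 2 = i div 2 + 2 ^ K" "odd (i + 2 ^ Suc K) \<longleftrightarrow> odd i" by simp_all
  then have "vdc (i + 2 ^ Suc K) = (of_bool (odd i) + (vdc (i div 2) + 1 / 2 ^ Suc K)) / 2"
    using vdc_rec[of "i + 2 ^ Suc K"] IH by (simp only:)
  then show ?case unfolding vdc_rec[of i] by (simp add: add_divide_distrib)
qed

text \<open>Scaling yields the natural number with the first \<open>N\<close> digits reversed, so
  that positions can be compared in integer arithmetic.\<close>

lemma vdc_scaled: "i < 2 ^ N \<Longrightarrow>
  2 ^ N * vdc i = real (\<Sum>k<N. of_bool (odd (i div 2 ^ k)) * 2 ^ (N - Suc k))"
proof (induction N arbitrary: i)
  case 0
  then show ?case by simp
next
  case (Suc N)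
  have "i div 2 < 2 ^ N" using Suc.prems by auto
  from Suc.IH[OF this] have IH: "2 ^ N * vdc (i div 2) =
      real (\<Sum>k<N. of_bool (odd (i div 2 ^ Suc k)) * 2 ^ (Suc N - Suc (Suc k)))"
    by (simp add: div_mult2_eq)
  have "(\<Sum>k<Suc N. of_bool (odd (i div 2 ^ k)) * 2 ^ (Suc N - Suc k) :: nat) = of_bool (odd i) * 2 ^ N +
      (\<Sum>k<N. of_bool (odd (i div 2 ^ Suc k)) * 2 ^ (Suc N - Suc (Suc k)))"
    by (simp only: sum.lessThan_Suc_shift power_0 div_by_1 diff_Suc_Suc diff_zero)
  then have "real (\<Sum>k<Suc N. of_bool (odd (i div 2 ^ k)) * 2 ^ (Suc N - Suc k)) =
      of_bool (odd i) * 2 ^ N + 2 ^ N * vdc (i div 2)"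
    using IH by (simp only: of_nat_add of_nat_mult of_nat_of_bool of_nat_power of_nat_numeral)
  then show ?case using vdc_rec[of i] by (simp only: power_Suc) (simp add: algebra_simps)
qed

text \<open>The first \<open>n\<close> labels occupy the points -n, ..., -1, each with an immediate
  successor; these gaps produce the atoms. Label \<open>n\<close> lies at 0, where the dense part
  begins.\<close>

definition pos :: "nat \<Rightarrow> nat \<Rightarrow> real" where
  "pos n i = (if i < n then real i - real n else vdc (i - n))"

lemma pos_nonneg_iff: "0 \<le> pos n i \<longleftrightarrow> n \<le> i"
  using vdc_bounds[of "i - n"] by (auto simp: pos_def)

lemma inj_pos: "inj (pos n)"
proof (rule injI)
  fix i j assume eq: "pos n i = pos n j"
  then have "n \<le> i \<longleftrightarrow> n \<le> j" by (metis pos_nonneg_iff)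
  then show "i = j" using eq injD[OF inj_vdc, of "i - n" "j - n"] by (auto simp: pos_def split: if_splits)
qed

interpretation pos: interval_order "pos n" 0 for n
proof
  show "inj (pos n)" by (rule inj_pos)
  show "pos n 0 \<le> pos n p" for p using vdc_bounds[of "p - n"] by (auto simp: pos_def)
qed

lemma pos_add_power:
  "n \<le> i \<Longrightarrow> i - n < 2 ^ K \<Longrightarrow> pos n (i + 2 ^ K) = pos n i + 1 / 2 ^ Suc K"
  using vdc_add_power[of "i - n" K] by (simp add: pos_def)

text \<open>For large \<open>k\<close> the labels \<open>s + 2 ^ k\<close> approach \<open>s\<close>
  from the right along an explicit sequence, which later makes splitting primitive
  recursive.\<close>

lemma pos_gap:
  assumes "finite S" "n \<le> s"
  shows "\<exists>K. \<forall>k\<ge>K. pos n (s + 2 ^ k) = pos n s + 1 / 2 ^ Suc k \<and>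
    (\<forall>t\<in>S. pos n s < pos n t \<longrightarrow> pos n (s + 2 ^ k) < pos n t)"
proof -
  have "\<exists>K. \<forall>k\<ge>K. \<forall>t\<in>S. pos n s < pos n t \<longrightarrow> pos n s + 1 / 2 ^ Suc k < pos n t"
    using assms(1)
  proof induction
    case (insert t S)
    then obtain K where K: "\<forall>k\<ge>K. \<forall>t\<in>S. pos n s < pos n t \<longrightarrow> pos n s + 1 / 2 ^ Suc k < pos n t" by blast
    obtain L where L: "pos n s < pos n t \<longrightarrow> (1 / 2) ^ L < pos n t - pos n s"
      using real_arch_pow_inv[of "pos n t - pos n s" "1 / 2"] by (cases "pos n s < pos n t") auto
    have "pos n s + 1 / 2 ^ Suc k < pos n t" if "L \<le> k" "pos n s < pos n t" for k
    proof -
      have "1 / 2 ^ Suc k = (1 / 2 :: real) ^ Suc k" by (simp add: power_one_over)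
      also have "\<dots> \<le> (1 / 2) ^ L" using that(1) by (intro power_decreasing) auto
      finally show ?thesis using L that(2) by simp
    qed
    with K show ?case by (intro exI[of _ "max K L"]) simp
  qed simp
  then obtain K where K: "\<forall>k\<ge>K. \<forall>t\<in>S. pos n s < pos n t \<longrightarrow> pos n s + 1 / 2 ^ Suc k < pos n t" by blast
  have eq: "pos n (s + 2 ^ k) = pos n s + 1 / 2 ^ Suc k" if "s \<le> k" for k
  proof (rule pos_add_power[OF assms(2)])
    have "s < 2 ^ s" by (rule less_exp)
    also have "\<dots> \<le> 2 ^ k" using that by (intro power_increasing) auto
    finally show "s - n < 2 ^ k" by simp
  qed
  show ?thesis
    using K eq by (intro exI[of _ "max K s"]) simp
qed

lemma region_pos_successor:
  assumes "i < n"
  shows "region (pos n) (set_encode {i, Suc i}) = {i}"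
proof -
  have lt: "pos n i < pos n (Suc i)" using assms vdc_bounds[of "Suc i - n"] by (auto simp: pos_def)
  have "pos n i \<le> pos n p \<and> pos n p < pos n (Suc i) \<longleftrightarrow> p = i" for p
  proof
    assume *: "pos n i \<le> pos n p \<and> pos n p < pos n (Suc i)"
    have "p < n"
    proof (rule ccontr)
      assume "\<not> p < n"
      then have "0 < pos n (Suc i)" using * vdc_bounds[of "p - n"] by (auto simp: pos_def)
      then have "Suc i = n \<and> vdc 0 > 0" using assms by (auto simp: pos_def split: if_splits)
      then show False by simp
    qed
    then show "p = i" using * assms by (auto simp: pos_def split: if_splits)
  qed (use lt in simp)
  then show ?thesis unfolding pos.region_pair[OF lt] by auto
qed

text \<open>The leftmost end point \<open>s\<close> of an atom decides: below \<open>n\<close> the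
  singleton of \<open>s\<close> already is an element below the atom, and in the dense part
  \<open>pos_gap\<close> would split it.\<close>

lemma atoms_pos:
  "{a. ba_atom (interval_algebra (pos n) 0) a} = (\<lambda>i. set_encode {i, Suc i}) ` {..<n}"
proof (intro set_eqI iffI)
  fix a assume a: "a \<in> (\<lambda>i. set_encode {i, Suc i}) ` {..<n}"
  then obtain i where i: "i < n" "a = set_encode {i, Suc i}" by blast
  then have "region (pos n) a = {i}" by (simp only: region_pos_successor)
  then show "a \<in> {a. ba_atom (interval_algebra (pos n) 0) a}"
    unfolding mem_Collect_eq ba_atom_def pos.region_eq_iff[of n, symmetric] by auto
next
  fix a assume "a \<in> {a. ba_atom (interval_algebra (pos n) 0) a}"
  then have a: "ba_atom (interval_algebra (pos n) 0) a" by simp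
  then have "set_decode a \<noteq> {}"
    by (metis ba_atom_def interval_algebra_def ba_structure.select_convs(5) set_decode_inverse set_encode_empty)
  then obtain s where s: "s \<in> set_decode a" "\<And>t. t \<in> set_decode a \<Longrightarrow> pos n s \<le> pos n t"
    using min_key[of "set_decode a" "pos n"] by auto
  show "a \<in> (\<lambda>i. set_encode {i, Suc i}) ` {..<n}"
  proof (cases "s < n")
    case True
    let ?y = "set_encode {s, Suc s}"
    have y: "region (pos n) ?y = {s}" using True by (rule region_pos_successor)
    have "s \<in> region (pos n) a"
      using pos.region_min[of s a n s] s by (metis order_le_less pos.key_eq_iff)
    then have "ba_meet (interval_algebra (pos n) 0) a ?y \<noteq> ba_bot (interval_algebra (pos n) 0)"
      unfolding pos.region_eq_iff[of n, symmetric] using y by auto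
    then have "ba_meet (interval_algebra (pos n) 0) a ?y = a" using a by (auto simp: ba_atom_def)
    then have "region (pos n) a \<subseteq> {s}" using y by (metis pos.region_simps(1) inf.cobounded2)
    then have "a = ?y" using \<open>s \<in> region (pos n) a\<close> y by (intro pos.region_eqD[of n]) auto
    then show ?thesis using True by blast
  next
    case False
    then obtain K where K: "pos n (s + 2 ^ K) = pos n s + 1 / 2 ^ Suc K"
      "\<forall>t\<in>set_decode a. pos n s < pos n t \<longrightarrow> pos n (s + 2 ^ K) < pos n t"
      using pos_gap[of "set_decode a" n s] by auto
    have False
    proof (rule pos.atom_no_gap[OF a s])
      show "pos n s < pos n (s + 2 ^ K)" unfolding K(1) by simp
      show "pos n (s + 2 ^ K) < pos n t" if "t \<in> set_decode a" "t \<noteq> s" for t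
        using K(2) s(2)[OF that(1)] that by (simp add: order_less_le)
    qed
    then show ?thesis ..
  qed
qed

lemma card_atoms_pos:
  "finite {a. ba_atom (interval_algebra (pos n) 0) a}"
  "card {a. ba_atom (interval_algebra (pos n) 0) a} = n"
proof -
  have "inj_on (\<lambda>i. set_encode {i, Suc i}) {..<n}"
    by (rule inj_onI) (metis lessThan_iff region_pos_successor singleton_inject)
  then show "card {a. ba_atom (interval_algebra (pos n) 0) a} = n"
    by (simp add: atoms_pos card_image)
qed (simp add: atoms_pos)

section \<open>Primitive recursiveness of interval algebras\<close>

lemma rec_mem_set_decode [rec_intros]:
  assumes "recursive_in mu orc g n a" "recursive_in mu orc g n b"
  shows "recursive_in mu orc g n (\<lambda>xs. of_bool (a xs \<in> set_decode (b xs)))"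
  unfolding set_decode_def mem_Collect_eq by (intro rec_intros assms)

text \<open>This and the next lemma express set codes and cardinalities as bounded sums, the form to
  which the closure rules apply.\<close>

lemma set_encode_bounded: "set_encode {u. u < b \<and> P u} = (\<Sum>u<b. of_bool (P u) * 2 ^ u)"
proof -
  have "set_encode {u. u < b \<and> P u} = sum ((^) 2) ({..<b} \<inter> {u. P u})"
    by (simp add: set_encode_def lessThan_def Int_def)
  also have "\<dots> = (\<Sum>u<b. if P u then 2 ^ u else 0)" by (subst sum.inter_restrict) auto
  also have "\<dots> = (\<Sum>u<b. of_bool (P u) * 2 ^ u)" by (intro sum.cong) auto
  finally show ?thesis .
qed

lemma card_bounded_pairs:
  "card {(s, t). s \<in> set_decode x \<and> t \<in> set_decode y \<and> P s t} =
    (\<Sum>s<x. \<Sum>t<y. of_bool (s \<in> set_decode x \<and> t \<in> set_decode y \<and> P s t))"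
proof -
  have "{(s, t). s \<in> set_decode x \<and> t \<in> set_decode y \<and> P s t} =
      {st \<in> {..<x} \<times> {..<y}. fst st \<in> set_decode x \<and> snd st \<in> set_decode y \<and> P (fst st) (snd st)}"
    using set_decode_less by auto
  also have "card \<dots> = (\<Sum>st\<in>{..<x} \<times> {..<y}.
      of_bool (fst st \<in> set_decode x \<and> snd st \<in> set_decode y \<and> P (fst st) (snd st)))"
    by (simp add: Int_def)
  finally show ?thesis by (simp only: sum.cartesian_product case_prod_unfold)
qed

lemma punctual_interval_algebra:
  assumes "primitive_recursive 2 (binary (\<lambda>i j. of_bool (key i \<le> key j)))"
  shows "punctual (interval_algebra key z)"
proof -
  let ?R = "recursive_in False False (\<lambda>_. 0)"
  have le: "?R 2 (binary (\<lambda>i j. of_bool (key i \<le> key j)))"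
    using assms by (simp add: primitive_recursive_iff[of _ _ "\<lambda>_. 0"])
  have compl: "?R 1 (unary (interval_compl z))"
    unfolding interval_compl_def by (intro rec_intros) auto
  have meet: "?R 2 (binary (interval_meet key))"
    unfolding interval_meet_def set_encode_bounded card_bounded_pairs later_def
    by (intro rec_intros rec_binary[OF le]) auto
  have "?R 2 (binary (ba_join (interval_algebra key z)))"
    unfolding interval_algebra_def ba_structure.select_convs
    by (intro rec_unary[OF compl] rec_binary[OF meet] rec_intros) auto
  then show ?thesis
    unfolding punctual_def primitive_recursive_iff[of _ _ "\<lambda>_. 0"]
    using meet compl by (simp add: interval_algebra_def)
qed

lemma rec_pos_le:
  "recursive_in mu orc g 2 (binary (\<lambda>i j. of_bool (pos n i \<le> pos n j)))"
proof -
  \<comment> \<open>Reverses the lowest \<open>N\<close> digits. The choice \<open>N = i + j\<close>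
    below covers all digits of both numbers.\<close>
  let ?rev = "\<lambda>N i. \<Sum>k<N. of_bool (odd (i div 2 ^ k)) * 2 ^ (N - Suc k) :: nat"
  have vdc_le: "vdc i \<le> vdc j \<longleftrightarrow> ?rev (i + j) i \<le> ?rev (i + j) j" for i j
  proof -
    have "i < 2 ^ (i + j)" "j < 2 ^ (i + j)"
      using less_exp[of "i + j"] by linarith+
    then have "?rev (i + j) i \<le> ?rev (i + j) j \<longleftrightarrow> 2 ^ (i + j) * vdc i \<le> 2 ^ (i + j) * vdc j"
      by (simp only: vdc_scaled of_nat_le_iff)
    then show ?thesis by simp
  qed
  have "pos n i \<le> pos n j \<longleftrightarrow>
      i < n \<and> (n \<le> j \<or> i \<le> j) \<or> n \<le> i \<and> n \<le> j \<and> vdc (i - n) \<le> vdc (j - n)" for i j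
    using vdc_bounds[of "i - n"] vdc_bounds[of "j - n"] by (auto simp: pos_def not_less)
  then show ?thesis
    unfolding vdc_le by (simp only:) (intro rec_intros; simp)
qed

section \<open>A slow copy\<close>

primrec count :: "(nat \<Rightarrow> bool) \<Rightarrow> nat \<Rightarrow> nat" where
  "count P 0 = 0"
| "count P (Suc j) = count P j + of_bool (P j)"

lemma count_mono: "i \<le> j \<Longrightarrow> count P i \<le> count P j"
  by (rule lift_Suc_mono_le) simp_all

lemma count_less: "i < j \<Longrightarrow> P i \<Longrightarrow> count P i < count P j"
  using count_mono[of "Suc i" j P] by simp

lemma count_eq_card: "count P j = card {i. i < j \<and> P i}"
proof (induction j)
  case (Suc j)
  have "{i. i < Suc j \<and> P i} = (if P j then insert j {i. i < j \<and> P i} else {i. i < j \<and> P i})"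
    by (auto simp: less_Suc_eq)
  then show ?case using Suc by simp
qed simp

lemma count_not: "count (\<lambda>i. \<not> P i) j = j - count P j"
proof -
  have "count (\<lambda>i. \<not> P i) j + count P j = j" by (induction j) auto
  then show ?thesis by linarith
qed

lemma count_attains:
  assumes "m < count P j"
  shows "\<exists>i<j. P i \<and> count P i = m"
  using assms
proof (induction j)
  case (Suc j)
  show ?case
  proof (cases "m < count P j")
    case True
    then show ?thesis using Suc.IH less_SucI by blast
  next
    case False
    then have "P j \<and> count P j = m" using Suc.prems by (auto split: if_splits simp: of_bool_def)
    then show ?thesis by blast
  qed
qed simp

lemma count_unbounded:
  assumes "\<And>j0. \<exists>j\<ge>j0. P j"
  shows "\<exists>j. m < count P j"
proof (induction m)
  case 0
  then show ?case using assms[of 0] count_less[of _ "Suc _" P] by (metis gr_zeroI less_zeroE lessI)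
next
  case (Suc m)
  then obtain j where j: "m < count P j" by blast
  obtain i where "j \<le> i" "P i" using assms by blast
  then have "count P j \<le> count P i" "count P i < count P (Suc i)" by (simp_all add: count_mono)
  then show ?case using j by (metis Suc_lessI le_less_trans less_trans_Suc not_less)
qed

text \<open>Members of \<open>P\<close> receive the odd numbers in increasing order and the others
  the even ones; \<open>j - count P j\<close> counts the non-members below \<open>j\<close>.\<close>

definition interleave :: "(nat \<Rightarrow> bool) \<Rightarrow> nat \<Rightarrow> nat" where
  "interleave P j = (if P j then 2 * count P j + 1 else 2 * (j - count P j))"

lemma bij_interleave:
  assumes P: "\<And>j0. \<exists>j\<ge>j0. P j" and notP: "\<And>j0. \<exists>j\<ge>j0. \<not> P j"
  shows "bij (interleave P)"
proof (rule bijI)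
  have inj: "i = j" if "P i" "P j" "count P i = count P j" for P i j
    using that count_less[of i j P] count_less[of j i P] by (metis less_irrefl linorder_neqE_nat)
  have eq: "interleave P j = (if P j then 2 * count P j + 1 else 2 * count (\<lambda>i. \<not> P i) j)" for j
    by (simp add: interleave_def count_not)
  show "inj (interleave P)"
  proof (rule injI)
    fix i j assume *: "interleave P i = interleave P j"
    have parity: "odd (interleave P k) \<longleftrightarrow> P k" for k by (simp add: eq)
    then have "P i \<longleftrightarrow> P j" using * by metis
    then show "i = j"
      using * inj[of P i j] inj[of "\<lambda>k. \<not> P k" i j] by (cases "P i") (simp_all add: eq)
  qed
  show "surj (interleave P)"
  proof (rule surjI)
    fix y
    have attain: "\<exists>j. P j \<and> count P j = m" if "\<And>j0. \<exists>j\<ge>j0. P j" for P m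
      using count_unbounded[of P m] count_attains that by metis
    have "\<exists>j. interleave P j = y"
    proof (cases "odd y")
      case True
      then obtain j where "P j" "count P j = y div 2" using attain[of P] P by blast
      then show ?thesis using True by (intro exI[of _ j]) (simp add: eq)
    next
      case False
      then obtain j where "\<not> P j" "count (\<lambda>i. \<not> P i) j = y div 2"
        using attain[of "\<lambda>i. \<not> P i"] notP by blast
      then show ?thesis using False by (intro exI[of _ j]) (simp add: eq)
    qed
    then show "interleave P (SOME j. interleave P j = y) = y" by (rule someI_ex)
  qed
qed

lemma vdc_ge_half: "1 / 2 \<le> vdc i \<Longrightarrow> odd i"
  using vdc_rec[of i] vdc_bounds[of "i div 2"] by (cases "odd i") auto

text \<open>Here \<open>a s x\<close> is the information about a computation on input \<open>x\<close> that is available at stage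
  \<open>s\<close>, with \<open>0\<close> meaning that the computation is still running.  A stage is an event if it reveals
  the convergence on the number of earlier events, so the inputs converge one after the other.
  Admitting even stages only makes the complement infinite.\<close>

locale delay =
  fixes a :: "nat \<Rightarrow> nat \<Rightarrow> nat" and f :: "nat \<Rightarrow> nat" and n :: nat
  assumes a_mono: "a s x = Suc v \<Longrightarrow> s \<le> t \<Longrightarrow> a t x = Suc v"
    and a_iff: "f x = v \<longleftrightarrow> (\<exists>s. a s x = Suc v)"
    and a_prim: "primitive_recursive 2 (binary a)"
begin

definition events :: "nat \<Rightarrow> nat" where
  "events j = rec_nat 0 (\<lambda>k v. v + of_bool (even k \<and> a k v \<noteq> 0)) j"

definition event :: "nat \<Rightarrow> bool" where
  "event j \<longleftrightarrow> even j \<and> a j (events j) \<noteq> 0"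

text \<open>Point \<open>i\<close> takes the place of point \<open>\<kappa> i\<close> of the
  standard order. The place depends only on stages up to \<open>i - n\<close>, so no computation is
  waited for.\<close>

definition \<kappa> :: "nat \<Rightarrow> nat" where
  "\<kappa> i = (if i < n then i else n + interleave event (i - n))"

abbreviation "slow \<equiv> interval_algebra (pos n \<circ> \<kappa>) (inv \<kappa> 0)"

lemma count_event: "count event j = events j"
  by (induction j) (simp_all add: events_def event_def)

text \<open>If the counter stayed at some value, the computation on that value would still converge,
  and every late even stage would be an event.\<close>

lemma infinite_events: "\<exists>j\<ge>j0. event j"
proof (rule ccontr)
  assume none: "\<not> (\<exists>j\<ge>j0. event j)"
  have const: "events (j0 + k) = events j0" for k
    using none by (induction k) (simp_all flip: count_event)
  obtain s where s: "a s (events j0) = Suc (f (events j0))" using a_iff by blast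
  define j where "j = 2 * (j0 + s)"
  have "a j (events j0) = Suc (f (events j0))" by (rule a_mono[OF s]) (simp add: j_def)
  moreover have "events j = events j0" using const[of "j - j0"] by (simp add: j_def)
  ultimately have "event j" by (simp add: event_def j_def)
  then show False using none by (auto simp: j_def)
qed

lemma infinite_nonevents: "\<exists>j\<ge>j0. \<not> event j"
  by (rule exI[of _ "Suc (2 * j0)"]) (simp add: event_def)

lemma bij_\<kappa>: "bij \<kappa>"
proof -
  have bij: "bij (interleave event)"
    by (rule bij_interleave[OF infinite_events infinite_nonevents])
  show ?thesis
  proof (rule bijI)
    show "inj \<kappa>"
    proof (rule injI)
      fix i j assume eq: "\<kappa> i = \<kappa> j"
      have "\<kappa> k < n \<longleftrightarrow> k < n" for k by (simp add: \<kappa>_def)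
      then have "i < n \<longleftrightarrow> j < n" using eq by metis
      moreover have "interleave event (i - n) = interleave event (j - n) \<longleftrightarrow> i - n = j - n"
        using bij by (simp add: bij_is_inj inj_eq)
      ultimately show "i = j" using eq by (cases "i < n") (simp_all add: \<kappa>_def)
    qed
    show "surj \<kappa>"
    proof (rule surjI)
      show "\<kappa> (if y < n then y else n + inv (interleave event) (y - n)) = y" for y
        using bij by (simp add: \<kappa>_def bij_is_surj surj_f_inv_f)
    qed
  qed
qed

lemma interval_order_slow: "interval_order (pos n \<circ> \<kappa>) (inv \<kappa> 0)"
  and isomorphic_slow: "isomorphic slow (interval_algebra (pos n) 0)"
  using interval_algebra_relabel[OF pos.interval_order_axioms bij_\<kappa>] by simp_all

lemma punctual_slow: "punctual slow"
proof (rule punctual_interval_algebra)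
  let ?R = "recursive_in False False (\<lambda>_. 0)"
  have a: "?R 2 (binary a)" using a_prim by (simp add: primitive_recursive_iff[of _ _ "\<lambda>_. 0"])
  have "?R 1 (unary events)"
    unfolding events_def by (intro rec_intros rec_binary[OF a]) auto
  note events = rec_unary[OF this]
  have "?R 1 (unary \<kappa>)"
    unfolding \<kappa>_def interleave_def count_event event_def
    by (intro rec_intros events rec_binary[OF a]) auto
  note \<kappa> = rec_unary[OF this]
  show "primitive_recursive 2 (binary (\<lambda>i j. of_bool ((pos n \<circ> \<kappa>) i \<le> (pos n \<circ> \<kappa>) j)))"
    unfolding primitive_recursive_iff[of _ _ "\<lambda>_. 0"] comp_def
    by (intro rec_binary[OF rec_pos_le] \<kappa> rec_intros) auto
qed

text \<open>Chosen because \<open>vdc 1 = 1 / 2\<close>, so label \<open>Suc n\<close> of the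
  standard order lies at 1/2.\<close>

definition half_point :: nat where "half_point = inv \<kappa> (Suc n)"

lemma pos_half_point: "pos n (\<kappa> half_point) = 1 / 2"
  using bij_\<kappa> vdc_rec[of 1] by (simp add: half_point_def pos_def bij_is_surj surj_f_inv_f)

interpretation slow: interval_order "pos n \<circ> \<kappa>" "inv \<kappa> 0"
  by (rule interval_order_slow)

lemma region_half_point: "region (pos n \<circ> \<kappa>) (2 ^ half_point) = {p. 1 / 2 \<le> pos n (\<kappa> p)}"
proof -
  have "set_decode (2 ^ half_point) = {half_point}" using set_encode_inverse[of "{half_point}"] by simp
  then show ?thesis using slow.region_min[of half_point "2 ^ half_point"] pos_half_point by auto
qed

text \<open>The leftmost end point of \<open>y\<close> belongs to its region, and all other end
  points lie to the right of it.\<close>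

lemma below_half_point_pos:
  assumes "region (pos n \<circ> \<kappa>) y \<subseteq> region (pos n \<circ> \<kappa>) (2 ^ half_point)" "t \<in> set_decode y"
  shows "1 / 2 \<le> pos n (\<kappa> t)"
proof -
  have "set_decode y \<noteq> {}" using assms(2) by blast
  then obtain s where s: "s \<in> set_decode y" "\<And>t. t \<in> set_decode y \<Longrightarrow> (pos n \<circ> \<kappa>) s \<le> (pos n \<circ> \<kappa>) t"
    using min_key[of "set_decode y" "pos n \<circ> \<kappa>"] by auto
  have "s \<in> region (pos n \<circ> \<kappa>) y"
  proof (rule slow.region_min[THEN iffD2, OF s])
    show "(pos n \<circ> \<kappa>) s < (pos n \<circ> \<kappa>) t" if "t \<in> set_decode y" "t \<noteq> s" for t
      using s(2)[OF that(1)] that(2) slow.key_eq_iff[of s t] by (metis order_le_less)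
  qed (assumption, rule order_refl)
  then have "1 / 2 \<le> pos n (\<kappa> s)" using assms(1) region_half_point by blast
  then show ?thesis using s(2)[OF assms(2)] by simp
qed

text \<open>The elements below \<open>half_point\<close> have their end points among the events.\<close>

lemma card_below_half_point:
  "card {y. y < N \<and> region (pos n \<circ> \<kappa>) y \<subseteq> region (pos n \<circ> \<kappa>) (2 ^ half_point)} \<le> 2 ^ events N"
proof -
  let ?Y = "{y. y < N \<and> region (pos n \<circ> \<kappa>) y \<subseteq> region (pos n \<circ> \<kappa>) (2 ^ half_point)}"
  let ?E = "(+) n ` {j. j < N \<and> event j}"
  have "set_decode ` ?Y \<subseteq> Pow ?E"
  proof clarify
    fix y t assume y: "y < N" "region (pos n \<circ> \<kappa>) y \<subseteq> region (pos n \<circ> \<kappa>) (2 ^ half_point)"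
      and t: "t \<in> set_decode y"
    have half: "1 / 2 \<le> pos n (\<kappa> t)" by (rule below_half_point_pos[OF y(2) t])
    then have "n \<le> \<kappa> t" using pos_nonneg_iff[of n "\<kappa> t"] by simp
    then have "n \<le> t" by (auto simp: \<kappa>_def split: if_splits)
    then have "1 / 2 \<le> vdc (interleave event (t - n))" using half by (simp add: \<kappa>_def pos_def)
    then have "odd (interleave event (t - n))" by (rule vdc_ge_half)
    then have "event (t - n)" by (simp add: interleave_def split: if_splits)
    moreover have "t - n < N" using set_decode_less[OF t] y(1) by simp
    ultimately show "t \<in> ?E" using \<open>n \<le> t\<close> by (intro image_eqI[of _ _ "t - n"]) auto
  qed
  then have "card (set_decode ` ?Y) \<le> card (Pow ?E)" by (intro card_mono) auto
  moreover have "card ?E = events N"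
    unfolding count_event[symmetric] count_eq_card by (rule card_image) simp
  moreover have "card (set_decode ` ?Y) = card ?Y"
    by (rule card_image) (rule inj_on_inverseI[of _ set_encode], simp)
  ultimately show ?thesis by (simp add: card_Pow)
qed

text \<open>The leftmost end point lies in the dense part, where \<open>pos_gap\<close> finds a
  point before the next end point.\<close>

lemma no_atom_below_half_point:
  assumes "ba_atom slow c" "ba_le slow c (2 ^ half_point)"
  shows False
proof -
  have "c \<noteq> 0" using assms(1) by (auto simp: ba_atom_def interval_algebra_def)
  then have "set_decode c \<noteq> {}" by (metis set_decode_inverse set_encode_empty)
  then obtain s where s: "s \<in> set_decode c" "\<And>t. t \<in> set_decode c \<Longrightarrow> (pos n \<circ> \<kappa>) s \<le> (pos n \<circ> \<kappa>) t"
    using min_key[of "set_decode c" "pos n \<circ> \<kappa>"] by auto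
  have "1 / 2 \<le> pos n (\<kappa> s)"
    using below_half_point_pos[of c s] assms(2) s(1) by (simp add: slow.ba_le_interval)
  then have "n \<le> \<kappa> s" using pos_nonneg_iff[of n "\<kappa> s"] by simp
  then obtain K where K: "pos n (\<kappa> s + 2 ^ K) = pos n (\<kappa> s) + 1 / 2 ^ Suc K"
    "\<forall>t\<in>\<kappa> ` set_decode c. pos n (\<kappa> s) < pos n t \<longrightarrow> pos n (\<kappa> s + 2 ^ K) < pos n t"
    using pos_gap[of "\<kappa> ` set_decode c" n "\<kappa> s"] by auto
  define u where "u = inv \<kappa> (\<kappa> s + 2 ^ K)"
  have u: "\<kappa> u = \<kappa> s + 2 ^ K" using bij_\<kappa> by (simp add: u_def bij_is_surj surj_f_inv_f)
  show False
  proof (rule slow.atom_no_gap[OF assms(1) s])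
    show "(pos n \<circ> \<kappa>) s < (pos n \<circ> \<kappa>) u" by (simp add: u K(1))
    show "(pos n \<circ> \<kappa>) u < (pos n \<circ> \<kappa>) t" if "t \<in> set_decode c" "t \<noteq> s" for t
      using K(2) s(2)[OF that(1)] slow.key_eq_iff[of s t] that u by (auto simp: order_le_less)
  qed
qed

text \<open>An isomorphism from the interval algebra of \<open>pos n\<close> has to send many elements below \<open>half_point\<close>,
  and these appear only after many events.\<close>

lemma computed_by_isomorphism:
  assumes h: "is_iso (interval_algebra (pos n) 0) slow h" and rec: "recursive_in False True g 1 (unary h)"
  shows "f \<le>\<^sub>P\<^sub>R g"
proof -
  let ?F = "interval_algebra (pos n) 0"
  have bij: "bij h" using h by (simp add: is_iso_def)
  have le: "ba_le slow (h x) (h y)" if "ba_le ?F x y" for x y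
    using h that unfolding ba_le_def is_iso_def by metis
  \<comment> \<open>The numbers \<open>x\<close>, \<open>s\<close> and \<open>K\<close> depend on
    \<open>h\<close>, but they enter the algorithm only as constants.\<close>
  define x where "x = inv h (2 ^ half_point)"
  have hx: "h x = 2 ^ half_point" using bij by (simp add: x_def bij_is_surj surj_f_inv_f)
  have "x \<noteq> 0"
  proof
    assume "x = 0"
    then have "2 ^ half_point = (0 :: nat)" using h hx by (simp add: is_iso_def interval_algebra_def)
    then show False by simp
  qed
  then have "set_decode x \<noteq> {}" by (metis set_decode_inverse set_encode_empty)
  then obtain s where s: "s \<in> set_decode x" "\<And>t. t \<in> set_decode x \<Longrightarrow> pos n s \<le> pos n t"
    using min_key[of "set_decode x" "pos n"] by auto
  have s_less: "pos n s < pos n t" if "t \<in> set_decode x" "t \<noteq> s" for t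
    using s(2)[OF that(1)] that(2) pos.key_eq_iff[of n s t] by (auto simp: order_le_less)
  \<comment> \<open>Otherwise the singleton of \<open>s\<close> is an atom below \<open>x\<close>,
    and \<open>h\<close> would send it to an atom below \<open>2 ^ half_point\<close>.\<close>
  have "n \<le> s"
  proof (rule ccontr)
    assume "\<not> n \<le> s"
    then have s_n: "s < n" by simp
    let ?y = "set_encode {s, Suc s}"
    have "ba_atom ?F ?y" using s_n atoms_pos[of n] by blast
    then have "ba_atom slow (h ?y)" using iso_atom_iff[OF h] by blast
    moreover have "ba_le ?F ?y x"
      unfolding pos.ba_le_interval region_pos_successor[OF s_n]
      using pos.region_min[of s x n s] s s_less by simp
    ultimately show False using le[of ?y x] hx no_atom_below_half_point by simp
  qed
  then obtain K where K: "\<And>k. K \<le> k \<Longrightarrow> pos n (s + 2 ^ k) = pos n s + 1 / 2 ^ Suc k"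
    "\<And>k t. K \<le> k \<Longrightarrow> t \<in> set_decode x \<Longrightarrow> pos n s < pos n t \<Longrightarrow> pos n (s + 2 ^ k) < pos n t"
    using pos_gap[OF finite_set_decode, of n s x] by metis
  \<comment> \<open>Codes of the intervals from \<open>s\<close> to \<open>s + 2 ^ (K + k)\<close>:
    pairwise distinct elements below \<open>x\<close>, as they end before the next end point of
    \<open>x\<close>.\<close>
  define e where "e = (\<lambda>k. 2 ^ s + 2 ^ (s + 2 ^ (K + k)) :: nat)"
  have "inj e" by (rule injI) (simp add: e_def)
  have "ba_le ?F (e k) x" for k
  proof -
    have lt: "pos n s < pos n (s + 2 ^ (K + k))" using K(1)[of "K + k"] by simp
    have "e k = set_encode {s, s + 2 ^ (K + k)}" by (simp add: e_def)
    then have "region (pos n) (e k) = {p. pos n s \<le> pos n p \<and> pos n p < pos n (s + 2 ^ (K + k))}"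
      by (simp only: pos.region_pair[OF lt])
    moreover have "p \<in> region (pos n) x" if "pos n s \<le> pos n p" "pos n p < pos n (s + 2 ^ (K + k))" for p
    proof (rule pos.region_min[THEN iffD2, OF s])
      show "pos n p < pos n t" if "t \<in> set_decode x" "t \<noteq> s" for t
        using K(2)[of "K + k" t] s_less[OF that] that(1) \<open>pos n p < pos n (s + 2 ^ (K + k))\<close> by simp
    qed (assumption, rule that(1))
    ultimately show ?thesis unfolding pos.ba_le_interval by blast
  qed
  then have below: "region (pos n \<circ> \<kappa>) (h (e k)) \<subseteq> region (pos n \<circ> \<kappa>) (2 ^ half_point)" for k
    using le[of "e k" x] by (simp add: hx slow.ba_le_interval)
  \<comment> \<open>Exceeds the images of \<open>2 ^ Suc m\<close> such elements. Since at most
    \<open>2 ^ events (N m)\<close> numbers below \<open>N m\<close> qualify as images, more than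
    \<open>m\<close> events have occurred.\<close>
  define N where "N = (\<lambda>m. Suc (\<Sum>k<2 ^ Suc m. h (e k)))"
  have "f m = a (N m) m - 1" for m
  proof -
    have "h (e k) < N m" if "k < 2 ^ Suc m" for k
      using member_le_sum[of k "{..<2 ^ Suc m}" "\<lambda>k. h (e k)"] that by (simp add: N_def)
    then have "(\<lambda>k. h (e k)) ` {..<2 ^ Suc m} \<subseteq>
        {y. y < N m \<and> region (pos n \<circ> \<kappa>) y \<subseteq> region (pos n \<circ> \<kappa>) (2 ^ half_point)}"
      using below by blast
    from card_mono[OF _ this] have "card ((\<lambda>k. h (e k)) ` {..<2 ^ Suc m}) \<le> 2 ^ events (N m)"
      using card_below_half_point[of "N m"] by simp
    moreover have "card ((\<lambda>k. h (e k)) ` {..<2 ^ Suc m}) = 2 ^ Suc m"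
      using \<open>inj e\<close> bij by (subst card_image) (auto intro!: inj_onI dest: injD bij_is_inj[THEN injD])
    ultimately have "(2 :: nat) ^ Suc m \<le> 2 ^ events (N m)" by simp
    then have "m < events (N m)" by (simp add: power_le_imp_le_exp Suc_le_eq[symmetric] del: power_Suc)
    \<comment> \<open>The event that occurs when the counter stands at \<open>m\<close> is the
      convergence on input \<open>m\<close>, so \<open>f m\<close> can be read off at stage
      \<open>N m\<close>.\<close>
    then obtain j where j: "j < N m" "event j" "events j = m"
      using count_attains[of m event "N m"] by (auto simp: count_event)
    then obtain v where "a j m = Suc v" by (auto simp: event_def gr0_conv_Suc)
    then have "a (N m) m = Suc v" "f m = v"
      using a_mono[of j m v "N m"] j(1) a_iff[of m v] by (simp, blast)
    then show ?thesis by simp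
  qed
  moreover have "recursive_in False True g 1 (\<lambda>xs. a (N (xs ! 0)) (xs ! 0) - 1)"
    unfolding N_def e_def
    by (intro rec_intros rec_binary[OF recursive_in_primitive[OF a_prim]] rec_unary[OF rec]) auto
  ultimately show ?thesis by (simp add: le_PR_iff)
qed

end

lemma punctual_pos: "punctual (interval_algebra (pos n) 0)"
  by (rule punctual_interval_algebra)
    (use rec_pos_le in \<open>simp only: primitive_recursive_iff[of _ _ "\<lambda>_. 0"]\<close>)

lemma isomorphic_trans: "isomorphic A C \<Longrightarrow> isomorphic C E \<Longrightarrow> isomorphic A E"
  unfolding isomorphic_def using is_iso_comp by blast

text \<open>The standard copy is carried to the slow one through \<open>A\<close>: the inverse of
  one isomorphism is followed by another. This needs the bound on inverses in
  \<open>PrCat\<close>.\<close>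

theorem PrCat_subset_Cone:
  assumes "is_boolean_algebra A" "finite {a. ba_atom A a}"
  shows "PrCat A \<subseteq> Cone_Delta01"
proof
  fix d assume d: "d \<in> PrCat A"
  then obtain g where dg: "d = PR_equivalence `` {g}"
    unfolding PrCat_def PR_degrees_def by (auto elim: quotientE)
  have "g \<le>\<^sub>P\<^sub>R g" unfolding le_PR_iff by (rule rec_oracle) simp
  then have "g \<in> d" by (simp add: dg PR_equivalence_def)
  have le_g: "recursive_in False True g 1 (unary h)" if "le_PR_degree h d" for h
  proof -
    obtain g' where "h \<le>\<^sub>P\<^sub>R g'" "g' \<le>\<^sub>P\<^sub>R g"
      using \<open>le_PR_degree h d\<close> by (auto simp: le_PR_degree_def dg PR_equivalence_def)
    then show ?thesis unfolding le_PR_iff by (rule recursive_in_trans)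
  qed
  define n where "n = card {a. ba_atom A a}"
  let ?F = "interval_algebra (pos n) 0"
  have F: "isomorphic ?F A"
    by (rule isomorphic_if_card_atoms_eq[OF pos.is_boolean_algebra_interval assms(1) card_atoms_pos(1) assms(2)])
      (simp add: card_atoms_pos n_def)
  show "d \<in> Cone_Delta01"
    unfolding Cone_Delta01_def
  proof (intro CollectI conjI allI impI)
    show "d \<in> PR_degrees" using d by (simp add: PrCat_def)
    fix f assume "computable 1 (unary f)"
    then obtain r where r: "oracle_free r" "computes (\<lambda>_. 0) r 1 (unary f)"
      by (auto simp: computable_def)
    then have "has_arity r 1" by (simp add: computes_def)
    then obtain A' where A': "recursive_in False False (\<lambda>_. 0) (Suc 1) A'"
      "stagewise 1 A' (rf_eval (\<lambda>_. 0) r)"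
      using stagewise_approximation[OF r(1)] by blast
    interpret delay "\<lambda>s x. A' [s, x]" f n
    proof
      show "A' [s, x] = Suc v \<Longrightarrow> s \<le> t \<Longrightarrow> A' [t, x] = Suc v" for s x v t
        by (rule stagewise_mono[OF A'(2)]) auto
      show "f x = v \<longleftrightarrow> (\<exists>s. A' [s, x] = Suc v)" for x v
        using stagewise_iff[OF A'(2), of "[x]" v] r(2) by (simp add: computes_def)
      show "primitive_recursive 2 (\<lambda>xs. A' [xs ! 0, xs ! 1])"
        unfolding primitive_recursive_iff[of _ _ "\<lambda>_. 0"]
      proof (rule rec_cong)
        show "recursive_in False False (\<lambda>_. 0) 2 A'" using A'(1) by (simp add: numeral_2_eq_2)
        show "A' xs = A' [xs ! 0, xs ! 1]" if "length xs = 2" for xs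
          using that by (auto simp: length_Suc_conv numeral_2_eq_2)
      qed
    qed
    obtain gF where gF: "is_iso A ?F gF" "le_PR_degree (inv gF) d"
      using d F punctual_pos unfolding PrCat_def by blast
    obtain gC where gC: "is_iso A slow gC" "le_PR_degree gC d"
      using d isomorphic_trans[OF isomorphic_slow F] punctual_slow unfolding PrCat_def by blast
    have "is_iso ?F slow (gC \<circ> inv gF)" using is_iso_comp[OF is_iso_inv[OF gF(1)] gC(1)] .
    moreover have "recursive_in False True g 1 (unary (gC \<circ> inv gF))"
      unfolding comp_def
      by (intro rec_unary[OF le_g[OF gC(2)]] rec_unary[OF le_g[OF gF(2)]] rec_intros) auto
    ultimately have "f \<le>\<^sub>P\<^sub>R g" by (rule computed_by_isomorphism)
    then show "le_PR_degree f d" using \<open>g \<in> d\<close> by (auto simp: le_PR_degree_def)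
  qed
qed

theorem theorem4p2:
  fixes B :: ba_structure
  assumes "is_boolean_algebra B"
    and "punctual B"
    and "relatively_computably_categorical B"
  shows "PrCat B = Cone_Delta01"
  using PrCat_subset_Cone[OF assms(1) relatively_computably_categorical_finite_atoms[OF assms(1,3)]]
    Cone_subset_PrCat[OF assms(3)]
  by blast

end
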